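(* Let $K$ be a strongly connected nice simplicial complex. The complete unfolding $p:\widetilde{K}\to K$ is the regularization of the partial unfolding $r:\widehat{K}\to K$.
   Context: $K$ is a locally finite simplicial complex, pure of dimension $d$ (every face lies in a $d$-dimensional face), identified with its geometric realization. Faces are non-empty simplices; $d$-dimensional faces are facets, codimension-$1$ faces are ridges; two distinct facets are neighbors if they share a ridge; $V(\sigma)$ is the vertex set of $\sigma$. A pure complex is strongly connected if any two facets are joined by a facet path, i.e. a sequence of facets with consecutive ones neighbors. $\operatorname{st}\kappa$ is the subcomplex of all faces of simplices containing $\kappa$; $\operatorname{lk}\kappa$ is the link. $K$ is locally strongly connected if $\operatorname{st}\kappa$ is strongly connected for each face $\kappa$; locally strongly simply connected if $\operatorname{lk}\kappa$ is simply connected for each face $\kappa$ with $\operatorname{codim}\kappa>2$; nice if both hold. For neighboring facets $\sigma,\tau$ the perspectivity $\langle\sigma,\tau\rangle:V(\sigma)\to V(\tau)$ is the bijection fixing all common vertices and sending the vertex of $\sigma$ not in $\tau$ to the vertex of $\tau$ not in $\sigma$. For a facet path $\gamma=(\sigma_0,\dots,\sigma_n)$ put $\langle\gamma\rangle=\langle\sigma_0,\sigma_1\rangle\cdots\langle\sigma_{n-1},\sigma_n\rangle$ (maps composed left to right) and $\gamma^-=(\sigma_n,\dots,\sigma_0)$. Complete unfolding. Fix a facet $\sigma_0$ and a bijective coloring $b_0:V(\sigma_0)\to\{0,\dots,d\}$. A coloring of $V(\sigma)$, $\sigma$ a facet, is admissible if it has the form $\langle\eta^-\rangle b_0$ for some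 facet path $\eta$ from $\sigma_0$ to $\sigma$. Take a copy $(\sigma,b)$ of the simplex $\sigma$ for each facet $\sigma$ and each admissible coloring $b$ of $V(\sigma)$; for neighbors $\sigma,\tau$ glue $(\sigma,b)$ and $(\tau,c)$ by the identity along the common ridge $\rho$ whenever $b$ and $c$ coincide on the vertices of $\rho$. The quotient of the disjoint union by the generated equivalence relation is $\widetilde{K}$ (independent, up to isomorphism, of the choices), and $p$ is induced by the affine isomorphisms $(\sigma,b)\to\sigma$. Partial unfolding. Take a copy $(\sigma,v)$ of $\sigma$ for each facet $\sigma$ and each $v\in V(\sigma)$; for neighbors $\sigma,\tau$ glue $(\sigma,v)$ and $(\tau,w)$ by the identity along the common ridge whenever $w$ is the image of $v$ under $\langle\sigma,\tau\rangle$. The quotient is $\widehat{K}$, and $r$ is induced by the affine isomorphisms $(\sigma,v)\to\sigma$. Branched coverings. Both $p$ and $r$ are branched coverings in the sense of Fox (completions, in the sense of Fox, of coverings over a dense subset of $K$ that is locally connected in $K$); here disconnected covering spaces are allowed. For a branched covering $g:Y\to Z$ let $Z_{\rm ord}\subseteq Z$ be the unique maximal subset over which $g$ restricts to a covering; the covering $g^{-1}(Z_{\rm ord})\to Z_{\rm ord}$ is the covering associated with $g$. A branched covering is regular if its associated covering is regular, and one branched covering is a regularization of another if the same holds for their associated coverings. Regularization of coverings. For a connected covering $f:X\to Y$ with base points $x_0$, $y_0=f(x_0)$, the characteristic subgroup is $f_*(\pi_1(X,x_0))\le\pi_1(Y,y_0)$; $f$ is regular if this subgroup is normal; the regularization of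 $f$ is the (connected, regular) covering of $Y$ whose characteristic subgroup is the core $\bigcap_{g}g^{-1}Hg$ of the characteristic subgroup $H$ of $f$ in $\pi_1(Y,y_0)$. Equivalently, and this applies also to disconnected $X$, it is the connected regular covering whose characteristic subgroup is the kernel of the monodromy homomorphism $\mathfrak{m}_f:\pi_1(Y,y_0)\to\operatorname{Sym}(f^{-1}(y_0))$, which sends $[\gamma]$ to the permutation taking $x\in f^{-1}(y_0)$ to the endpoint of the lift of $\gamma$ starting at $x$. Coverings are considered up to equivalence. *)

theory Defs
  imports "HOL-Analysis.Analysis" "HOL-Algebra.Bij" "HOL-Algebra.Coset"
begin

section \<open>Quotient topologies\<close>

definition quotient_topology :: "'a topology \<Rightarrow> ('a \<Rightarrow> 'b) \<Rightarrow> 'b topology" where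
  "quotient_topology X f =
     topology (\<lambda>U. U \<subseteq> f ` topspace X \<and> openin X {x \<in> topspace X. f x \<in> U})"

lemma openin_quotient_topology:
  "openin (quotient_topology X f) U \<longleftrightarrow>
     U \<subseteq> f ` topspace X \<and> openin X {x \<in> topspace X. f x \<in> U}"
proof -
  have "istopology (\<lambda>U. U \<subseteq> f ` topspace X \<and> openin X {x \<in> topspace X. f x \<in> U})"
    unfolding istopology_def
  proof (intro conjI allI impI)
    fix S T
    assume S: "S \<subseteq> f ` topspace X \<and> openin X {x \<in> topspace X. f x \<in> S}"
      and T: "T \<subseteq> f ` topspace X \<and> openin X {x \<in> topspace X. f x \<in> T}"
    show "S \<inter> T \<subseteq> f ` topspace X" using S by blast
    have "{x \<in> topspace X. f x \<in> S \<inter> T} =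
        {x \<in> topspace X. f x \<in> S} \<inter> {x \<in> topspace X. f x \<in> T}" by blast
    then show "openin X {x \<in> topspace X. f x \<in> S \<inter> T}" using S T by auto
  next
    fix \<K>
    assume A: "\<forall>K\<in>\<K>. K \<subseteq> f ` topspace X \<and> openin X {x \<in> topspace X. f x \<in> K}"
    then show "\<Union>\<K> \<subseteq> f ` topspace X" by blast
    have "{x \<in> topspace X. f x \<in> \<Union>\<K>} = (\<Union>K\<in>\<K>. {x \<in> topspace X. f x \<in> K})" by blast
    then show "openin X {x \<in> topspace X. f x \<in> \<Union>\<K>}" using A by auto
  qed
  then show ?thesis
    by (simp add: quotient_topology_def)
qed

lemma topspace_quotient_topology [simp]:
  "topspace (quotient_topology X f) = f ` topspace X"
proof -
  have "openin (quotient_topology X f) (f ` topspace X)"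
  proof -
    have "{x \<in> topspace X. f x \<in> f ` topspace X} = topspace X" by blast
    then show ?thesis by (simp add: openin_quotient_topology)
  qed
  moreover have "topspace (quotient_topology X f) \<subseteq> f ` topspace X"
    using openin_quotient_topology[of X f "topspace (quotient_topology X f)"] by simp
  ultimately show ?thesis
    by (simp add: openin_subset subset_antisym)
qed

lemma quotient_map_quotient_topology: "quotient_map X (quotient_topology X f) f"
  by (simp add: quotient_map_def openin_quotient_topology)


section \<open>Simplicial complexes\<close>

text \<open>A complex is given by its set of faces; a face is its (non-empty, finite) vertex set,
  so that \<open>V(\<sigma>) = \<sigma>\<close>.\<close>

definition abstract_complex :: "'v set set \<Rightarrow> bool" where
  "abstract_complex K \<longleftrightarrow>
     (\<forall>\<sigma>\<in>K. finite \<sigma> \<and> \<sigma> \<noteq> {}) \<and> (\<forall>\<sigma>\<in>K. \<forall>\<tau>. \<tau> \<noteq> {} \<and> \<tau> \<subseteq> \<sigma> \<longrightarrow> \<tau> \<in> K)"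

definition locally_finite :: "'v set set \<Rightarrow> bool" where
  "locally_finite K \<longleftrightarrow> (\<forall>v. finite {\<sigma>\<in>K. v \<in> \<sigma>})"

definition face_dim :: "'v set \<Rightarrow> nat" where
  "face_dim \<sigma> = card \<sigma> - 1"

definition codim :: "nat \<Rightarrow> 'v set \<Rightarrow> nat" where
  "codim d \<sigma> = d - face_dim \<sigma>"

definition facets :: "'v set set \<Rightarrow> nat \<Rightarrow> 'v set set" where
  "facets K d = {\<sigma>\<in>K. face_dim \<sigma> = d}"

definition pure :: "'v set set \<Rightarrow> nat \<Rightarrow> bool" where
  "pure K d \<longleftrightarrow> (\<forall>\<sigma>\<in>K. face_dim \<sigma> \<le> d) \<and> (\<forall>\<sigma>\<in>K. \<exists>\<tau>\<in>facets K d. \<sigma> \<subseteq> \<tau>)"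

definition ridges :: "'v set set \<Rightarrow> nat \<Rightarrow> 'v set set" where
  "ridges K d = {\<rho>\<in>K. codim d \<rho> = 1}"

definition neighbors :: "'v set set \<Rightarrow> nat \<Rightarrow> 'v set \<Rightarrow> 'v set \<Rightarrow> bool" where
  "neighbors K d \<sigma> \<tau> \<longleftrightarrow>
     \<sigma> \<in> facets K d \<and> \<tau> \<in> facets K d \<and> \<sigma> \<noteq> \<tau> \<and> (\<exists>\<rho>\<in>ridges K d. \<rho> \<subseteq> \<sigma> \<and> \<rho> \<subseteq> \<tau>)"

definition facet_path :: "'v set set \<Rightarrow> nat \<Rightarrow> 'v set list \<Rightarrow> bool" where
  "facet_path K d \<gamma> \<longleftrightarrow> \<gamma> \<noteq> [] \<and> set \<gamma> \<subseteq> facets K d \<and> successively (neighbors K d) \<gamma>"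

definition strongly_connected :: "'v set set \<Rightarrow> nat \<Rightarrow> bool" where
  "strongly_connected K d \<longleftrightarrow> pure K d \<and>
     (\<forall>\<sigma>\<in>facets K d. \<forall>\<tau>\<in>facets K d. \<exists>\<gamma>. facet_path K d \<gamma> \<and> hd \<gamma> = \<sigma> \<and> last \<gamma> = \<tau>)"

definition st :: "'v set set \<Rightarrow> 'v set \<Rightarrow> 'v set set" where
  "st K \<kappa> = {\<sigma>\<in>K. \<exists>\<tau>\<in>K. \<kappa> \<subseteq> \<tau> \<and> \<sigma> \<subseteq> \<tau>}"

definition lk :: "'v set set \<Rightarrow> 'v set \<Rightarrow> 'v set set" where
  "lk K \<kappa> = {\<sigma>\<in>K. \<sigma> \<inter> \<kappa> = {} \<and> \<sigma> \<union> \<kappa> \<in> K}"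

text \<open>The geometric realization, in barycentric coordinates, with the weak topology: it is
  glued from the simplices, each of which carries its Euclidean topology.\<close>

definition simplex_pts :: "'v set \<Rightarrow> ('v \<Rightarrow> real) set" where
  "simplex_pts \<sigma> = {x. (\<forall>v. 0 \<le> x v) \<and> (\<forall>v. v \<notin> \<sigma> \<longrightarrow> x v = 0) \<and> sum x \<sigma> = 1}"

definition realization :: "'v set set \<Rightarrow> ('v \<Rightarrow> real) topology" where
  "realization K = quotient_topology (sum_topology (\<lambda>\<sigma>. top_of_set (simplex_pts \<sigma>)) K) snd"

lemma topspace_realization: "topspace (realization K) = (\<Union>\<sigma>\<in>K. simplex_pts \<sigma>)"
  by (force simp: realization_def)

lemma openin_realization:
  "openin (realization K) U \<longleftrightarrow>
     U \<subseteq> (\<Union>\<sigma>\<in>K. simplex_pts \<sigma>) \<and>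
     (\<forall>\<sigma>\<in>K. openin (top_of_set (simplex_pts \<sigma>)) (simplex_pts \<sigma> \<inter> U))"
proof -
  let ?S = "sum_topology (\<lambda>\<sigma>. top_of_set (simplex_pts \<sigma>)) K"
  have top: "topspace ?S = Sigma K simplex_pts" by (simp add: comp_def)
  have slice: "{x. (\<sigma>, x) \<in> {a \<in> Sigma K simplex_pts. snd a \<in> U}} = simplex_pts \<sigma> \<inter> U"
    if "\<sigma> \<in> K" for \<sigma>
    using that by auto
  have img: "snd ` Sigma K simplex_pts = (\<Union>\<sigma>\<in>K. simplex_pts \<sigma>)" by force
  have sub: "{a \<in> Sigma K simplex_pts. snd a \<in> U} \<subseteq> Sigma K simplex_pts" by blast
  have "openin ?S {a \<in> Sigma K simplex_pts. snd a \<in> U} \<longleftrightarrow>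
      (\<forall>\<sigma>\<in>K. openin (top_of_set (simplex_pts \<sigma>)) (simplex_pts \<sigma> \<inter> U))"
    unfolding openin_sum_topology comp_def topspace_euclidean_subtopology using sub
    by (simp only: slice simp_thms cong: ball_cong)
  then show ?thesis
    unfolding realization_def openin_quotient_topology top img by simp
qed


section \<open>Fundamental groups\<close>

text \<open>The library has path homotopy only for subsets of types of class topological-space;
  these are the same notions for abstract topologies.\<close>

definition path_homotopic :: "'a topology \<Rightarrow> (real \<Rightarrow> 'a) \<Rightarrow> (real \<Rightarrow> 'a) \<Rightarrow> bool" where
  "path_homotopic X p q \<longleftrightarrow>
     homotopic_with (\<lambda>r. r 0 = p 0 \<and> r 1 = p 1) (top_of_set {0..1}) X p q"

definition path_class :: "'a topology \<Rightarrow> (real \<Rightarrow> 'a) \<Rightarrow> (real \<Rightarrow> 'a) set" where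
  "path_class X p = {q. path_homotopic X p q}"

definition loops_at :: "'a topology \<Rightarrow> 'a \<Rightarrow> (real \<Rightarrow> 'a) set" where
  "loops_at X x = {p. pathin X p \<and> p 0 = x \<and> p 1 = x}"

definition path_join :: "(real \<Rightarrow> 'a) \<Rightarrow> (real \<Rightarrow> 'a) \<Rightarrow> real \<Rightarrow> 'a" where
  "path_join p q = (\<lambda>t. if t \<le> 1/2 then p (2 * t) else q (2 * t - 1))"

definition fundamental_group :: "'a topology \<Rightarrow> 'a \<Rightarrow> (real \<Rightarrow> 'a) set monoid" where
  "fundamental_group X x =
     \<lparr>carrier = path_class X ` loops_at X x,
      mult = (\<lambda>A B. \<Union>p\<in>A. \<Union>q\<in>B. path_class X (path_join p q)),
      one = path_class X (\<lambda>_. x)\<rparr>"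

definition induced_hom :: "'b topology \<Rightarrow> ('a \<Rightarrow> 'b) \<Rightarrow> (real \<Rightarrow> 'a) set \<Rightarrow> (real \<Rightarrow> 'b) set" where
  "induced_hom Y f A = (\<Union>p\<in>A. path_class Y (f \<circ> p))"

definition simply_connected_space :: "'a topology \<Rightarrow> bool" where
  "simply_connected_space X \<longleftrightarrow> path_connected_space X \<and>
     (\<forall>x\<in>topspace X. carrier (fundamental_group X x) = {\<one>\<^bsub>fundamental_group X x\<^esub>})"

definition locally_strongly_connected :: "'v set set \<Rightarrow> nat \<Rightarrow> bool" where
  "locally_strongly_connected K d \<longleftrightarrow> (\<forall>\<kappa>\<in>K. strongly_connected (st K \<kappa>) d)"

definition locally_strongly_simply_connected :: "'v set set \<Rightarrow> nat \<Rightarrow> bool" where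
  "locally_strongly_simply_connected K d \<longleftrightarrow>
     (\<forall>\<kappa>\<in>K. codim d \<kappa> > 2 \<longrightarrow> simply_connected_space (realization (lk K \<kappa>)))"

definition nice :: "'v set set \<Rightarrow> nat \<Rightarrow> bool" where
  "nice K d \<longleftrightarrow> locally_strongly_connected K d \<and> locally_strongly_simply_connected K d"


section \<open>Coverings, monodromy and regularization\<close>

definition preim :: "'a topology \<Rightarrow> ('a \<Rightarrow> 'b) \<Rightarrow> 'b set \<Rightarrow> 'a set" where
  "preim X f S = {x \<in> topspace X. f x \<in> S}"

definition covering_map :: "'a topology \<Rightarrow> 'b topology \<Rightarrow> ('a \<Rightarrow> 'b) \<Rightarrow> bool" where
  "covering_map X Y f \<longleftrightarrow>
     continuous_map X Y f \<and> f ` topspace X = topspace Y \<and>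
     (\<forall>y\<in>topspace Y. \<exists>U. openin Y U \<and> y \<in> U \<and>
        (\<exists>\<V>. \<Union>\<V> = preim X f U \<and> (\<forall>V\<in>\<V>. openin X V) \<and> pairwise disjnt \<V> \<and>
             (\<forall>V\<in>\<V>. homeomorphic_map (subtopology X V) (subtopology Y U) f)))"

definition char_subgroup :: "'a topology \<Rightarrow> 'b topology \<Rightarrow> ('a \<Rightarrow> 'b) \<Rightarrow> 'a \<Rightarrow> (real \<Rightarrow> 'b) set set" where
  "char_subgroup X Y f x = induced_hom Y f ` carrier (fundamental_group X x)"

definition regular_covering :: "'a topology \<Rightarrow> 'b topology \<Rightarrow> ('a \<Rightarrow> 'b) \<Rightarrow> bool" where
  "regular_covering X Y f \<longleftrightarrow>
     covering_map X Y f \<and> topspace X \<noteq> {} \<and> connected_space X \<and>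
     (\<forall>x\<in>topspace X. char_subgroup X Y f x \<lhd> fundamental_group Y (f x))"

text \<open>Permutations are composed from left to right, so that monodromy is a homomorphism.\<close>

definition sym_group :: "'a set \<Rightarrow> ('a \<Rightarrow> 'a) monoid" where
  "sym_group S = (BijGroup S)\<lparr>mult := (\<lambda>g h. compose S h g)\<rparr>"

text \<open>For a covering the endpoint described below exists, and depends neither on the
  representing loop nor on the choice of the lift outside the unit interval.\<close>

definition monodromy :: "'a topology \<Rightarrow> ('a \<Rightarrow> 'b) \<Rightarrow> 'b \<Rightarrow> (real \<Rightarrow> 'b) set \<Rightarrow> 'a \<Rightarrow> 'a" where
  "monodromy X f y A =
     (\<lambda>x\<in>preim X f {y}.
        THE e. \<exists>p\<in>A. \<exists>q. pathin X q \<and> q 0 = x \<and> (\<forall>t\<in>{0..1}. f (q t) = p t) \<and> q 1 = e)"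

definition monodromy_kernel :: "'a topology \<Rightarrow> 'b topology \<Rightarrow> ('a \<Rightarrow> 'b) \<Rightarrow> 'b \<Rightarrow> (real \<Rightarrow> 'b) set set" where
  "monodromy_kernel X Y f y =
     kernel (fundamental_group Y y) (sym_group (preim X f {y})) (monodromy X f y)"

text \<open>The covering \<open>f\<close> is (up to equivalence) the regularization of the covering \<open>g\<close>, the
  total space of which may be disconnected.\<close>

definition regularization_of ::
    "'a topology \<Rightarrow> ('a \<Rightarrow> 'b) \<Rightarrow> 'c topology \<Rightarrow> ('c \<Rightarrow> 'b) \<Rightarrow> 'b topology \<Rightarrow> bool" where
  "regularization_of X f X' g Y \<longleftrightarrow>
     covering_map X' Y g \<and> regular_covering X Y f \<and>
     (\<forall>x\<in>topspace X. char_subgroup X Y f x = monodromy_kernel X' Y g (f x))"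


section \<open>Branched coverings in the sense of Fox\<close>

definition preim_components :: "'a topology \<Rightarrow> ('a \<Rightarrow> 'b) \<Rightarrow> 'b set \<Rightarrow> 'a set set" where
  "preim_components Y g W = connected_components_of (subtopology Y (preim Y g W))"

text \<open>A spread: the components of the preimages of open sets form a basis.\<close>

definition spread :: "'a topology \<Rightarrow> 'b topology \<Rightarrow> ('a \<Rightarrow> 'b) \<Rightarrow> bool" where
  "spread Y Z g \<longleftrightarrow>
     locally_connected_space Y \<and> t1_space Y \<and> locally_connected_space Z \<and> t1_space Z \<and>
     continuous_map Y Z g \<and>
     (\<forall>W. openin Z W \<longrightarrow> (\<forall>C\<in>preim_components Y g W. openin Y C)) \<and>
     (\<forall>V y. openin Y V \<and> y \<in> V \<longrightarrow>
        (\<exists>W. openin Z W \<and> (\<exists>C\<in>preim_components Y g W. y \<in> C \<and> C \<subseteq> V)))"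

definition complete_spread :: "'a topology \<Rightarrow> 'b topology \<Rightarrow> ('a \<Rightarrow> 'b) \<Rightarrow> bool" where
  "complete_spread Y Z g \<longleftrightarrow> spread Y Z g \<and>
     (\<forall>z\<in>topspace Z. \<forall>c.
        (\<forall>W. openin Z W \<and> z \<in> W \<longrightarrow> c W \<in> preim_components Y g W) \<and>
        (\<forall>W W'. openin Z W \<and> openin Z W' \<and> z \<in> W \<and> W \<subseteq> W' \<longrightarrow> c W \<subseteq> c W') \<longrightarrow>
        (\<Inter>W\<in>{W. openin Z W \<and> z \<in> W}. c W) \<noteq> {})"

definition locally_connected_in :: "'a set \<Rightarrow> 'a topology \<Rightarrow> bool" where
  "locally_connected_in S Y \<longleftrightarrow>
     (\<forall>V y. openin Y V \<and> y \<in> V \<longrightarrow> (\<exists>B. openin Y B \<and> y \<in> B \<and> B \<subseteq> V \<and> connectedin Y (B \<inter> S)))"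

definition dense_in :: "'a set \<Rightarrow> 'a topology \<Rightarrow> bool" where
  "dense_in S Y \<longleftrightarrow> S \<subseteq> topspace Y \<and> (closure_of) Y S = topspace Y"

text \<open>The map \<open>g\<close> on \<open>Y\<close> is the completion of its restriction to \<open>S\<close>.\<close>

definition completion_of :: "'a topology \<Rightarrow> 'b topology \<Rightarrow> ('a \<Rightarrow> 'b) \<Rightarrow> 'a set \<Rightarrow> bool" where
  "completion_of Y Z g S \<longleftrightarrow>
     spread (subtopology Y S) Z g \<and> complete_spread Y Z g \<and>
     dense_in S Y \<and> locally_connected_in S Y"

definition branched_covering :: "'a topology \<Rightarrow> 'b topology \<Rightarrow> ('a \<Rightarrow> 'b) \<Rightarrow> bool" where
  "branched_covering Y Z g \<longleftrightarrow>
     (\<exists>D S. dense_in D Z \<and> locally_connected_in D Z \<and>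
        covering_map (subtopology Y S) (subtopology Z D) g \<and> completion_of Y Z g S)"

text \<open>Maximality refers to open subsets: over a single point with discrete fiber any map restricts
  to a covering, so that without openness there is no unique maximal subset.\<close>

definition ordinary_set :: "'a topology \<Rightarrow> 'b topology \<Rightarrow> ('a \<Rightarrow> 'b) \<Rightarrow> 'b set" where
  "ordinary_set Y Z g =
     \<Union>{U. openin Z U \<and> covering_map (subtopology Y (preim Y g U)) (subtopology Z U) g}"

definition associated_space :: "'a topology \<Rightarrow> 'b topology \<Rightarrow> ('a \<Rightarrow> 'b) \<Rightarrow> 'a topology" where
  "associated_space Y Z g = subtopology Y (preim Y g (ordinary_set Y Z g))"

lemma ordinary_set_greatest:
  assumes "openin Z U" "covering_map (subtopology Y (preim Y g U)) (subtopology Z U) g"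
  shows "U \<subseteq> ordinary_set Y Z g"
  using assms by (auto simp: ordinary_set_def)

lemma openin_ordinary_set: "openin Z (ordinary_set Y Z g)"
  by (auto simp: ordinary_set_def)

lemma covering_map_ordinary_set:
  assumes cont: "continuous_map Y Z g"
  shows "covering_map (associated_space Y Z g) (subtopology Z (ordinary_set Y Z g)) g"
proof -
  let ?O = "ordinary_set Y Z g"
  let ?P = "preim Y g"
  have sub: "?O \<subseteq> topspace Z" using openin_ordinary_set openin_subset by metis
  have op: "openin Y (?P U)" if "openin Z U" for U
    using that cont by (auto simp: preim_def continuous_map_def)
  have mem: "\<exists>U. openin Z U \<and> y \<in> U \<and> U \<subseteq> ?O \<and>
      covering_map (subtopology Y (?P U)) (subtopology Z U) g" if "y \<in> ?O" for y
    using that ordinary_set_greatest unfolding ordinary_set_def by blast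
  have "continuous_map (associated_space Y Z g) (subtopology Z ?O) g"
    using cont by (auto simp: associated_space_def continuous_map_in_subtopology preim_def
        continuous_map_from_subtopology)
  moreover have "g ` topspace (associated_space Y Z g) = topspace (subtopology Z ?O)"
  proof
    show "g ` topspace (associated_space Y Z g) \<subseteq> topspace (subtopology Z ?O)"
      using sub by (auto simp: associated_space_def preim_def)
    show "topspace (subtopology Z ?O) \<subseteq> g ` topspace (associated_space Y Z g)"
    proof
      fix y assume "y \<in> topspace (subtopology Z ?O)"
      then have "y \<in> ?O" by simp
      then obtain U where U: "openin Z U" "y \<in> U" "U \<subseteq> ?O"
        and c: "covering_map (subtopology Y (?P U)) (subtopology Z U) g" using mem by blast
      have "y \<in> g ` topspace (subtopology Y (?P U))"
        using c U openin_subset[OF U(1)] by (auto simp: covering_map_def)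
      then show "y \<in> g ` topspace (associated_space Y Z g)"
        using U(3) by (auto simp: associated_space_def preim_def)
    qed
  qed
  moreover have "\<exists>V. openin (subtopology Z ?O) V \<and> y \<in> V \<and>
        (\<exists>\<V>. \<Union>\<V> = preim (associated_space Y Z g) g V \<and> (\<forall>W\<in>\<V>. openin (associated_space Y Z g) W) \<and>
             pairwise disjnt \<V> \<and>
             (\<forall>W\<in>\<V>. homeomorphic_map (subtopology (associated_space Y Z g) W)
                      (subtopology (subtopology Z ?O) V) g))"
    if y: "y \<in> topspace (subtopology Z ?O)" for y
  proof -
    from y have "y \<in> ?O" by simp
    then obtain U where U: "openin Z U" "y \<in> U" "U \<subseteq> ?O"
      and c: "covering_map (subtopology Y (?P U)) (subtopology Z U) g" using mem by blast
    have "y \<in> topspace (subtopology Z U)" using U openin_subset by fastforce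
    with c obtain V \<V> where V: "openin (subtopology Z U) V" "y \<in> V"
      and \<V>: "\<Union>\<V> = preim (subtopology Y (?P U)) g V"
        "\<And>W. W \<in> \<V> \<Longrightarrow> openin (subtopology Y (?P U)) W" "pairwise disjnt \<V>"
        "\<And>W. W \<in> \<V> \<Longrightarrow> homeomorphic_map (subtopology (subtopology Y (?P U)) W)
                      (subtopology (subtopology Z U) V) g"
      unfolding covering_map_def by metis
    have VU: "V \<subseteq> U" using V(1) openin_subset by fastforce
    have VZ: "openin Z V" using V(1) U(1) by (simp add: openin_open_subtopology)
    have PU: "?P U \<subseteq> ?P ?O" using U(3) by (auto simp: preim_def)
    have W1: "W \<subseteq> ?P U" "openin Y W" if "W \<in> \<V>" for W
      using \<V>(2)[OF that] op[OF U(1)] by (simp_all add: openin_open_subtopology)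
    have a: "openin (subtopology Z ?O) V"
      using VZ VU U(3) openin_ordinary_set[of Z Y g] by (simp add: openin_open_subtopology)
    have b: "\<Union>\<V> = preim (associated_space Y Z g) g V"
      using \<V>(1) VU U(3) by (auto simp: preim_def associated_space_def)
    have e: "openin (associated_space Y Z g) W" if "W \<in> \<V>" for W
      using W1[OF that] PU op[OF openin_ordinary_set[of Z Y g]]
      by (auto simp: associated_space_def openin_open_subtopology)
    have f: "homeomorphic_map (subtopology (associated_space Y Z g) W)
                      (subtopology (subtopology Z ?O) V) g" if "W \<in> \<V>" for W
    proof -
      have "subtopology (associated_space Y Z g) W = subtopology (subtopology Y (?P U)) W"
      proof -
        have "?P ?O \<inter> W = W" "?P U \<inter> W = W" using W1(1)[OF that] PU by blast+
        then show ?thesis unfolding associated_space_def subtopology_subtopology by simp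
      qed
      moreover have "subtopology (subtopology Z ?O) V = subtopology (subtopology Z U) V"
      proof -
        have "?O \<inter> V = V" "U \<inter> V = V" using VU U(3) by blast+
        then show ?thesis unfolding subtopology_subtopology by simp
      qed
      ultimately show ?thesis using \<V>(4)[OF that] by simp
    qed
    show ?thesis
      by (intro exI[of _ V] exI[of _ \<V>] conjI ballI a V(2) b e \<V>(3) f)
  qed
  ultimately show ?thesis by (simp add: covering_map_def)
qed

text \<open>Being a regularization is a relation between branched coverings, and the associated
  coverings have to be coverings of the same space.\<close>

definition branched_regularization_of ::
    "'a topology \<Rightarrow> ('a \<Rightarrow> 'b) \<Rightarrow> 'c topology \<Rightarrow> ('c \<Rightarrow> 'b) \<Rightarrow> 'b topology \<Rightarrow> bool" where
  "branched_regularization_of Y g Y' h Z \<longleftrightarrow>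
     branched_covering Y Z g \<and> branched_covering Y' Z h \<and>
     ordinary_set Y Z g = ordinary_set Y' Z h \<and>
     regularization_of (associated_space Y Z g) g (associated_space Y' Z h) h
       (subtopology Z (ordinary_set Y' Z h))"


section \<open>Projectivities and unfoldings\<close>

text \<open>Only the values of \<open>perspectivity \<sigma> \<tau>\<close> on \<open>\<sigma>\<close> are relevant, likewise for
  \<open>projectivity \<gamma>\<close> on \<open>hd \<gamma>\<close>.\<close>

definition perspectivity :: "'v set \<Rightarrow> 'v set \<Rightarrow> 'v \<Rightarrow> 'v" where
  "perspectivity \<sigma> \<tau> v = (if v \<in> \<tau> then v else the_elem (\<tau> - \<sigma>))"

fun projectivity :: "'v set list \<Rightarrow> 'v \<Rightarrow> 'v" where
  "projectivity (\<sigma> # \<tau> # \<gamma>) = projectivity (\<tau> # \<gamma>) \<circ> perspectivity \<sigma> \<tau>"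
| "projectivity _ = id"

definition admissible ::
    "'v set set \<Rightarrow> nat \<Rightarrow> 'v set \<Rightarrow> ('v \<Rightarrow> nat) \<Rightarrow> 'v set \<Rightarrow> ('v \<Rightarrow> nat) \<Rightarrow> bool" where
  "admissible K d \<sigma>0 b0 \<sigma> b \<longleftrightarrow>
     (\<exists>\<eta>. facet_path K d \<eta> \<and> hd \<eta> = \<sigma>0 \<and> last \<eta> = \<sigma> \<and>
          b = restrict (b0 \<circ> projectivity (rev \<eta>)) \<sigma>)"

text \<open>Copies of facets are indexed by pairs of a facet and a label (a coloring or a vertex);
  \<open>I\<close> is the set of copies, and \<open>G\<close> tells which copies of neighbors are glued. The common ridge
  of neighbors is their intersection.\<close>

definition glue_step ::
    "'v set set \<Rightarrow> nat \<Rightarrow> ('v set \<times> 'l) set \<Rightarrow> ('v set \<times> 'l \<Rightarrow> 'v set \<times> 'l \<Rightarrow> bool) \<Rightarrow>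
     ('v set \<times> 'l) \<times> ('v \<Rightarrow> real) \<Rightarrow> ('v set \<times> 'l) \<times> ('v \<Rightarrow> real) \<Rightarrow> bool" where
  "glue_step K d I G a a' \<longleftrightarrow>
     fst a \<in> I \<and> fst a' \<in> I \<and> neighbors K d (fst (fst a)) (fst (fst a')) \<and> G (fst a) (fst a') \<and>
     snd a = snd a' \<and> snd a \<in> simplex_pts (fst (fst a) \<inter> fst (fst a'))"

definition unfolding_space ::
    "'v set set \<Rightarrow> nat \<Rightarrow> ('v set \<times> 'l) set \<Rightarrow> ('v set \<times> 'l \<Rightarrow> 'v set \<times> 'l \<Rightarrow> bool) \<Rightarrow>
     (('v set \<times> 'l) \<times> ('v \<Rightarrow> real)) set topology" where
  "unfolding_space K d I G =
     quotient_topology (sum_topology (\<lambda>i. top_of_set (simplex_pts (fst i))) I)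
       (\<lambda>a. {a'. equivclp (glue_step K d I G) a a'})"

text \<open>All members of a class have the same barycentric coordinates.\<close>

definition unfolding_map :: "(('v set \<times> 'l) \<times> ('v \<Rightarrow> real)) set \<Rightarrow> 'v \<Rightarrow> real" where
  "unfolding_map A = the_elem (snd ` A)"

definition complete_unfolding ::
    "'v set set \<Rightarrow> nat \<Rightarrow> 'v set \<Rightarrow> ('v \<Rightarrow> nat) \<Rightarrow>
     (('v set \<times> ('v \<Rightarrow> nat)) \<times> ('v \<Rightarrow> real)) set topology" where
  "complete_unfolding K d \<sigma>0 b0 =
     unfolding_space K d {(\<sigma>, b). \<sigma> \<in> facets K d \<and> admissible K d \<sigma>0 b0 \<sigma> b}
       (\<lambda>(\<sigma>, b) (\<tau>, c). \<forall>v\<in>\<sigma> \<inter> \<tau>. b v = c v)"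

definition partial_unfolding ::
    "'v set set \<Rightarrow> nat \<Rightarrow> (('v set \<times> 'v) \<times> ('v \<Rightarrow> real)) set topology" where
  "partial_unfolding K d =
     unfolding_space K d {(\<sigma>, v). \<sigma> \<in> facets K d \<and> v \<in> \<sigma>}
       (\<lambda>(\<sigma>, v) (\<tau>, w). w = perspectivity \<sigma> \<tau> v)"

lemma unfolding_map_class:
  "unfolding_map {a'. equivclp (glue_step K d I G) a a'} = snd a"
proof -
  have "snd a' = snd a" if "equivclp (glue_step K d I G) a a'" for a'
    using that by (induction rule: equivclp_induct) (auto simp: glue_step_def)
  moreover have "equivclp (glue_step K d I G) a a"
    by (rule equivclp_refl)
  ultimately have "snd ` {a'. equivclp (glue_step K d I G) a a'} = {snd a}"
    by blast
  then show ?thesis by (simp add: unfolding_map_def)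
qed

end

theory Submission
  imports Defs
begin

text \<open>Both unfoldings are instances of one construction: finitely many labelled copies of every
  facet are glued along common ridges, and every copy of a facet is glued to some copy of each
  neighbor. Let \<open>z\<close> lie in the relative interior of a face \<open>\<kappa>\<close>. The points over \<open>z\<close> are the
  classes of copies of facets containing \<open>\<kappa>\<close>, where two copies are equivalent if a chain of
  gluings through facets containing \<open>\<kappa>\<close> leads from one to the other. As the star of \<open>\<kappa>\<close> is
  finite, the points near \<open>z\<close> form a small coordinate cube, and as it is strongly connected,
  the preimage of the cube splits into disjoint open connected sets, one for each point over
  \<open>z\<close>, which stay connected after removing any open faces of codimension at least two
  (\<open>preim_components_star\<close>). This makes the unfolding a complete spread and a branched covering.
  It also shows where the map is a covering: near \<open>z\<close> exactly if no chain around \<open>\<kappa>\<close> joins two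
  different copies of one facet (\<open>ordinary_set_eq\<close>).

  A chain of perspectivities carries a coloring along with the vertices that it colors.
  Hence a closed chain fixes a coloring if and only if it fixes every vertex,
  and the two unfoldings have the same ordinary set (\<open>unram_iff\<close>).

  For a color \<open>k\<close>, sending the copy \<open>(\<sigma>, b)\<close> to \<open>(\<sigma>, v)\<close>, where \<open>v\<close> is the vertex with
  \<open>b v = k\<close>, respects the gluings and induces a continuous map from the complete to the partial
  unfolding that commutes with the projections to the complex. Over the ordinary set the
  \<open>d + 1\<close> maps obtained in this way send a point \<open>x\<close> onto the whole fiber of the partial unfolding
  below it, and together they determine \<open>x\<close> within its own fiber. They carry lifts of
  a loop to lifts of the same loop; so a loop lifts to a loop at \<open>x\<close> if and only if all its
  lifts to the partial unfolding are loops. In other words, the characteristic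
  subgroup at \<open>x\<close> is the kernel of the monodromy of the partial unfolding
  (\<open>regularization_of_by_maps\<close>), and it is therefore normal. Finally, every admissible coloring is
  carried from the fixed one by a facet path, which makes the covering associated with
  the complete unfolding connected.\<close>


section \<open>Path homotopy and the fundamental group\<close>

text \<open>The straight line homotopy takes place in the interval that parametrizes the path. All laws of
  the fundamental group are instances: both sides of each law are reparametrizations of one path
  with the same endpoints.\<close>

lemma path_homotopic_reparametrize:
  assumes p: "pathin X p"
    and \<phi>: "continuous_on {0..1} \<phi>" "\<phi> ` {0..1} \<subseteq> {0..1}"
    and \<psi>: "continuous_on {0..1} \<psi>" "\<psi> ` {0..1} \<subseteq> {0..1}"
    and ends: "\<phi> 0 = \<psi> 0" "\<phi> 1 = \<psi> 1"
  shows "path_homotopic X (p \<circ> \<phi>) (p \<circ> \<psi>)"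
proof -
  let ?h = "\<lambda>x::real \<times> real. (1 - fst x) * \<phi> (snd x) + fst x * \<psi> (snd x)"
  have I: "?h x \<in> {0..1}" if "x \<in> {0..1} \<times> {0..1}" for x
  proof -
    have "\<phi> (snd x) \<in> {0..1}" "\<psi> (snd x) \<in> {0..1}" using that \<phi>(2) \<psi>(2) by auto
    moreover have "fst x \<in> {0..1}" using that by auto
    ultimately show ?thesis
      using convex_bound_le[of "\<phi> (snd x)" 1 "\<psi> (snd x)" "1 - fst x" "fst x"] by simp
  qed
  have "continuous_on ({0..1} \<times> {0..1}) ?h"
    by (intro continuous_intros continuous_on_compose2[OF \<phi>(1)] continuous_on_compose2[OF \<psi>(1)]) auto
  then have c: "continuous_map (prod_topology (top_of_set {0..1}) (top_of_set {0..1})) (top_of_set {0..1}) ?h"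
    using I by (auto simp: continuous_map_in_subtopology)
  have "continuous_map (prod_topology (top_of_set {0..1}) (top_of_set {0..1})) X (p \<circ> ?h)"
    using continuous_map_compose[OF c] p by (simp add: pathin_def)
  then show ?thesis
    unfolding path_homotopic_def homotopic_with_def
    by (intro exI[of _ "p \<circ> ?h"]) (auto simp: ends algebra_simps)
qed

lemma path_homotopic_imp_pathin:
  "path_homotopic X p q \<Longrightarrow> pathin X p \<and> pathin X q"
  unfolding path_homotopic_def pathin_def by (rule homotopic_with_imp_continuous_maps)

lemma path_homotopic_ends:
  "path_homotopic X p q \<Longrightarrow> q 0 = p 0 \<and> q 1 = p 1"
  unfolding path_homotopic_def by (drule homotopic_with_imp_property) simp

lemma path_homotopic_refl: "pathin X p \<Longrightarrow> path_homotopic X p p"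
  by (simp add: path_homotopic_def pathin_def)

lemma path_homotopic_sym: "path_homotopic X p q \<Longrightarrow> path_homotopic X q p"
  using path_homotopic_ends[of X p q]
  unfolding path_homotopic_def by (simp add: homotopic_with_sym)

lemma path_homotopic_trans:
  "path_homotopic X p q \<Longrightarrow> path_homotopic X q r \<Longrightarrow> path_homotopic X p r"
  using path_homotopic_ends[of X p q]
  unfolding path_homotopic_def by (auto intro: homotopic_with_trans)

lemma path_homotopic_eq_on:
  assumes "pathin X p" "\<And>t. t \<in> {0..1} \<Longrightarrow> p t = q t"
  shows "path_homotopic X p q"
  unfolding path_homotopic_def
  using assms by (intro homotopic_with_equal) (auto simp: pathin_def)

lemma path_class_eq:
  "path_homotopic X p q \<Longrightarrow> path_class X p = path_class X q"
  unfolding path_class_def by (auto intro: path_homotopic_sym path_homotopic_trans)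

lemma path_class_self: "pathin X p \<Longrightarrow> p \<in> path_class X p"
  by (simp add: path_class_def path_homotopic_refl)

lemma path_homotopic_join:
  assumes pp: "path_homotopic X p p'" and qq: "path_homotopic X q q'" and e: "p 1 = q 0"
  shows "path_homotopic X (path_join p q) (path_join p' q')"
proof -
  let ?I = "top_of_set {0..1::real}" and ?T = "prod_topology (top_of_set {0..1::real}) (top_of_set {0..1::real})"
  obtain h where h: "continuous_map ?T X h" "\<And>t. h (0,t) = p t" "\<And>t. h (1,t) = p' t"
      "\<And>s. s \<in> {0..1} \<Longrightarrow> h (s,0) = p 0 \<and> h (s,1) = p 1"
    using pp unfolding path_homotopic_def homotopic_with_def by auto
  obtain k where k: "continuous_map ?T X k" "\<And>t. k (0,t) = q t" "\<And>t. k (1,t) = q' t"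
      "\<And>s. s \<in> {0..1} \<Longrightarrow> k (s,0) = q 0 \<and> k (s,1) = q 1"
    using qq unfolding path_homotopic_def homotopic_with_def by auto
  note T = prod_topology_subtopology_eu[of "{0..1::real}" "{0..1::real}"]
  let ?H = "\<lambda>x::real\<times>real. if snd x \<le> 1/2 then h (fst x, 2 * snd x) else k (fst x, 2 * snd x - 1)"
  have "continuous_map ?T X ?H"
  proof (rule continuous_map_cases_le)
    show "continuous_map ?T euclideanreal snd" "continuous_map ?T euclideanreal (\<lambda>x. 1/2)"
      by (auto simp: T intro!: continuous_intros)
    have "continuous_map (subtopology ?T {x \<in> topspace ?T. snd x \<le> 1/2}) ?T (\<lambda>x. (fst x, 2 * snd x))"
      by (auto simp: T subtopology_subtopology continuous_map_in_subtopology intro!: continuous_intros)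
    from continuous_map_compose[OF this h(1)]
    show "continuous_map (subtopology ?T {x \<in> topspace ?T. snd x \<le> 1/2}) X (\<lambda>x. h (fst x, 2 * snd x))"
      by (simp add: o_def)
    have "continuous_map (subtopology ?T {x \<in> topspace ?T. 1/2 \<le> snd x}) ?T (\<lambda>x. (fst x, 2 * snd x - 1))"
      by (auto simp: T subtopology_subtopology continuous_map_in_subtopology intro!: continuous_intros)
    from continuous_map_compose[OF this k(1)]
    show "continuous_map (subtopology ?T {x \<in> topspace ?T. 1/2 \<le> snd x}) X (\<lambda>x. k (fst x, 2 * snd x - 1))"
      by (simp add: o_def)
    show "h (fst x, 2 * snd x) = k (fst x, 2 * snd x - 1)" if "x \<in> topspace ?T" "snd x = 1/2" for x
    proof -
      have "2 * snd x = 1" "fst x \<in> {0..1}" using that by auto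
      then show ?thesis using h(4)[of "fst x"] k(4)[of "fst x"] e by simp
    qed
  qed
  then show ?thesis
    unfolding path_homotopic_def homotopic_with_def
    by (intro exI[of _ ?H]) (auto simp: path_join_def h k)
qed

lemma pathin_join:
  "pathin X p \<Longrightarrow> pathin X q \<Longrightarrow> p 1 = q 0 \<Longrightarrow> pathin X (path_join p q)"
  using path_homotopic_join[OF path_homotopic_refl path_homotopic_refl] path_homotopic_imp_pathin
  by blast

lemma pathin_compose:
  assumes "pathin X p" "continuous_on {0..1} \<phi>" "\<phi> ` {0..1} \<subseteq> {0..1}"
  shows "pathin X (p \<circ> \<phi>)"
  using path_homotopic_reparametrize[OF assms assms(2,3)] path_homotopic_imp_pathin by auto

lemma pathin_reverse: "pathin X p \<Longrightarrow> pathin X (\<lambda>t. p (1 - t))"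
  using pathin_compose[of X p "\<lambda>t. 1 - t"] by (force simp: o_def intro!: continuous_intros)

lemma pathin_continuous_map:
  "pathin X p \<Longrightarrow> continuous_map X Y f \<Longrightarrow> pathin Y (f \<circ> p)"
  by (simp add: pathin_def continuous_map_compose)

lemma path_homotopic_continuous_map:
  "path_homotopic X p q \<Longrightarrow> continuous_map X Y f \<Longrightarrow> path_homotopic Y (f \<circ> p) (f \<circ> q)"
  unfolding path_homotopic_def
  by (erule homotopic_with_compose_continuous_map_left) auto

lemma loops_join: "p \<in> loops_at X x \<Longrightarrow> q \<in> loops_at X x \<Longrightarrow> path_join p q \<in> loops_at X x"
  by (auto simp: loops_at_def pathin_join) (auto simp: path_join_def)

lemma loops_reverse: "p \<in> loops_at X x \<Longrightarrow> (\<lambda>t. p (1 - t)) \<in> loops_at X x"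
  by (auto simp: loops_at_def pathin_reverse)

lemma loops_const: "x \<in> topspace X \<Longrightarrow> (\<lambda>_. x) \<in> loops_at X x"
  by (auto simp: loops_at_def pathin_def)

lemma fundamental_group_mult:
  assumes "p \<in> loops_at X x" "q \<in> loops_at X x"
  shows "path_class X p \<otimes>\<^bsub>fundamental_group X x\<^esub> path_class X q = path_class X (path_join p q)"
proof -
  have "path_class X (path_join p' q') = path_class X (path_join p q)"
    if "p' \<in> path_class X p" "q' \<in> path_class X q" for p' q'
    using that assms path_class_eq[OF path_homotopic_join]
    by (fastforce simp: path_class_def loops_at_def)
  moreover have "p \<in> path_class X p" "q \<in> path_class X q"
    using assms by (auto simp: loops_at_def path_class_self)
  ultimately show ?thesis
    unfolding fundamental_group_def monoid.simps by blast
qed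

text \<open>Both bracketings run through the same path, at different speeds.\<close>

lemma path_join_assoc:
  assumes "p \<in> loops_at X x" "q \<in> loops_at X x" "r \<in> loops_at X x"
  shows "path_homotopic X (path_join (path_join p q) r) (path_join p (path_join q r))"
proof -
  (* The parameter change has slopes 2, 1 and 1/2, hence it is concave and the minimum of its three
     affine pieces. *)
  let ?w = "path_join p (path_join q r)" and ?\<phi> = "\<lambda>t::real. min (2 * t) (min (t + 1/4) ((t + 1) / 2))"
  have "path_homotopic X (?w \<circ> ?\<phi>) (?w \<circ> id)"
  proof (rule path_homotopic_reparametrize)
    show "pathin X ?w" using assms loops_join by (metis (no_types, lifting) loops_at_def mem_Collect_eq)
    show "continuous_on {0..1} ?\<phi>" by (intro continuous_intros) auto
  qed (auto simp: min_def)
  moreover have "?w \<circ> ?\<phi> = path_join (path_join p q) r"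
  proof
    fix t :: real
    have e: "p 1 = q 0" "q 1 = r 0" using assms by (auto simp: loops_at_def)
    consider "t \<le> 1/4" | "1/4 < t" "t \<le> 1/2" | "1/2 < t" by linarith
    then show "(?w \<circ> ?\<phi>) t = path_join (path_join p q) r t"
    proof cases
      case 1 then show ?thesis by (simp add: path_join_def min_def)
    next
      case 2
      then have "?\<phi> t = t + 1/4" by (simp add: min_def)
      then show ?thesis using 2 by (simp add: path_join_def algebra_simps)
    next
      case 3
      then have "?\<phi> t = (t + 1)/2" by (simp add: min_def)
      then show ?thesis using 3 by (simp add: path_join_def field_simps)
    qed
  qed
  ultimately show ?thesis by simp
qed

lemma path_join_const:
  assumes "p \<in> loops_at X x"
  shows "path_homotopic X (path_join (\<lambda>_. x) p) p"
proof -
  have "path_homotopic X (p \<circ> (\<lambda>t. max 0 (2 * t - 1))) (p \<circ> id)"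
    using assms by (intro path_homotopic_reparametrize continuous_intros) (auto simp: loops_at_def)
  moreover have "p \<circ> (\<lambda>t. max 0 (2 * t - 1)) = path_join (\<lambda>_. x) p"
  proof
    fix t :: real
    have "p (2 * t - 1) = x" if "2 * t = 1" using that assms by (simp add: loops_at_def)
    then show "(p \<circ> (\<lambda>t. max 0 (2 * t - 1))) t = path_join (\<lambda>_. x) p t"
      using assms by (cases "2 * t = 1") (auto simp: path_join_def max_def loops_at_def)
  qed
  ultimately show ?thesis by simp
qed

text \<open>Going back and forth is the path run along a parameter that starts and ends at 1, and such a
  parameter can be contracted to the constant 1.\<close>

lemma path_join_reverse:
  assumes "p \<in> loops_at X x"
  shows "path_homotopic X (path_join (\<lambda>t. p (1 - t)) p) (\<lambda>_. x)"
proof -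
  have h: "path_homotopic X (p \<circ> (\<lambda>t. \<bar>1 - 2 * t\<bar>)) (p \<circ> (\<lambda>_. 1))"
    using assms by (intro path_homotopic_reparametrize continuous_intros) (auto simp: loops_at_def)
  have e1: "p \<circ> (\<lambda>t. \<bar>1 - 2 * t\<bar>) = path_join (\<lambda>t. p (1 - t)) p"
    by (auto simp: path_join_def fun_eq_iff)
  have e2: "p \<circ> (\<lambda>_. 1) = (\<lambda>_. x)"
    using assms by (auto simp: loops_at_def)
  show ?thesis using h unfolding e1 e2 .
qed

lemma carrier_fundamental_group: "carrier (fundamental_group X x) = path_class X ` loops_at X x"
  and one_fundamental_group: "\<one>\<^bsub>fundamental_group X x\<^esub> = path_class X (\<lambda>_. x)"
  by (simp_all add: fundamental_group_def)

lemma group_fundamental_group: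
  assumes "x \<in> topspace X"
  shows "group (fundamental_group X x)"
proof (rule groupI, unfold carrier_fundamental_group one_fundamental_group)
  show "path_class X (\<lambda>_. x) \<in> path_class X ` loops_at X x"
    using loops_const[OF assms] by blast
next
  fix A assume "A \<in> path_class X ` loops_at X x"
  then obtain p where p: "p \<in> loops_at X x" "A = path_class X p" by blast
  then show "path_class X (\<lambda>_. x) \<otimes>\<^bsub>fundamental_group X x\<^esub> A = A"
    using loops_const[OF assms] path_class_eq[OF path_join_const] by (simp add: fundamental_group_mult)
  show "\<exists>B\<in>path_class X ` loops_at X x. B \<otimes>\<^bsub>fundamental_group X x\<^esub> A = path_class X (\<lambda>_. x)"
    using p(2) loops_reverse[OF p(1)] path_class_eq[OF path_join_reverse[OF p(1)]]
      fundamental_group_mult[OF loops_reverse[OF p(1)] p(1)] by auto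
qed (auto simp: fundamental_group_mult loops_join path_class_eq[OF path_join_assoc])

lemma inv_fundamental_group:
  assumes "p \<in> loops_at X x"
  shows "inv\<^bsub>fundamental_group X x\<^esub> (path_class X p) = path_class X (\<lambda>t. p (1 - t))"
proof (rule group.inv_equality)
  have "x \<in> topspace X"
    using assms by (force simp: loops_at_def pathin_def continuous_map_def)
  then show "group (fundamental_group X x)" by (rule group_fundamental_group)
  show "path_class X (\<lambda>t. p (1 - t)) \<otimes>\<^bsub>fundamental_group X x\<^esub> path_class X p = \<one>\<^bsub>fundamental_group X x\<^esub>"
    using assms path_class_eq[OF path_join_reverse[OF assms]]
    by (simp add: fundamental_group_mult loops_reverse one_fundamental_group)
qed (use assms in \<open>auto simp: loops_reverse carrier_fundamental_group\<close>)


section \<open>Lifting along coverings\<close>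

lemma covering_map_sheets:
  assumes "covering_map X Y f" "y \<in> topspace Y"
  obtains U \<V> where "openin Y U" "y \<in> U" "\<Union>\<V> = preim X f U" "\<And>V. V \<in> \<V> \<Longrightarrow> openin X V"
    "pairwise disjnt \<V>" "\<And>V. V \<in> \<V> \<Longrightarrow> \<exists>k. homeomorphic_maps (subtopology X V) (subtopology Y U) f k"
  using assms unfolding covering_map_def by (metis homeomorphic_map_maps)

text \<open>Two lifts agree near a point where they agree, because they lie in one sheet, and differ near
  a point where they differ, because distinct sheets are disjoint. So the set of agreement is
  open and closed.\<close>

lemma lift_unique:
  assumes cov: "covering_map X Y f" and S: "connected_space S"
    and q: "continuous_map S X q" "continuous_map S X q'"
    and eq: "\<And>s. s \<in> topspace S \<Longrightarrow> f (q s) = f (q' s)"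
    and s0: "s0 \<in> topspace S" "q s0 = q' s0" and s: "s \<in> topspace S"
  shows "q s = q' s"
proof -
  let ?A = "{s \<in> topspace S. q s = q' s}"
  have key: "\<exists>T. openin S T \<and> s \<in> T \<and> (T \<subseteq> ?A \<or> T \<subseteq> topspace S - ?A)"
    if s: "s \<in> topspace S" for s
  proof -
    have qX: "q s \<in> topspace X" "q' s \<in> topspace X" and "f (q s) \<in> topspace Y"
      using s q cov by (auto simp: continuous_map_def covering_map_def Pi_iff)
    then obtain U \<V> where U: "openin Y U" "f (q s) \<in> U" "\<Union>\<V> = preim X f U" "\<And>V. V \<in> \<V> \<Longrightarrow> openin X V"
      "pairwise disjnt \<V>" "\<And>V. V \<in> \<V> \<Longrightarrow> \<exists>k. homeomorphic_maps (subtopology X V) (subtopology Y U) f k"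
      using covering_map_sheets[OF cov] by metis
    have "q s \<in> \<Union>\<V>" "q' s \<in> \<Union>\<V>"
      using qX U(2) eq[OF s] unfolding U(3) by (auto simp: preim_def)
    then obtain V V' where V: "V \<in> \<V>" "q s \<in> V" "V' \<in> \<V>" "q' s \<in> V'" by blast
    let ?T = "{s \<in> topspace S. q s \<in> V} \<inter> {s \<in> topspace S. q' s \<in> V'}"
    have T: "openin S ?T" "s \<in> ?T"
      using q U(4) V s by (auto intro: openin_continuous_map_preimage)
    have inj: "inj_on f V"
    proof -
      obtain k where "homeomorphic_maps (subtopology X V) (subtopology Y U) f k" using U(6) V(1) by blast
      then have "\<And>x. x \<in> V \<Longrightarrow> k (f x) = x"
        using openin_subset[OF U(4)[OF V(1)]] by (auto simp: homeomorphic_maps_def)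
      then show ?thesis by (rule inj_on_inverseI)
    qed
    show ?thesis
    proof (cases "V = V'")
      case True
      have "?T \<subseteq> ?A" using inj eq True by (auto simp: inj_on_def)
      with T show ?thesis by blast
    next
      case False
      then have "V \<inter> V' = {}" using U(5) V by (metis disjnt_def pairwiseD)
      then have "?T \<subseteq> topspace S - ?A" by auto
      with T show ?thesis by blast
    qed
  qed
  have "openin S ?A"
    by (subst openin_subopen) (use key in blast)
  moreover have "openin S (topspace S - ?A)"
    by (subst openin_subopen) (use key in blast)
  ultimately have "?A = {} \<or> ?A = topspace S"
    using S by (auto simp: connected_space_clopen_in closedin_def)
  then show ?thesis using s0 s by blast
qed

lemma continuous_map_restrict_rectangle:
  assumes "continuous_map (prod_topology (subtopology S J) (top_of_set T)) X H" "J' \<subseteq> J" "\<And>p. p \<in> A \<Longrightarrow> snd p \<in> T"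
  shows "continuous_map (subtopology (prod_topology (subtopology S J') (top_of_set T')) A) X H"
  using assms(1)
  unfolding subtopology_Times[symmetric] subtopology_subtopology
  by (rule continuous_map_from_subtopology_mono) (use assms in auto)

text \<open>Existence of lifts for families of paths, locally in the parameter. A single path is the case
  of a one-point parameter space; the homotopy lifting property needs the interval.\<close>

lemma lift_with_parameters:
  fixes a b :: real
  assumes cov: "covering_map X Y f" and ab: "a \<le> b"
    and h: "continuous_map (prod_topology S (top_of_set {a..b})) Y h"
    and s0: "s0 \<in> topspace S"
    and k: "continuous_map S X k" "\<And>s. s \<in> topspace S \<Longrightarrow> f (k s) = h (s, a)"
  shows "\<exists>J H. openin S J \<and> s0 \<in> J \<and> J \<subseteq> topspace S \<and>
    continuous_map (prod_topology (subtopology S J) (top_of_set {a..b})) X H \<and>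
    (\<forall>s\<in>J. \<forall>t\<in>{a..b}. f (H (s, t)) = h (s, t)) \<and> (\<forall>s\<in>J. H (s, a) = k s)"
proof -
  define ext where "ext c e J k \<longleftrightarrow> (\<exists>J' H. openin S J' \<and> s0 \<in> J' \<and> J' \<subseteq> J \<and>
        continuous_map (prod_topology (subtopology S J') (top_of_set {c..e})) X H \<and>
        (\<forall>s\<in>J'. \<forall>t\<in>{c..e}. f (H (s, t)) = h (s, t)) \<and> (\<forall>s\<in>J'. H (s, c) = k s))" for c e J k
  (* Bisection: subintervals over which every partial lift can be continued are closed under
     concatenation, and short subintervals are mapped into an evenly covered set. *)
  define P where "P c e \<longleftrightarrow> (a \<le> c \<longrightarrow> e \<le> b \<longrightarrow> (\<forall>J k. openin S J \<and> s0 \<in> J \<and> continuous_map (subtopology S J) X k \<and>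
      (\<forall>s\<in>J. f (k s) = h (s, c)) \<longrightarrow>
      ext c e J k))" for c e
  have "P a b"
  proof (rule Bolzano[OF ab])
    fix c m e assume trans: "P c m" "P m e" "c \<le> m" "m \<le> e"
    show "P c e"
      unfolding P_def
    proof (intro impI allI)
      fix J k
      assume ac: "a \<le> c" "e \<le> b" and J: "openin S J \<and> s0 \<in> J \<and> continuous_map (subtopology S J) X k \<and>
        (\<forall>s\<in>J. f (k s) = h (s, c))"
      have "m \<le> b" "a \<le> m" using ac trans by auto
      with trans(1)[unfolded P_def] ac(1) J have "ext c m J k" by simp
      then obtain J1 H1 where 1: "openin S J1" "s0 \<in> J1" "J1 \<subseteq> J"
          "continuous_map (prod_topology (subtopology S J1) (top_of_set {c..m})) X H1"
          "\<forall>s\<in>J1. \<forall>t\<in>{c..m}. f (H1 (s, t)) = h (s, t)" "\<forall>s\<in>J1. H1 (s, c) = k s"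
        unfolding ext_def by (elim exE conjE) (rule that)
      have c2: "continuous_map (subtopology S J1) X (\<lambda>s. H1 (s, m))"
        using continuous_map_compose[OF _ 1(4), of "subtopology S J1" "\<lambda>s. (s, m)"] trans
        by (simp add: o_def continuous_map_pairedI)
      have "\<forall>s\<in>J1. f (H1 (s, m)) = h (s, m)" using 1(5) trans by auto
      with trans(2)[unfolded P_def] ac(2) \<open>a \<le> m\<close> 1(1,2) c2 have "ext m e J1 (\<lambda>s. H1 (s, m))" by simp
      then obtain J2 H2 where 2: "openin S J2" "s0 \<in> J2" "J2 \<subseteq> J1"
          "continuous_map (prod_topology (subtopology S J2) (top_of_set {m..e})) X H2"
          "\<forall>s\<in>J2. \<forall>t\<in>{m..e}. f (H2 (s, t)) = h (s, t)" "\<forall>s\<in>J2. H2 (s, m) = H1 (s, m)"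
        unfolding ext_def by (elim exE conjE) (rule that)
      let ?H = "\<lambda>p. if snd p \<le> m then H1 p else H2 p"
      let ?T = "prod_topology (subtopology S J2) (top_of_set {c..e})"
      have "continuous_map ?T X ?H"
      proof (rule continuous_map_cases_le)
        show "continuous_map ?T euclideanreal snd"
          using continuous_map_into_fulltopology[OF continuous_map_snd] by metis
        show "continuous_map ?T euclideanreal (\<lambda>x. m)" by simp
        show "continuous_map (subtopology ?T {x \<in> topspace ?T. snd x \<le> m}) X H1"
          by (rule continuous_map_restrict_rectangle[OF 1(4) 2(3)]) auto
        show "continuous_map (subtopology ?T {x \<in> topspace ?T. m \<le> snd x}) X H2"
          by (rule continuous_map_restrict_rectangle[OF 2(4)]) auto
        show "H1 x = H2 x" if "x \<in> topspace ?T" "snd x = m" for x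
          using that 2(6) by (cases x) auto
      qed
      moreover have "f (?H (s, t)) = h (s, t)" if "s \<in> J2" "t \<in> {c..e}" for s t
        using that 1(5) 2(3,5) by auto
      moreover have "?H (s, c) = k s" if "s \<in> J2" for s
        using that 1(6) 2(3) trans by auto
      ultimately show "ext c e J k"
        unfolding ext_def using 2(1-3) 1(3) by (intro exI[of _ J2] exI[of _ ?H]) auto
    qed
  next
    fix x assume local: "a \<le> x" "x \<le> b"
    let ?R = "prod_topology S (top_of_set {a..b})"
    have "h (s0, x) \<in> topspace Y"
      using h s0 local by (auto simp: continuous_map_def Pi_iff)
    then obtain U \<V> where U: "openin Y U" "h (s0, x) \<in> U" "\<Union>\<V> = preim X f U" "\<And>V. V \<in> \<V> \<Longrightarrow> openin X V"
      "pairwise disjnt \<V>" "\<And>V. V \<in> \<V> \<Longrightarrow> \<exists>k. homeomorphic_maps (subtopology X V) (subtopology Y U) f k"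
      using covering_map_sheets[OF cov] by metis
    have "openin ?R {p \<in> topspace ?R. h p \<in> U}"
      using h U(1) by (rule openin_continuous_map_preimage)
    moreover have "(s0, x) \<in> {p \<in> topspace ?R. h p \<in> U}" using s0 local U(2) by simp
    ultimately obtain J0 T where JT: "openin S J0" "openin (top_of_set {a..b}) T" "s0 \<in> J0" "x \<in> T"
        "J0 \<times> T \<subseteq> {p \<in> topspace ?R. h p \<in> U}"
      unfolding openin_prod_topology_alt by meson
    obtain T' where T': "open T'" "T = {a..b} \<inter> T'" using JT(2) by (auto simp: openin_open)
    then obtain d where d: "d > 0" "ball x d \<subseteq> T'" using JT(4) by (auto simp: open_contains_ball)
    have hU: "h (s, t) \<in> U" if "s \<in> J0" "t \<in> T" for s t using JT(5) that by blast
    have "P c e" if ce: "c \<le> x" "x \<le> e" "e - c < d" for c e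
      unfolding P_def
    proof (intro impI allI)
      fix J k
      assume ac: "a \<le> c" "e \<le> b" and J: "openin S J \<and> s0 \<in> J \<and> continuous_map (subtopology S J) X k \<and>
        (\<forall>s\<in>J. f (k s) = h (s, c))"
      have sub: "{c..e} \<subseteq> T"
      proof
        fix t assume t: "t \<in> {c..e}"
        then have "t \<in> ball x d" using ce by (auto simp: dist_real_def)
        then show "t \<in> T" using t ac T' d by auto
      qed
      have "c \<in> T" using sub ce by auto
      have JS: "J \<subseteq> topspace S" using J openin_subset by blast
      have kX: "k s \<in> topspace X" if "s \<in> J" for s
        using J that JS by (auto simp: continuous_map_def Pi_iff)
      have "k s0 \<in> \<Union>\<V>"
        unfolding U(3) using J kX hU[OF JT(3) \<open>c \<in> T\<close>] by (auto simp: preim_def)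
      then obtain V g where V: "V \<in> \<V>" "k s0 \<in> V" "homeomorphic_maps (subtopology X V) (subtopology Y U) f g"
        using U(6) by blast
      have VX: "V \<subseteq> topspace X" and UY: "U \<subseteq> topspace Y" using U(1,4) V openin_subset by blast+
      let ?J = "{s \<in> topspace (subtopology S J). k s \<in> V} \<inter> J0"
      have 1: "openin S ?J"
      proof -
        have "openin (subtopology S J) {s \<in> topspace (subtopology S J). k s \<in> V}"
          using J U(4) V(1) by (blast intro: openin_continuous_map_preimage)
        then show ?thesis using J JT(1) by (auto simp: openin_open_subtopology)
      qed
      have 2: "s0 \<in> ?J" "?J \<subseteq> J" using J V JT s0 by auto
      have hU: "h p \<in> U" if "p \<in> topspace (prod_topology (subtopology S ?J) (top_of_set {c..e}))" for p
        using that hU[of "fst p" "snd p"] sub by auto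
      have "continuous_map (prod_topology (subtopology S ?J) (top_of_set {c..e})) Y h"
        unfolding subtopology_Times[symmetric]
        by (rule continuous_map_from_subtopology_mono[of _ "topspace S \<times> {a..b}"])
          (use h ac in \<open>auto simp: subtopology_Times\<close>)
      then have "continuous_map (prod_topology (subtopology S ?J) (top_of_set {c..e})) (subtopology Y U) h"
        using hU by (auto simp: continuous_map_in_subtopology)
      moreover have "continuous_map (subtopology Y U) X g"
        using V(3) by (auto simp: homeomorphic_maps_def continuous_map_in_subtopology)
      ultimately have 3: "continuous_map (prod_topology (subtopology S ?J) (top_of_set {c..e})) X (g \<circ> h)"
        by (rule continuous_map_compose)
      have 4: "f ((g \<circ> h) (s, t)) = h (s, t)" if "s \<in> ?J" "t \<in> {c..e}" for s t
      proof -
        have "h (s, t) \<in> U" using that JT(5) sub by blast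
        then show ?thesis using V(3) UY by (auto simp: homeomorphic_maps_def)
      qed
      have 5: "(g \<circ> h) (s, c) = k s" if "s \<in> ?J" for s
      proof -
        have "h (s, c) = f (k s)" "k s \<in> V" using that J by auto
        then show ?thesis using V(3) VX by (auto simp: homeomorphic_maps_def)
      qed
      show "ext c e J k"
        unfolding ext_def using 1 2 3 4 5 by (intro exI[of _ ?J] exI[of _ "g \<circ> h"]) blast
    qed
    then show "\<exists>d>0. \<forall>c e. c \<le> x \<and> x \<le> e \<and> e - c < d \<longrightarrow> P c e" using d(1) by blast
  qed
  then have "ext a b (topspace S) k"
    unfolding P_def using s0 k by simp
  then show ?thesis unfolding ext_def .
qed

definition lifts_from :: "'a topology \<Rightarrow> ('a \<Rightarrow> 'b) \<Rightarrow> (real \<Rightarrow> 'b) \<Rightarrow> 'a \<Rightarrow> (real \<Rightarrow> 'a) set" where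
  "lifts_from X f p x = {q. pathin X q \<and> q 0 = x \<and> (\<forall>t\<in>{0..1}. f (q t) = p t)}"

lemma path_lift:
  assumes cov: "covering_map X Y f" and p: "pathin Y p" and x: "x \<in> topspace X" "f x = p 0"
  shows "lifts_from X f p x \<noteq> {}"
proof -
  let ?S = "top_of_set {0::real}"
  have h: "continuous_map (prod_topology ?S (top_of_set {0..1})) Y (p \<circ> snd)"
    using p continuous_map_compose[OF continuous_map_snd] unfolding pathin_def by blast
  have k: "continuous_map ?S X (\<lambda>_. x)" using x by simp
  have "\<exists>J H. openin ?S J \<and> 0 \<in> J \<and> J \<subseteq> topspace ?S \<and>
      continuous_map (prod_topology (subtopology ?S J) (top_of_set {0..1})) X H \<and>
      (\<forall>s\<in>J. \<forall>t\<in>{0..1}. f (H (s, t)) = (p \<circ> snd) (s, t)) \<and> (\<forall>s\<in>J. H (s, 0) = x)"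
    by (rule lift_with_parameters[OF cov zero_le_one h _ k]) (use x in auto)
  then obtain J H where J: "openin ?S J" "0 \<in> J"
    "continuous_map (prod_topology (subtopology ?S J) (top_of_set {0..1})) X H"
    "\<forall>s\<in>J. \<forall>t\<in>{0..1}. f (H (s, t)) = (p \<circ> snd) (s, t)" "\<forall>s\<in>J. H (s, 0) = x"
    by (elim exE conjE) (rule that)
  have "continuous_map (top_of_set {0..1::real}) (prod_topology (subtopology ?S J) (top_of_set {0..1})) (\<lambda>t. (0, t))"
    using J(2) by (intro continuous_map_pairedI) auto
  then have "pathin X (\<lambda>t. H (0, t))"
    using continuous_map_compose[OF _ J(3)] unfolding pathin_def o_def by blast
  then have "(\<lambda>t. H (0, t)) \<in> lifts_from X f p x"
    using J by (auto simp: lifts_from_def)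
  then show ?thesis by blast
qed

lemma connected_space_top_of_set_Icc: "connected_space (top_of_set {0..1::real})"
  by (metis connected_Icc connectedin_def connectedin_iff_connected)

lemma path_lift_unique:
  assumes cov: "covering_map X Y f" and q: "q \<in> lifts_from X f p x" "q' \<in> lifts_from X f p x" and t: "t \<in> {0..1}"
  shows "q t = q' t"
  by (rule lift_unique[OF cov, of "top_of_set {0..1}" q q' 0])
    (use q t in \<open>auto simp: lifts_from_def pathin_def connected_space_top_of_set_Icc\<close>)

text \<open>The endpoints of the lifts of the intermediate paths depend continuously on the homotopy
  parameter and lie over one point; so they form a lift of a constant path, which is constant.\<close>

lemma homotopic_lifts_end:
  assumes cov: "covering_map X Y f" and pp: "path_homotopic Y p p'"
    and q: "q \<in> lifts_from X f p x" and q': "q' \<in> lifts_from X f p' x"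
  shows "q 1 = q' 1"
proof -
  let ?I = "top_of_set {0..1::real}"
  obtain h where h: "continuous_map (prod_topology ?I ?I) Y h" "\<And>t. h (0,t) = p t" "\<And>t. h (1,t) = p' t"
      "\<And>s. s \<in> {0..1} \<Longrightarrow> h (s,0) = p 0 \<and> h (s,1) = p 1"
    using pp unfolding path_homotopic_def homotopic_with_def by auto
  have x: "x \<in> topspace X" "f x = p 0"
    using q by (auto simp: lifts_from_def pathin_def continuous_map_def Pi_iff)
  define Q where "Q s = (SOME q. q \<in> lifts_from X f (\<lambda>t. h (s, t)) x)" for s
  have "lifts_from X f (\<lambda>t. h (s, t)) x \<noteq> {}" if "s \<in> {0..1}" for s
  proof (rule path_lift[OF cov])
    have "continuous_map ?I (prod_topology ?I ?I) (\<lambda>t. (s, t))"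
      using that by (intro continuous_map_pairedI) auto
    then show "pathin Y (\<lambda>t. h (s, t))"
      using continuous_map_compose[OF _ h(1)] unfolding pathin_def o_def by blast
  qed (use x h that in auto)
  then have Q: "Q s \<in> lifts_from X f (\<lambda>t. h (s, t)) x" if "s \<in> {0..1}" for s
    unfolding Q_def using that some_in_eq by blast
  have kx: "continuous_map ?I X (\<lambda>_. x)" using x by simp
  (* The local families of lifts; by uniqueness they agree with the lifts \<open>Q s\<close>, so
     they can be pasted. *)
  define \<L> where "\<L> = {(J, H). openin ?I J \<and> J \<subseteq> topspace ?I \<and>
      continuous_map (prod_topology (subtopology ?I J) ?I) X H \<and>
      (\<forall>s\<in>J. \<forall>t\<in>{0..1}. f (H (s, t)) = h (s, t)) \<and> (\<forall>s\<in>J. H (s, 0) = x)}"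
  have ex: "\<exists>i. i \<in> \<L> \<and> s0 \<in> fst i" if "s0 \<in> {0..1}" for s0
  proof -
    have "\<exists>J H. openin ?I J \<and> s0 \<in> J \<and> J \<subseteq> topspace ?I \<and> continuous_map (prod_topology (subtopology ?I J) ?I) X H \<and>
        (\<forall>s\<in>J. \<forall>t\<in>{0..1}. f (H (s, t)) = h (s, t)) \<and> (\<forall>s\<in>J. H (s, 0) = x)"
      by (rule lift_with_parameters[OF cov zero_le_one h(1) _ kx]) (use that x h(4) in auto)
    then obtain J H where "openin ?I J" "s0 \<in> J" "J \<subseteq> topspace ?I"
        "continuous_map (prod_topology (subtopology ?I J) ?I) X H"
        "\<forall>s\<in>J. \<forall>t\<in>{0..1}. f (H (s, t)) = h (s, t)" "\<forall>s\<in>J. H (s, 0) = x"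
      by (elim exE conjE) (rule that)
    then have "(J, H) \<in> \<L>" "s0 \<in> fst (J, H)" unfolding \<L>_def by simp_all
    then show ?thesis by blast
  qed
  have HQ: "snd i (s, 1) = Q s 1" if i: "i \<in> \<L>" and s: "s \<in> fst i" for i s
  proof -
    obtain J H where JH: "i = (J, H)" by fastforce
    have J: "J \<subseteq> {0..1}" "continuous_map (prod_topology (subtopology ?I J) ?I) X H"
        "\<forall>s\<in>J. \<forall>t\<in>{0..1}. f (H (s, t)) = h (s, t)" "\<forall>s\<in>J. H (s, 0) = x"
      using i by (auto simp: \<L>_def JH)
    have s1: "s \<in> {0..1}" "s \<in> J" using J(1) s JH by auto
    have "continuous_map ?I (prod_topology (subtopology ?I J) ?I) (\<lambda>t. (s, t))"
      using s1 by (intro continuous_map_pairedI) auto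
    then have "pathin X (\<lambda>t. H (s, t))"
      using continuous_map_compose[OF _ J(2)] unfolding pathin_def o_def by blast
    then have "(\<lambda>t. H (s, t)) \<in> lifts_from X f (\<lambda>t. h (s, t)) x"
      using J s1 by (auto simp: lifts_from_def)
    from path_lift_unique[OF cov this Q[OF s1(1)], of 1] show ?thesis by (simp add: JH)
  qed
  have "continuous_map ?I X (\<lambda>s. Q s 1)"
  proof (rule pasting_lemma[of \<L> ?I fst X "\<lambda>i s. snd i (s, 1)"])
    fix i assume i: "i \<in> \<L>"
    then show "openin ?I (fst i)" by (auto simp: \<L>_def)
    have "continuous_map (subtopology ?I (fst i)) (prod_topology (subtopology ?I (fst i)) ?I) (\<lambda>s. (s, 1))"
      by (intro continuous_map_pairedI) auto
    moreover have "continuous_map (prod_topology (subtopology ?I (fst i)) ?I) X (snd i)"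
      using i by (auto simp: \<L>_def)
    ultimately show "continuous_map (subtopology ?I (fst i)) X (\<lambda>s. snd i (s, 1))"
      using continuous_map_compose unfolding o_def by blast
  next
    fix i j s assume "i \<in> \<L>" "j \<in> \<L>" "s \<in> topspace ?I \<inter> fst i \<inter> fst j"
    then show "snd i (s, 1) = snd j (s, 1)" using HQ[of i s] HQ[of j s] by simp
  next
    fix s assume "s \<in> topspace ?I"
    then obtain i where "i \<in> \<L>" "s \<in> fst i" using ex[of s] by auto
    then show "\<exists>j. j \<in> \<L> \<and> s \<in> fst j \<and> Q s 1 = snd j (s, 1)"
      using HQ[of i s] by (intro exI[of _ i]) simp
  qed
  then have "Q 0 1 = Q 1 1"
  proof (intro lift_unique[OF cov, of ?I "\<lambda>s. Q s 1" "\<lambda>_. Q 0 1" 0 1, symmetric])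
    show "f (Q s 1) = f (Q 0 1)" if "s \<in> topspace ?I" for s
      using that Q[of s] Q[of 0] h(4)[of s] h(4)[of 0] by (simp add: lifts_from_def)
  qed (auto simp: connected_space_top_of_set_Icc continuous_map_def Pi_iff)
  moreover have "Q 0 1 = q 1" using path_lift_unique[OF cov, of "Q 0" p x q 1] Q[of 0] q h(2) by simp
  moreover have "Q 1 1 = q' 1" using path_lift_unique[OF cov, of "Q 1" p' x q' 1] Q[of 1] q' h(3) by simp
  ultimately show ?thesis by simp
qed


section \<open>Characteristic subgroups and monodromy kernels\<close>

definition lifts_closed :: "'a topology \<Rightarrow> ('a \<Rightarrow> 'b) \<Rightarrow> (real \<Rightarrow> 'b) \<Rightarrow> 'a \<Rightarrow> bool" where
  "lifts_closed X f p x \<longleftrightarrow> (\<exists>q\<in>lifts_from X f p x. q 1 = x)"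

lemma induced_hom_path_class:
  assumes "continuous_map X Y f" "pathin X q"
  shows "induced_hom Y f (path_class X q) = path_class Y (f \<circ> q)"
proof -
  have "path_class Y (f \<circ> q') = path_class Y (f \<circ> q)" if "q' \<in> path_class X q" for q'
    using path_class_eq[OF path_homotopic_continuous_map[OF _ assms(1)], of q q'] that
    by (simp add: path_class_def)
  then show ?thesis
    using path_class_self[OF assms(2)] unfolding induced_hom_def by blast
qed

lemma lifts_from_start:
  assumes "q \<in> lifts_from X f p x"
  shows "x \<in> topspace X" "f x = p 0" "t \<in> {0..1} \<Longrightarrow> q t \<in> topspace X"
proof -
  have q: "q 0 = x" "f (q 0) = p 0" "continuous_map (top_of_set {0..1}) X q"
    using assms by (auto simp: lifts_from_def pathin_def)
  then show "f x = p 0" by simp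
  show *: "q t \<in> topspace X" if "t \<in> {0..1}" for t
    using continuous_map_image_subset_topspace[OF q(3)] that by auto
  show "x \<in> topspace X" using *[of 0] q(1) by simp
qed

lemma lifts_closed_homotopic:
  assumes cov: "covering_map X Y f" and pp: "path_homotopic Y p p'" and c: "lifts_closed X f p x"
  shows "lifts_closed X f p' x"
proof -
  obtain q where q: "q \<in> lifts_from X f p x" "q 1 = x" using c by (auto simp: lifts_closed_def)
  then have "x \<in> topspace X" "f x = p' 0"
    using path_homotopic_ends[OF pp] lifts_from_start by metis+
  then obtain q' where "q' \<in> lifts_from X f p' x"
    using path_lift[OF cov] path_homotopic_imp_pathin[OF pp] by blast
  with homotopic_lifts_end[OF cov pp q(1)] q(2) show ?thesis
    unfolding lifts_closed_def by metis
qed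

lemma lifts_closed_iff:
  assumes "covering_map X Y f" "q \<in> lifts_from X f p x"
  shows "lifts_closed X f p x \<longleftrightarrow> q 1 = x"
proof -
  have "q' 1 = q 1" if "q' \<in> lifts_from X f p x" for q'
    using path_lift_unique[OF assms(1) that assms(2), of 1] by simp
  then show ?thesis using assms(2) unfolding lifts_closed_def by metis
qed

text \<open>By homotopy lifting, whether the lift is closed does not depend on the representative of the
  class; so the loop can be compared with the image of a loop upstairs.\<close>

lemma path_class_in_char_subgroup_iff:
  assumes cov: "covering_map X Y f" and x: "x \<in> topspace X" and p: "p \<in> loops_at Y (f x)"
  shows "path_class Y p \<in> char_subgroup X Y f x \<longleftrightarrow> lifts_closed X f p x"
proof
  have cont: "continuous_map X Y f" using cov by (simp add: covering_map_def)
  show "lifts_closed X f p x" if A: "path_class Y p \<in> char_subgroup X Y f x"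
  proof -
    obtain q where q: "q \<in> loops_at X x" "path_class Y p = induced_hom Y f (path_class X q)"
      using A unfolding char_subgroup_def carrier_fundamental_group by blast
    then have q: "q \<in> loops_at X x" "path_class Y p = path_class Y (f \<circ> q)"
      using induced_hom_path_class[OF cont, of q] by (simp_all add: loops_at_def)
    have "f \<circ> q \<in> path_class Y (f \<circ> q)"
      using q(1) cont by (intro path_class_self pathin_continuous_map) (auto simp: loops_at_def)
    then have "f \<circ> q \<in> path_class Y p" using q(2) by simp
    then have "path_homotopic Y (f \<circ> q) p" unfolding path_class_def by (simp add: path_homotopic_sym)
    moreover have "lifts_closed X f (f \<circ> q) x"
      using q(1) by (auto simp: lifts_closed_def lifts_from_def loops_at_def)
    ultimately show ?thesis using lifts_closed_homotopic[OF cov] by blast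
  qed
  show "path_class Y p \<in> char_subgroup X Y f x" if A: "lifts_closed X f p x"
  proof -
    obtain q where q: "pathin X q" "q 0 = x" "q 1 = x" "\<And>t. t \<in> {0..1} \<Longrightarrow> f (q t) = p t"
      using A by (auto simp: lifts_closed_def lifts_from_def)
    have "path_homotopic Y p (f \<circ> q)"
      using p q(4) by (intro path_homotopic_eq_on) (auto simp: loops_at_def)
    then have "path_class Y p = induced_hom Y f (path_class X q)"
      using path_class_eq induced_hom_path_class[OF cont q(1)] by metis
    then show ?thesis
      using q by (auto simp: char_subgroup_def carrier_fundamental_group loops_at_def)
  qed
qed

lemma char_subgroup_subset_carrier:
  assumes "continuous_map X Y f"
  shows "char_subgroup X Y f x \<subseteq> carrier (fundamental_group Y (f x))"
proof -
  have "f \<circ> q \<in> loops_at Y (f x)" if "q \<in> loops_at X x" for q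
    using that assms by (auto simp: loops_at_def pathin_continuous_map)
  then show ?thesis
    using induced_hom_path_class[OF assms]
    by (auto simp: char_subgroup_def carrier_fundamental_group loops_at_def)
qed

lemma monodromy_path_class:
  assumes cov: "covering_map X Y f" and p: "p \<in> loops_at Y y" and x: "x \<in> preim X f {y}"
    and q: "q \<in> lifts_from X f p x"
  shows "monodromy X f y (path_class Y p) x = q 1"
proof -
  have "(THE e. \<exists>p'\<in>path_class Y p. \<exists>q. pathin X q \<and> q 0 = x \<and> (\<forall>t\<in>{0..1}. f (q t) = p' t) \<and> q 1 = e) = q 1"
  proof (rule the_equality)
    have "p \<in> path_class Y p" using p by (simp add: loops_at_def path_class_self)
    then show "\<exists>p'\<in>path_class Y p. \<exists>q'. pathin X q' \<and> q' 0 = x \<and> (\<forall>t\<in>{0..1}. f (q' t) = p' t) \<and> q' 1 = q 1"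
      using q by (auto simp: lifts_from_def)
  next
    fix e assume "\<exists>p'\<in>path_class Y p. \<exists>q. pathin X q \<and> q 0 = x \<and> (\<forall>t\<in>{0..1}. f (q t) = p' t) \<and> q 1 = e"
    then obtain p' q' where "path_homotopic Y p p'" "q' \<in> lifts_from X f p' x" "q' 1 = e"
      by (auto simp: path_class_def lifts_from_def)
    then show "e = q 1" using homotopic_lifts_end[OF cov _ q] by metis
  qed
  then show ?thesis using x by (simp add: monodromy_def)
qed

lemma path_class_in_monodromy_kernel_iff:
  assumes cov: "covering_map X Y f" and p: "p \<in> loops_at Y y"
  shows "path_class Y p \<in> monodromy_kernel X Y f y \<longleftrightarrow> (\<forall>x\<in>preim X f {y}. lifts_closed X f p x)"
proof -
  have one: "\<one>\<^bsub>sym_group S\<^esub> = (\<lambda>x\<in>S. x)" for S :: "'a set"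
    by (simp add: sym_group_def BijGroup_def)
  have "path_class Y p \<in> monodromy_kernel X Y f y \<longleftrightarrow>
      monodromy X f y (path_class Y p) = (\<lambda>x\<in>preim X f {y}. x)"
    using p by (auto simp: monodromy_kernel_def kernel_def one carrier_fundamental_group)
  also have "\<dots> \<longleftrightarrow> (\<forall>x\<in>preim X f {y}. monodromy X f y (path_class Y p) x = x)"
    by (auto simp: fun_eq_iff monodromy_def)
  also have "\<dots> \<longleftrightarrow> (\<forall>x\<in>preim X f {y}. lifts_closed X f p x)"
  proof (intro ball_cong refl)
    fix x assume x: "x \<in> preim X f {y}"
    then obtain q where q: "q \<in> lifts_from X f p x"
      using path_lift[OF cov, of p x] p by (auto simp: preim_def loops_at_def)
    show "monodromy X f y (path_class Y p) x = x \<longleftrightarrow> lifts_closed X f p x"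
      unfolding monodromy_path_class[OF cov p x q] lifts_closed_iff[OF cov q] ..
  qed
  finally show ?thesis .
qed

lemma lifts_from_join:
  assumes "q \<in> lifts_from X f p x" "q' \<in> lifts_from X f p' (q 1)"
  shows "path_join q q' \<in> lifts_from X f (path_join p p') x"
  using assms by (auto simp: lifts_from_def pathin_join) (auto simp: path_join_def)

lemma lifts_from_reverse:
  assumes "q \<in> lifts_from X f p x"
  shows "(\<lambda>t. q (1 - t)) \<in> lifts_from X f (\<lambda>t. p (1 - t)) (q 1)"
  using assms by (auto simp: lifts_from_def pathin_reverse)

lemma path_join_end: "path_join p q 1 = q 1"
  by (simp add: path_join_def)

text \<open>Membership in the kernel means that all lifts, from whatever point of the fiber, are closed;
  this condition does not single out a point of the fiber, which is why it is stable under
  conjugation.\<close>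

lemma monodromy_kernel_normal:
  assumes cov: "covering_map X Y f" and y: "y \<in> topspace Y"
  shows "monodromy_kernel X Y f y \<lhd> fundamental_group Y y"
proof -
  let ?G = "fundamental_group Y y" and ?N = "monodromy_kernel X Y f y"
  interpret G: group ?G using group_fundamental_group[OF y] .
  note mem = path_class_in_monodromy_kernel_iff[OF cov]
  have sub: "?N \<subseteq> carrier ?G" by (auto simp: monodromy_kernel_def kernel_def)
  have rep: "\<And>thesis. (\<And>p. p \<in> loops_at Y y \<Longrightarrow> A = path_class Y p \<Longrightarrow> thesis) \<Longrightarrow> thesis" if "A \<in> carrier ?G" for A
    using that by (auto simp: carrier_fundamental_group)
  have "subgroup ?N ?G"
  proof (rule G.subgroupI)
    have "path_class Y (\<lambda>_. y) \<in> ?N"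
      unfolding mem[OF loops_const[OF y]]
    proof
      fix x assume "x \<in> preim X f {y}"
      then show "lifts_closed X f (\<lambda>_. y) x"
        by (auto simp: preim_def lifts_closed_def lifts_from_def pathin_def intro!: exI[of _ "\<lambda>_. x"])
    qed
    then show "?N \<noteq> {}" by blast
  next
    fix A assume A: "A \<in> ?N"
    with sub have "A \<in> carrier ?G" by blast
    then obtain p where p: "p \<in> loops_at Y y" "A = path_class Y p" by (rule rep)
    have "lifts_closed X f (\<lambda>t. p (1 - t)) x" if "x \<in> preim X f {y}" for x
      using A that lifts_from_reverse[of _ X f p x] unfolding p(2) mem[OF p(1)] lifts_closed_def
      by (force simp: lifts_from_def)
    then show "inv\<^bsub>?G\<^esub> A \<in> ?N"
      unfolding p(2) inv_fundamental_group[OF p(1)] mem[OF loops_reverse[OF p(1)]] by blast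
  next
    fix A B assume AB: "A \<in> ?N" "B \<in> ?N"
    with sub have "A \<in> carrier ?G" "B \<in> carrier ?G" by blast+
    then obtain p q where p: "p \<in> loops_at Y y" "A = path_class Y p" "q \<in> loops_at Y y" "B = path_class Y q"
      using rep[of A] rep[of B] by metis
    have "lifts_closed X f (path_join p q) x" if x: "x \<in> preim X f {y}" for x
    proof -
      obtain p' q' where p': "p' \<in> lifts_from X f p x" "p' 1 = x" "q' \<in> lifts_from X f q x" "q' 1 = x"
        using AB x unfolding p(2,4) mem[OF p(1)] mem[OF p(3)] lifts_closed_def by blast
      then have "path_join p' q' \<in> lifts_from X f (path_join p q) x"
        by (intro lifts_from_join) simp_all
      then show ?thesis
        using p'(4) path_join_end[of p' q'] unfolding lifts_closed_def by metis
    qed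
    then show "A \<otimes>\<^bsub>?G\<^esub> B \<in> ?N"
      unfolding p(2,4) fundamental_group_mult[OF p(1,3)] mem[OF loops_join[OF p(1,3)]] by blast
  qed (use sub in auto)
  moreover have "B \<otimes>\<^bsub>?G\<^esub> A \<otimes>\<^bsub>?G\<^esub> inv\<^bsub>?G\<^esub> B \<in> ?N" if AB: "B \<in> carrier ?G" "A \<in> ?N" for A B
  proof -
    from sub AB have "A \<in> carrier ?G" by blast
    then obtain p q where p: "p \<in> loops_at Y y" "A = path_class Y p" "q \<in> loops_at Y y" "B = path_class Y q"
      using rep[of A] rep[OF AB(1)] by metis
    note qp = loops_join[OF p(3,1)] and q' = loops_reverse[OF p(3)]
    have "lifts_closed X f (path_join (path_join q p) (\<lambda>t. q (1 - t))) x" if x: "x \<in> preim X f {y}" for x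
    proof -
      obtain r where r: "r \<in> lifts_from X f q x"
        using path_lift[OF cov, of q x] p(3) x by (auto simp: preim_def loops_at_def)
      then have "r 1 \<in> preim X f {y}"
        using p(3) lifts_from_start(3)[OF r, of 1] by (auto simp: preim_def lifts_from_def loops_at_def)
      then obtain s where s: "s \<in> lifts_from X f p (r 1)" "s 1 = r 1"
        using AB(2) unfolding p(2) mem[OF p(1)] lifts_closed_def by blast
      have j: "path_join (path_join r s) (\<lambda>t. r (1 - t)) \<in>
          lifts_from X f (path_join (path_join q p) (\<lambda>t. q (1 - t))) x"
        using lifts_from_join[OF lifts_from_join[OF r s(1)], of "\<lambda>t. r (1 - t)"] lifts_from_reverse[OF r] s(2)
        by (simp add: path_join_end)
      have "path_join (path_join r s) (\<lambda>t. r (1 - t)) 1 = x"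
        using r by (simp add: path_join_end lifts_from_def)
      with j show ?thesis unfolding lifts_closed_def by blast
    qed
    then show ?thesis
      unfolding p(2,4) inv_fundamental_group[OF p(3)] fundamental_group_mult[OF p(3,1)]
        fundamental_group_mult[OF qp q'] mem[OF loops_join[OF qp q']] by blast
  qed
  ultimately show ?thesis unfolding G.normal_inv_iff by blast
qed

text \<open>A criterion without reference to paths. The maps \<open>C k\<close> turn the lift of a loop
  that starts at \<open>x\<close> into all of its lifts to the other covering, and the lift at
  \<open>x\<close> is closed as soon as its images are, because the maps jointly separate the
  points of a fiber.\<close>

lemma regularization_of_by_maps:
  assumes f: "covering_map X Y f" and g: "covering_map X' Y g"
    and X: "connected_space X" "topspace X \<noteq> {}"
    and C: "\<And>k. k \<in> M \<Longrightarrow> continuous_map X X' (C k)"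
    and gC: "\<And>k x. k \<in> M \<Longrightarrow> x \<in> topspace X \<Longrightarrow> g (C k x) = f x"
    and onto: "\<And>x x'. x \<in> topspace X \<Longrightarrow> x' \<in> topspace X' \<Longrightarrow> g x' = f x \<Longrightarrow> \<exists>k\<in>M. x' = C k x"
    and inj: "\<And>x x'. x \<in> topspace X \<Longrightarrow> x' \<in> topspace X \<Longrightarrow> f x = f x' \<Longrightarrow>
      (\<And>k. k \<in> M \<Longrightarrow> C k x = C k x') \<Longrightarrow> x = x'"
  shows "regularization_of X f X' g Y"
proof -
  have fcont: "continuous_map X Y f" using f by (simp add: covering_map_def)
  have fY: "f x \<in> topspace Y" if "x \<in> topspace X" for x
    using fcont that by (auto simp: continuous_map_def Pi_iff)
  have main: "lifts_closed X f p x \<longleftrightarrow> (\<forall>x'\<in>preim X' g {f x}. lifts_closed X' g p x')"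
    if x: "x \<in> topspace X" and p: "p \<in> loops_at Y (f x)" for x p
  proof -
    have "pathin Y p" "f x = p 0" using p by (auto simp: loops_at_def)
    then obtain q where q: "q \<in> lifts_from X f p x" using path_lift[OF f _ x] by blast
    note qX = lifts_from_start(3)[OF q]
    have Cq: "C k \<circ> q \<in> lifts_from X' g p (C k x)" if "k \<in> M" for k
      using q qX gC[OF that] pathin_continuous_map[OF _ C[OF that]] by (auto simp: lifts_from_def)
    have "lifts_closed X f p x \<longleftrightarrow> q 1 = x"
      by (rule lifts_closed_iff[OF f q])
    also have "\<dots> \<longleftrightarrow> (\<forall>k\<in>M. C k (q 1) = C k x)"
    proof
      have "f (q 1) = p 1" using q by (simp add: lifts_from_def)
      then have "f (q 1) = f x" using p by (simp add: loops_at_def)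
      then show "q 1 = x" if "\<forall>k\<in>M. C k (q 1) = C k x"
        using inj[of "q 1" x] qX[of 1] x that by auto
    qed auto
    also have "\<dots> \<longleftrightarrow> (\<forall>k\<in>M. lifts_closed X' g p (C k x))"
    proof (intro ball_cong refl)
      fix k assume "k \<in> M"
      from lifts_closed_iff[OF g Cq[OF this]]
      show "C k (q 1) = C k x \<longleftrightarrow> lifts_closed X' g p (C k x)" by simp
    qed
    also have "\<dots> \<longleftrightarrow> (\<forall>x'\<in>preim X' g {f x}. lifts_closed X' g p x')"
    proof -
      have "preim X' g {f x} = (\<lambda>k. C k x) ` M"
        using onto[OF x] gC[OF _ x] C x by (auto simp: preim_def continuous_map_def Pi_iff)
      then show ?thesis by simp
    qed
    finally show ?thesis .
  qed
  have eq: "char_subgroup X Y f x = monodromy_kernel X' Y g (f x)" if x: "x \<in> topspace X" for x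
  proof -
    have 1: "char_subgroup X Y f x \<subseteq> carrier (fundamental_group Y (f x))"
      by (rule char_subgroup_subset_carrier[OF fcont])
    have 2: "monodromy_kernel X' Y g (f x) \<subseteq> carrier (fundamental_group Y (f x))"
      by (auto simp: monodromy_kernel_def kernel_def)
    have "A \<in> char_subgroup X Y f x \<longleftrightarrow> A \<in> monodromy_kernel X' Y g (f x)"
      if A: "A \<in> carrier (fundamental_group Y (f x))" for A
    proof -
      obtain p where p: "p \<in> loops_at Y (f x)" "A = path_class Y p"
        using A by (auto simp: carrier_fundamental_group)
      show ?thesis
        unfolding p(2) path_class_in_char_subgroup_iff[OF f x p(1)]
          path_class_in_monodromy_kernel_iff[OF g p(1)] by (rule main[OF x p(1)])
    qed
    with 1 2 show ?thesis by blast
  qed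
  show ?thesis
    unfolding regularization_of_def regular_covering_def
    using f g X eq monodromy_kernel_normal[OF g fY] by auto
qed


section \<open>Components of open partitions\<close>

text \<open>Members of a partition into open sets are also closed.\<close>

lemma connected_components_of_open_partition:
  assumes cover: "\<Union>\<C> = topspace X" and op: "\<And>C. C \<in> \<C> \<Longrightarrow> openin X C"
    and conn: "\<And>C. C \<in> \<C> \<Longrightarrow> connectedin X C \<and> C \<noteq> {}" and disj: "pairwise disjnt \<C>"
  shows "connected_components_of X = \<C>"
proof -
  have comp: "connected_component_of_set X x = C" if C: "C \<in> \<C>" and x: "x \<in> C" for x C
  proof
    show "C \<subseteq> connected_component_of_set X x"
      using conn[OF C] x by (intro connected_component_of_maximal) auto
    have "topspace X - C = \<Union>(\<C> - {C})"
      using cover C disj by (auto simp: pairwise_def disjnt_def)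
    then have "openin X (topspace X - C)" using op by auto
    then have "closedin X C" using C cover by (auto simp: closedin_def)
    moreover have "connectedin X (connected_component_of_set X x)"
      by (rule connectedin_connected_component_of)
    moreover have "x \<in> connected_component_of_set X x"
      using x C cover by (auto simp: connected_component_of_refl)
    ultimately show "connected_component_of_set X x \<subseteq> C"
      using connectedin_clopen_cases[OF _ _ op[OF C]] x by (metis disjnt_iff)
  qed
  show ?thesis
  proof
    show "connected_components_of X \<subseteq> \<C>"
      unfolding connected_components_of_def using comp cover by fastforce
    show "\<C> \<subseteq> connected_components_of X"
    proof
      fix C assume C: "C \<in> \<C>"
      then obtain x where x: "x \<in> C" using conn by blast
      then have "x \<in> topspace X" using C cover by blast
      with comp[OF C x] show "C \<in> connected_components_of X"
        unfolding connected_components_of_def by blast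
    qed
  qed
qed


section \<open>Points of simplices\<close>

definition supp :: "('v \<Rightarrow> real) \<Rightarrow> 'v set" where
  "supp x = {v. x v \<noteq> 0}"

text \<open>Neighborhoods are described by coordinates alone. As a point of a simplex has finitely many
  nonzero coordinates, the trace of a cube on each simplex is open although all coordinates are
  constrained.\<close>

definition cube :: "('v \<Rightarrow> real) \<Rightarrow> real \<Rightarrow> ('v \<Rightarrow> real) set" where
  "cube z \<epsilon> = {x. \<forall>v. \<bar>x v - z v\<bar> < \<epsilon>}"

definition segment :: "('v \<Rightarrow> real) \<Rightarrow> ('v \<Rightarrow> real) \<Rightarrow> real \<Rightarrow> 'v \<Rightarrow> real" where
  "segment x y t = (\<lambda>v. (1 - t) * x v + t * y v)"

lemma simplex_pts_iff:
  assumes "finite \<sigma>"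
  shows "x \<in> simplex_pts \<sigma> \<longleftrightarrow> (\<forall>v. 0 \<le> x v) \<and> supp x \<subseteq> \<sigma> \<and> sum x (supp x) = 1"
proof -
  have "sum x \<sigma> = sum x (supp x)" if "supp x \<subseteq> \<sigma>"
    using assms that by (intro sum.mono_neutral_right) (auto simp: supp_def)
  moreover have "(\<forall>v. v \<notin> \<sigma> \<longrightarrow> x v = 0) \<longleftrightarrow> supp x \<subseteq> \<sigma>" by (auto simp: supp_def)
  ultimately show ?thesis unfolding simplex_pts_def by auto
qed

lemma supp_nonempty: "finite \<sigma> \<Longrightarrow> x \<in> simplex_pts \<sigma> \<Longrightarrow> supp x \<noteq> {}"
  by (auto simp: simplex_pts_iff)

lemma simplex_pts_nonempty: "finite \<sigma> \<Longrightarrow> \<sigma> \<noteq> {} \<Longrightarrow> \<exists>z. z \<in> simplex_pts \<sigma>"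
proof -
  assume "finite \<sigma>" "\<sigma> \<noteq> {}"
  then obtain v where "v \<in> \<sigma>" "finite \<sigma>" by blast
  then have "(\<lambda>w. if w = v then 1 else 0) \<in> simplex_pts \<sigma>" by (auto simp: simplex_pts_def)
  then show ?thesis by blast
qed

lemma segment_in_simplex:
  assumes "x \<in> simplex_pts \<sigma>" "y \<in> simplex_pts \<sigma>" "t \<in> {0..1}"
  shows "segment x y t \<in> simplex_pts \<sigma>"
  using assms by (simp add: simplex_pts_def segment_def sum.distrib flip: sum_distrib_left)

lemma supp_segment:
  assumes "x \<in> simplex_pts \<sigma>" "y \<in> simplex_pts \<sigma>" "0 < t" "t < 1"
  shows "supp (segment x y t) = supp x \<union> supp y"
proof -
  have "(1 - t) * x v + t * y v = 0 \<longleftrightarrow> x v = 0 \<and> y v = 0" for v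
  proof -
    have "0 \<le> x v" "0 \<le> y v" using assms by (auto simp: simplex_pts_def)
    then show ?thesis using assms(3,4) by (simp add: add_nonneg_eq_0_iff)
  qed
  then show ?thesis by (auto simp: supp_def segment_def)
qed

lemma continuous_segment: "continuous_on S (segment x y)"
  unfolding segment_def by (intro continuous_intros)

lemma segment_in_cube:
  assumes "x \<in> cube z \<epsilon>" "y \<in> cube z \<epsilon>" "t \<in> {0..1}"
  shows "segment x y t \<in> cube z \<epsilon>"
proof -
  have "\<bar>(1 - t) * x v + t * y v - z v\<bar> < \<epsilon>" for v
  proof -
    have "(1 - t) * x v + t * y v - z v = (1 - t) * (x v - z v) + t * (y v - z v)"
      by (simp add: algebra_simps)
    moreover have "x v - z v < \<epsilon>" "y v - z v < \<epsilon>" "- (x v - z v) < \<epsilon>" "- (y v - z v) < \<epsilon>"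
      using assms(1,2) by (auto simp: cube_def abs_less_iff)
    ultimately show ?thesis
      using convex_bound_lt[of "x v - z v" \<epsilon> "y v - z v" "1 - t" t]
        convex_bound_lt[of "- (x v - z v)" \<epsilon> "- (y v - z v)" "1 - t" t] assms(3)
      by (auto simp: abs_less_iff algebra_simps)
  qed
  then show ?thesis by (simp add: cube_def segment_def)
qed

lemma center_in_cube: "0 < \<epsilon> \<Longrightarrow> z \<in> cube z \<epsilon>"
  by (simp add: cube_def)

text \<open>Moving a point slightly towards the barycenter makes all coordinates positive.\<close>

lemma interior_point_near:
  assumes fin: "finite \<sigma>" and z: "z \<in> simplex_pts \<sigma>" and \<epsilon>: "0 < \<epsilon>"
  shows "\<exists>x\<in>simplex_pts \<sigma> \<inter> cube z \<epsilon>. supp x = \<sigma>"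
proof -
  have ne: "\<sigma> \<noteq> {}" using z by (auto simp: simplex_pts_def)
  (* The barycenter; coordinates of points of a simplex differ by at most 1, so the step
     \<open>t\<close> moves them by less than \<open>\<epsilon>\<close>. *)
  define b :: "'a \<Rightarrow> real" where "b = (\<lambda>v. if v \<in> \<sigma> then 1 / card \<sigma> else 0)"
  define t where "t = min (1/2) (\<epsilon>/2)"
  have t: "0 < t" "t < 1" "t < \<epsilon>" using \<epsilon> by (auto simp: t_def min_def)
  have b: "b \<in> simplex_pts \<sigma>" using fin ne by (auto simp: simplex_pts_def b_def)
  have le1: "0 \<le> y v \<and> y v \<le> 1" if "y \<in> simplex_pts \<sigma>" for y v
  proof (cases "v \<in> \<sigma>")
    case True
    then have "y v \<le> sum y \<sigma>" using that fin by (intro member_le_sum) (auto simp: simplex_pts_def)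
    then show ?thesis using that by (simp add: simplex_pts_def)
  qed (use that in \<open>auto simp: simplex_pts_def\<close>)
  have "\<bar>segment z b t v - z v\<bar> < \<epsilon>" for v
  proof -
    have "segment z b t v - z v = t * (b v - z v)" by (simp add: segment_def algebra_simps)
    moreover have "\<bar>b v - z v\<bar> \<le> 1" using le1[OF b, of v] le1[OF z, of v] by linarith
    ultimately have "\<bar>segment z b t v - z v\<bar> \<le> t * 1"
      using t(1) by (simp add: abs_mult)
    then show ?thesis using t(3) by simp
  qed
  moreover have "supp b = \<sigma>" using fin ne by (auto simp: supp_def b_def)
  moreover have "supp z \<subseteq> \<sigma>" using z fin by (simp add: simplex_pts_iff)
  ultimately show ?thesis
    using segment_in_simplex[OF z b, of t] supp_segment[OF z b] t
    by (intro bexI[of _ "segment z b t"]) (auto simp: cube_def)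
qed

lemma openin_cube:
  assumes "finite \<sigma>" "finite (supp z)"
  shows "openin (top_of_set (simplex_pts \<sigma>)) (simplex_pts \<sigma> \<inter> cube z \<epsilon>)"
proof (cases "0 < \<epsilon>")
  case True
  have "simplex_pts \<sigma> \<inter> cube z \<epsilon> = simplex_pts \<sigma> \<inter> (\<Inter>v\<in>\<sigma> \<union> supp z. {x. \<bar>x v - z v\<bar> < \<epsilon>})"
    using True by (auto simp: cube_def simplex_pts_def supp_def)
  moreover have "open (\<Inter>v\<in>\<sigma> \<union> supp z. {x. \<bar>x v - z v\<bar> < \<epsilon>})"
    using assms by (intro open_INT ballI open_Collect_less continuous_intros) auto
  ultimately show ?thesis by (auto simp: openin_open)
next
  case False
  then have "cube z \<epsilon> = {}" by (auto simp: cube_def)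
  then show ?thesis by simp
qed

lemma open_simplex_contains_cube:
  assumes fin: "finite \<sigma>" and A: "openin (top_of_set (simplex_pts \<sigma>)) A" and z: "z \<in> A"
  shows "\<exists>\<epsilon>>0. simplex_pts \<sigma> \<inter> cube z \<epsilon> \<subseteq> A"
proof -
  obtain A' where A': "open A'" "A = simplex_pts \<sigma> \<inter> A'" using A by (auto simp: openin_open)
  then have "openin (product_topology (\<lambda>i. euclidean) UNIV) A'" "z \<in> A'" using z by (auto simp: open_fun_def)
  from product_topology_open_contains_basis[OF this]
  obtain X where X: "\<And>i. z i \<in> X i" "\<And>i. open (X i)" "finite {i. X i \<noteq> UNIV}" "(\<Pi>\<^sub>E i\<in>UNIV. X i) \<subseteq> A'"
    by auto
  have "\<exists>e>0. ball (z i) e \<subseteq> X i" for i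
    using X(1,2) by (meson open_contains_ball)
  then obtain e where e: "\<And>i. e i > 0" "\<And>i. ball (z i) (e i) \<subseteq> X i" by metis
  define \<epsilon> where "\<epsilon> = Min (insert 1 (e ` {i. X i \<noteq> UNIV}))"
  have \<epsilon>: "\<epsilon> > 0" "\<And>i. X i \<noteq> UNIV \<Longrightarrow> \<epsilon> \<le> e i"
    using X(3) e(1) by (auto simp: \<epsilon>_def)
  have "x \<in> A'" if "x \<in> cube z \<epsilon>" for x
  proof -
    have "x i \<in> X i" for i
    proof (cases "X i = UNIV")
      case False
      have "\<bar>x i - z i\<bar> < \<epsilon>" using that by (simp add: cube_def)
      then have "x i \<in> ball (z i) (e i)"
        using \<epsilon>(2)[OF False] by (simp add: dist_real_def)
      then show ?thesis using e(2) by blast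
    qed simp
    then show ?thesis using X(4) by (auto simp: PiE_def extensional_def Pi_iff)
  qed
  then show ?thesis using \<epsilon>(1) A'(2) by blast
qed


section \<open>Gluing copies of facets\<close>

definition glued :: "'v set set \<Rightarrow> nat \<Rightarrow> ('v set \<times> 'l) set \<Rightarrow> ('v set \<times> 'l \<Rightarrow> 'v set \<times> 'l \<Rightarrow> bool) \<Rightarrow>
    'v set \<Rightarrow> 'v set \<times> 'l \<Rightarrow> 'v set \<times> 'l \<Rightarrow> bool" where
  "glued K d I G \<kappa> i j \<longleftrightarrow>
     i \<in> I \<and> j \<in> I \<and> neighbors K d (fst i) (fst j) \<and> G i j \<and> \<kappa> \<subseteq> fst i \<inter> fst j"

text \<open>For \<open>\<kappa>\<close> the support of a point \<open>x\<close>, this is the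
  identification of the copies of \<open>x\<close>; for \<open>\<kappa>\<close> empty, its
  classes are the components of the unfolding.\<close>

definition glued_around :: "'v set set \<Rightarrow> nat \<Rightarrow> ('v set \<times> 'l) set \<Rightarrow> ('v set \<times> 'l \<Rightarrow> 'v set \<times> 'l \<Rightarrow> bool) \<Rightarrow>
    'v set \<Rightarrow> 'v set \<times> 'l \<Rightarrow> 'v set \<times> 'l \<Rightarrow> bool" where
  "glued_around K d I G \<kappa> = equivclp (glued K d I G \<kappa>)"

text \<open>The local group around \<open>\<kappa>\<close>, which consists of the closed chains of
  gluings, acts trivially on labels.\<close>

definition unramified_at :: "'v set set \<Rightarrow> nat \<Rightarrow> ('v set \<times> 'l) set \<Rightarrow> ('v set \<times> 'l \<Rightarrow> 'v set \<times> 'l \<Rightarrow> bool) \<Rightarrow>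
    'v set \<Rightarrow> bool" where
  "unramified_at K d I G \<kappa> \<longleftrightarrow> (\<forall>\<sigma> l m. glued_around K d I G \<kappa> (\<sigma>, l) (\<sigma>, m) \<longrightarrow> l = m)"

lemma glued_around_refl: "glued_around K d I G \<kappa> i i"
  by (simp add: glued_around_def)

lemma glued_around_sym: "glued_around K d I G \<kappa> i j \<Longrightarrow> glued_around K d I G \<kappa> j i"
  unfolding glued_around_def by (rule equivclp_sym)

lemma glued_around_trans:
  "glued_around K d I G \<kappa> i j \<Longrightarrow> glued_around K d I G \<kappa> j k \<Longrightarrow> glued_around K d I G \<kappa> i k"
  unfolding glued_around_def by (rule equivclp_trans)

lemma glued_imp_around: "glued K d I G \<kappa> i j \<Longrightarrow> glued_around K d I G \<kappa> i j"
  unfolding glued_around_def by (rule r_into_equivclp)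

lemma glued_around_induct [consumes 1, case_names base step sym]:
  assumes "glued_around K d I G \<kappa> i j" "P i"
    and "\<And>j k. glued_around K d I G \<kappa> i j \<Longrightarrow> glued K d I G \<kappa> j k \<Longrightarrow> P j \<Longrightarrow> P k"
    and "\<And>j k. glued_around K d I G \<kappa> i j \<Longrightarrow> glued K d I G \<kappa> k j \<Longrightarrow> P j \<Longrightarrow> P k"
  shows "P j"
  using assms unfolding glued_around_def by (induction rule: equivclp_induct) blast+

text \<open>A larger face has a smaller star; hence ramification can only decrease when passing to nearby
  points, whose supports are larger.\<close>

lemma glued_around_mono:
  assumes "\<kappa> \<subseteq> \<kappa>'" "glued_around K d I G \<kappa>' i j"
  shows "glued_around K d I G \<kappa> i j"
  using assms(2)
proof (induction rule: glued_around_induct)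
  case (step j k)
  then have "glued K d I G \<kappa> j k" using assms(1) by (auto simp: glued_def)
  with step show ?case by (blast intro: glued_around_trans glued_imp_around)
next
  case (sym j k)
  then have "glued K d I G \<kappa> k j" using assms(1) by (auto simp: glued_def)
  with sym show ?case by (blast intro: glued_around_trans glued_around_sym glued_imp_around)
qed (rule glued_around_refl)

lemma glued_around_mem:
  assumes "glued_around K d I G \<kappa> i j" "i \<in> I" "\<kappa> \<subseteq> fst i"
  shows "j \<in> I" "\<kappa> \<subseteq> fst j"
proof -
  have "j \<in> I \<and> \<kappa> \<subseteq> fst j"
    using assms(1) by (induction rule: glued_around_induct) (auto simp: glued_def assms(2,3))
  then show "j \<in> I" "\<kappa> \<subseteq> fst j" by auto
qed

lemma glued_around_trivial_or_mem:
  "glued_around K d I G \<kappa> i j \<Longrightarrow> i = j \<or> i \<in> I \<and> j \<in> I \<and> \<kappa> \<subseteq> fst i \<and> \<kappa> \<subseteq> fst j"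
  by (induction rule: glued_around_induct) (auto simp: glued_def)

lemma unramified_at_mono:
  "\<kappa> \<subseteq> \<kappa>' \<Longrightarrow> unramified_at K d I G \<kappa> \<Longrightarrow> unramified_at K d I G \<kappa>'"
  unfolding unramified_at_def by (blast intro: glued_around_mono)

definition point :: "'v set set \<Rightarrow> nat \<Rightarrow> ('v set \<times> 'l) set \<Rightarrow> ('v set \<times> 'l \<Rightarrow> 'v set \<times> 'l \<Rightarrow> bool) \<Rightarrow>
    'v set \<times> 'l \<Rightarrow> ('v \<Rightarrow> real) \<Rightarrow> (('v set \<times> 'l) \<times> ('v \<Rightarrow> real)) set" where
  "point K d I G i x = {a. equivclp (glue_step K d I G) (i, x) a}"

lemma unfolding_map_point [simp]: "unfolding_map (point K d I G i x) = x"
  unfolding point_def unfolding_map_class by simp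

lemma topspace_unfolding_space:
  "topspace (unfolding_space K d I G) = {point K d I G i x | i x. i \<in> I \<and> x \<in> simplex_pts (fst i)}"
  unfolding unfolding_space_def point_def by (auto simp: comp_def image_iff) blast

lemma openin_unfolding_space:
  "openin (unfolding_space K d I G) U \<longleftrightarrow> U \<subseteq> topspace (unfolding_space K d I G) \<and>
     (\<forall>i\<in>I. openin (top_of_set (simplex_pts (fst i))) {x \<in> simplex_pts (fst i). point K d I G i x \<in> U})"
proof -
  let ?S = "sum_topology (\<lambda>i. top_of_set (simplex_pts (fst i))) I"
  let ?P = "{a \<in> topspace ?S. {a'. equivclp (glue_step K d I G) a a'} \<in> U}"
  have "{x. (i, x) \<in> ?P} = {x \<in> simplex_pts (fst i). point K d I G i x \<in> U}" if "i \<in> I" for i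
    using that by (auto simp: point_def)
  then have "openin ?S ?P \<longleftrightarrow>
      (\<forall>i\<in>I. openin (top_of_set (simplex_pts (fst i))) {x \<in> simplex_pts (fst i). point K d I G i x \<in> U})"
    unfolding openin_sum_topology by (auto simp: comp_def cong: ball_cong)
  then show ?thesis
    unfolding unfolding_space_def topspace_quotient_topology openin_quotient_topology by simp
qed

lemma neighbors_sym: "neighbors K d \<sigma> \<tau> \<Longrightarrow> neighbors K d \<tau> \<sigma>"
  by (auto simp: neighbors_def)


section \<open>Complexes with strongly connected stars\<close>

locale locally_strong_complex =
  fixes K :: "'v set set" and d :: nat
  assumes complex: "abstract_complex K" and locfin: "locally_finite K" and pure_K: "pure K d"
    and loc_strong: "locally_strongly_connected K d"
begin

abbreviation "Z \<equiv> realization K"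

lemma finite_face: "\<sigma> \<in> K \<Longrightarrow> finite \<sigma>" and face_nonempty: "\<sigma> \<in> K \<Longrightarrow> \<sigma> \<noteq> {}"
  using complex by (auto simp: abstract_complex_def)

lemma subface: "\<sigma> \<in> K \<Longrightarrow> \<tau> \<subseteq> \<sigma> \<Longrightarrow> \<tau> \<noteq> {} \<Longrightarrow> \<tau> \<in> K"
  using complex unfolding abstract_complex_def by blast

lemma card_face: "\<sigma> \<in> K \<Longrightarrow> card \<sigma> = Suc (face_dim \<sigma>)"
  using finite_face[of \<sigma>] face_nonempty[of \<sigma>] by (simp add: face_dim_def card_gt_0_iff)

lemma facetD: "\<sigma> \<in> facets K d \<Longrightarrow> \<sigma> \<in> K" "\<sigma> \<in> facets K d \<Longrightarrow> finite \<sigma>" "\<sigma> \<in> facets K d \<Longrightarrow> card \<sigma> = Suc d"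
  using finite_face card_face by (auto simp: facets_def)

lemma facet_maximal: "\<sigma> \<in> facets K d \<Longrightarrow> \<tau> \<in> K \<Longrightarrow> \<sigma> \<subseteq> \<tau> \<Longrightarrow> \<sigma> = \<tau>"
proof -
  assume a: "\<sigma> \<in> facets K d" "\<tau> \<in> K" "\<sigma> \<subseteq> \<tau>"
  have "face_dim \<tau> \<le> d" using pure_K a(2) by (simp add: pure_def)
  then have "card \<tau> \<le> card \<sigma>" using card_face[OF a(2)] facetD(3)[OF a(1)] by simp
  then show ?thesis using card_seteq[OF finite_face[OF a(2)] a(3)] by simp
qed

lemma neighbors_facets: "neighbors K d \<sigma> \<tau> \<Longrightarrow> \<sigma> \<in> facets K d \<and> \<tau> \<in> facets K d \<and> \<sigma> \<noteq> \<tau>"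
  by (simp add: neighbors_def)

text \<open>A ridge inside both facets has \<open>d\<close> vertices, and two distinct facets share no
  more.\<close>

lemma neighbors_ridge:
  assumes "neighbors K d \<sigma> \<tau>"
  shows "\<sigma> \<inter> \<tau> \<in> ridges K d"
proof -
  obtain \<rho> where \<rho>: "\<rho> \<in> ridges K d" "\<rho> \<subseteq> \<sigma> \<inter> \<tau>" using assms by (auto simp: neighbors_def)
  note f = neighbors_facets[OF assms]
  have c: "card \<rho> = d" using \<rho>(1) card_face[of \<rho>] by (auto simp: ridges_def codim_def)
  have "\<sigma> \<inter> \<tau> \<noteq> \<sigma>" using f facet_maximal[of \<sigma> \<tau>] facetD(1) by blast
  then have "\<sigma> \<inter> \<tau> \<subset> \<sigma>" by blast
  then have "card (\<sigma> \<inter> \<tau>) < card \<sigma>" using f facetD(2) by (simp add: psubset_card_mono)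
  then have "card (\<sigma> \<inter> \<tau>) \<le> card \<rho>" using f facetD(3) c by simp
  moreover have "finite (\<sigma> \<inter> \<tau>)" using f facetD(2) by blast
  ultimately have "\<rho> = \<sigma> \<inter> \<tau>" using card_seteq[OF _ \<rho>(2)] by simp
  with \<rho>(1) show ?thesis by simp
qed

lemma ridgeD: "\<rho> \<in> ridges K d \<Longrightarrow> \<rho> \<in> K"
  by (simp add: ridges_def)

lemma topspace_Z: "x \<in> topspace Z \<longleftrightarrow> (\<exists>\<sigma>\<in>K. x \<in> simplex_pts \<sigma>)"
  by (auto simp: topspace_realization)

lemma in_simplex: "x \<in> topspace Z \<Longrightarrow> supp x \<subseteq> \<sigma> \<Longrightarrow> finite \<sigma> \<Longrightarrow> x \<in> simplex_pts \<sigma>"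
  unfolding topspace_Z using finite_face by (auto simp: simplex_pts_iff)

lemma simplex_supp: "finite \<sigma> \<Longrightarrow> x \<in> simplex_pts \<sigma> \<Longrightarrow> supp x \<subseteq> \<sigma>"
  by (simp add: simplex_pts_iff)

lemma supp_in_K: "x \<in> topspace Z \<Longrightarrow> supp x \<in> K"
proof -
  assume "x \<in> topspace Z"
  then obtain \<sigma> where \<sigma>: "\<sigma> \<in> K" "x \<in> simplex_pts \<sigma>" unfolding topspace_Z by blast
  show ?thesis
    using subface[OF \<sigma>(1)] simplex_supp[OF _ \<sigma>(2)] supp_nonempty[OF _ \<sigma>(2)] finite_face[OF \<sigma>(1)] by simp
qed

lemma finite_supp: "x \<in> topspace Z \<Longrightarrow> finite (supp x)"
  by (rule finite_face[OF supp_in_K])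

lemma neighbors_split:
  assumes "neighbors K d \<sigma> \<tau>"
  obtains a b where "\<sigma> - \<tau> = {a}" "\<tau> - \<sigma> = {b}"
proof -
  have one: "card (\<sigma> - \<tau>) = 1" if n: "neighbors K d \<sigma> \<tau>" for \<sigma> \<tau>
  proof -
    have r: "\<sigma> \<inter> \<tau> \<in> ridges K d" by (rule neighbors_ridge[OF n])
    have "card (\<sigma> \<inter> \<tau>) = d" using r card_face[OF ridgeD[OF r]] by (auto simp: ridges_def codim_def)
    moreover have "finite \<sigma>" "card \<sigma> = Suc d" using facetD neighbors_facets[OF n] by blast+
    ultimately show ?thesis by (simp add: card_Diff_subset_Int)
  qed
  show ?thesis
    using one[OF assms] one[OF neighbors_sym[OF assms]] that by (metis card_1_singletonE)
qed

lemma perspectivity_mem: "neighbors K d \<sigma> \<tau> \<Longrightarrow> v \<in> \<sigma> \<Longrightarrow> perspectivity \<sigma> \<tau> v \<in> \<tau>"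
  by (erule neighbors_split) (auto simp: perspectivity_def)

lemma perspectivity_off: "neighbors K d \<sigma> \<tau> \<Longrightarrow> v \<notin> \<tau> \<Longrightarrow> perspectivity \<sigma> \<tau> v \<notin> \<sigma>"
  by (erule neighbors_split) (auto simp: perspectivity_def)

lemma perspectivity_inverse:
  assumes n: "neighbors K d \<sigma> \<tau>" and v: "v \<in> \<sigma>"
  shows "perspectivity \<tau> \<sigma> (perspectivity \<sigma> \<tau> v) = v"
proof -
  obtain a b where ab: "\<sigma> - \<tau> = {a}" "\<tau> - \<sigma> = {b}" by (rule neighbors_split[OF n])
  show ?thesis
  proof (cases "v \<in> \<tau>")
    case False
    then have "v = a" "b \<notin> \<sigma>" using v ab by auto
    then show ?thesis using ab False by (simp add: perspectivity_def)
  qed (simp add: perspectivity_def v)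
qed

lemma bij_perspectivity: "neighbors K d \<sigma> \<tau> \<Longrightarrow> bij_betw (perspectivity \<sigma> \<tau>) \<sigma> \<tau>"
  by (rule bij_betw_byWitness[where f' = "perspectivity \<tau> \<sigma>"])
    (auto simp: perspectivity_inverse neighbors_sym perspectivity_mem)

lemma bij_projectivity: "facet_path K d \<gamma> \<Longrightarrow> bij_betw (projectivity \<gamma>) (hd \<gamma>) (last \<gamma>)"
proof (induction \<gamma> rule: induct_list012)
  case (3 \<sigma> \<tau> \<gamma>)
  then have n: "neighbors K d \<sigma> \<tau>" and "facet_path K d (\<tau> # \<gamma>)" by (auto simp: facet_path_def)
  with 3(2) have "bij_betw (projectivity (\<tau> # \<gamma>)) \<tau> (last (\<tau> # \<gamma>))" by simp
  from bij_betw_trans[OF bij_perspectivity[OF n] this] show ?case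
    by (simp only: projectivity.simps list.sel last.simps list.distinct if_False)
qed (auto simp: facet_path_def)

lemma facet_path_rev: "facet_path K d \<gamma> \<Longrightarrow> facet_path K d (rev \<gamma>)"
  unfolding facet_path_def by (auto simp: successively_rev intro: neighbors_sym successively_mono)

lemma facet_path_snoc:
  "facet_path K d \<eta> \<Longrightarrow> neighbors K d (last \<eta>) \<tau> \<Longrightarrow> facet_path K d (\<eta> @ [\<tau>])"
  unfolding facet_path_def by (auto simp: successively_append_iff dest: neighbors_facets)


end


section \<open>Labellings of facets\<close>

text \<open>The common abstraction of the two unfoldings: \<open>I\<close> is the set of copies and
  \<open>G\<close> tells which copies of neighbors are glued. The last condition says that all
  copies of the facets around a ridge fit together, so that branching has codimension at least
  two.\<close>

locale facet_labelling = locally_strong_complex K d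
  for K :: "'v set set" and d :: nat +
  fixes I :: "('v set \<times> 'l) set" and G :: "'v set \<times> 'l \<Rightarrow> 'v set \<times> 'l \<Rightarrow> bool"
  assumes I_facets: "i \<in> I \<Longrightarrow> fst i \<in> facets K d"
    and finite_labels: "finite {l. (\<sigma>, l) \<in> I}"
    and label_exists: "\<sigma> \<in> facets K d \<Longrightarrow> \<exists>l. (\<sigma>, l) \<in> I"
    and glue_exists: "i \<in> I \<Longrightarrow> neighbors K d (fst i) \<tau> \<Longrightarrow> \<exists>l. (\<tau>, l) \<in> I \<and> G i (\<tau>, l)"
    and unramified_ridge: "\<rho> \<in> ridges K d \<Longrightarrow> unramified_at K d I G \<rho>"
begin

abbreviation "around \<equiv> glued_around K d I G"
abbreviation "unram \<equiv> unramified_at K d I G"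
abbreviation "pt \<equiv> point K d I G"
abbreviation "Y \<equiv> unfolding_space K d I G"
abbreviation "g \<equiv> unfolding_map :: (('v set \<times> 'l) \<times> ('v \<Rightarrow> real)) set \<Rightarrow> 'v \<Rightarrow> real"

lemma copy_face: "i \<in> I \<Longrightarrow> fst i \<in> K" "i \<in> I \<Longrightarrow> finite (fst i)"
  by (rule facetD[OF I_facets], assumption)+

lemma copy_point_Z: "i \<in> I \<Longrightarrow> x \<in> simplex_pts (fst i) \<Longrightarrow> x \<in> topspace Z"
  unfolding topspace_Z by (rule bexI[OF _ copy_face(1)])

lemma copy_point_supp: "i \<in> I \<Longrightarrow> x \<in> simplex_pts (fst i) \<Longrightarrow> supp x \<subseteq> fst i"
  by (rule simplex_supp[OF copy_face(2)])

lemma copy_simplex: "i \<in> I \<Longrightarrow> x \<in> topspace Z \<Longrightarrow> supp x \<subseteq> fst i \<Longrightarrow> x \<in> simplex_pts (fst i)"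
  by (rule in_simplex[OF _ _ copy_face(2)])

text \<open>The equivalence relation of the quotient, read off from the combinatorics of the star of the
  support.\<close>

lemma point_eq_iff:
  assumes i: "i \<in> I" and x: "x \<in> simplex_pts (fst i)"
  shows "pt i x = pt j y \<longleftrightarrow> x = y \<and> around (supp x) i j"
proof -
  let ?s = "glue_step K d I G"
  have "pt i x = pt j y \<longleftrightarrow> equivclp ?s (i, x) (j, y)"
  proof
    assume "pt i x = pt j y"
    moreover have "(j, y) \<in> pt j y" by (simp add: point_def)
    ultimately have "(j, y) \<in> pt i x" by simp
    then show "equivclp ?s (i, x) (j, y)" by (simp add: point_def)
  next
    assume "equivclp ?s (i, x) (j, y)"
    then show "pt i x = pt j y"
      unfolding point_def by (intro Collect_cong) (metis equivclp_sym equivclp_trans)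
  qed
  also have "\<dots> \<longleftrightarrow> x = y \<and> around (supp x) i j"
  proof
    have gs: "glued K d I G (supp y) (fst a) (fst b)" if "?s a b" "snd a = y" for a b y
    proof -
      have "finite (fst (fst a) \<inter> fst (fst b))"
        using that(1) copy_face(2) by (auto simp: glue_step_def)
      then have "supp y \<subseteq> fst (fst a) \<inter> fst (fst b)"
        using that by (intro simplex_supp) (auto simp: glue_step_def)
      then show ?thesis using that(1) by (auto simp: glue_step_def glued_def)
    qed
    have "snd b = x \<and> around (supp x) i (fst b)" if "equivclp ?s (i, x) b" for b
      using that
    proof (induction rule: equivclp_induct)
      case (step b c)
      then have "snd b = x" "snd c = x" by (auto simp: glue_step_def)
      moreover have "around (supp x) (fst b) (fst c)"
        using step(2) gs[of b c x] gs[of c b x] calculation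
        by (blast intro: glued_imp_around glued_around_sym)
      ultimately show ?case using step by (blast intro: glued_around_trans)
    qed (simp add: glued_around_refl)
    then show "x = y \<and> around (supp x) i j" if "equivclp ?s (i, x) (j, y)"
      using that by fastforce
  next
    have gs: "?s (j, x) (k, x)" if "glued K d I G (supp x) j k" for j k
    proof -
      have "finite (fst j \<inter> fst k)" using that copy_face(2) by (auto simp: glued_def)
      then have "x \<in> simplex_pts (fst j \<inter> fst k)"
        using that copy_point_Z[OF i x] by (intro in_simplex) (auto simp: glued_def)
      then show ?thesis using that by (auto simp: glued_def glue_step_def)
    qed
    assume "x = y \<and> around (supp x) i j"
    moreover have "equivclp ?s (i, x) (j, x)" if "around (supp x) i j"
      using that
    proof (induction rule: glued_around_induct)
      case (step j k) then show ?case using gs by (meson equivclp_into_equivclp)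
    next
      case (sym j k) then show ?case using gs by (meson equivclp_into_equivclp)
    qed simp
    ultimately show "equivclp ?s (i, x) (j, y)" by blast
  qed
  finally show ?thesis .
qed

lemma star_facetD:
  assumes "\<sigma> \<in> facets (st K \<kappa>) d"
  shows "\<sigma> \<in> facets K d" "\<kappa> \<subseteq> \<sigma>"
proof -
  obtain \<tau> where \<tau>: "\<tau> \<in> K" "\<kappa> \<subseteq> \<tau>" "\<sigma> \<subseteq> \<tau>" using assms by (auto simp: facets_def st_def)
  show \<sigma>: "\<sigma> \<in> facets K d" using assms by (auto simp: facets_def st_def)
  from facet_maximal[OF this \<tau>(1,3)] \<tau>(2) show "\<kappa> \<subseteq> \<sigma>" by simp
qed

lemma relabel_along:
  assumes "facet_path (st K \<kappa>) d \<gamma>" "i \<in> I" "hd \<gamma> = fst i"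
  shows "\<exists>l. around \<kappa> i (last \<gamma>, l)"
  using assms
proof (induction \<gamma> arbitrary: i rule: induct_list012)
  case (2 \<sigma>)
  then have "around \<kappa> i (last [\<sigma>], snd i)" by (simp add: glued_around_refl)
  then show ?case by blast
next
  case (3 \<sigma> \<tau> \<gamma>)
  have n: "neighbors (st K \<kappa>) d \<sigma> \<tau>" and p: "facet_path (st K \<kappa>) d (\<tau> # \<gamma>)"
    using 3(3) by (auto simp: facet_path_def)
  have nK: "neighbors K d (fst i) \<tau>"
    using n 3(5) star_facetD(1) by (auto simp: neighbors_def ridges_def st_def)
  then obtain l where l: "(\<tau>, l) \<in> I" "G i (\<tau>, l)" using glue_exists[OF 3(4)] by blast
  have "\<kappa> \<subseteq> \<sigma> \<inter> \<tau>" using n star_facetD(2)[of _ \<kappa>] by (auto simp: neighbors_def)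
  then have "around \<kappa> i (\<tau>, l)"
    using nK l 3(4,5) by (intro glued_imp_around) (simp add: glued_def)
  moreover obtain m where "around \<kappa> (\<tau>, l) (last (\<tau> # \<gamma>), m)"
    using 3(2)[OF p l(1)] by auto
  ultimately have "around \<kappa> i (last (\<sigma> # \<tau> # \<gamma>), m)" by (auto intro: glued_around_trans)
  then show ?case by blast
qed (simp add: facet_path_def)

text \<open>Strong connectivity of stars, used to move a copy to any other facet around the same face
  without leaving its class.\<close>

lemma relabel_around:
  assumes "i \<in> I" "\<kappa> \<in> K" "\<kappa> \<subseteq> fst i" "\<tau> \<in> facets K d" "\<kappa> \<subseteq> \<tau>"
  shows "\<exists>l. around \<kappa> i (\<tau>, l)"
proof -
  have sc: "strongly_connected (st K \<kappa>) d" using loc_strong assms(2) by (simp add: locally_strongly_connected_def)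
  have "fst i \<in> facets (st K \<kappa>) d" "\<tau> \<in> facets (st K \<kappa>) d"
    using assms I_facets[OF assms(1)] by (auto simp: facets_def st_def)
  with sc obtain \<gamma> where "facet_path (st K \<kappa>) d \<gamma>" "hd \<gamma> = fst i" "last \<gamma> = \<tau>"
    unfolding strongly_connected_def by blast
  then show ?thesis using relabel_along assms(1) by blast
qed

lemma around_facet: "\<sigma> \<in> facets K d \<Longrightarrow> around \<sigma> i j \<Longrightarrow> i = j"
proof -
  assume \<sigma>: "\<sigma> \<in> facets K d"
  have no: "\<not> glued K d I G \<sigma> j k" for j k
  proof
    assume g: "glued K d I G \<sigma> j k"
    then have n: "neighbors K d (fst j) (fst k)" "\<sigma> \<subseteq> fst j" "\<sigma> \<subseteq> fst k" by (auto simp: glued_def)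
    with facet_maximal[OF \<sigma>] neighbors_facets[OF n(1)] facetD(1) show False by blast
  qed
  assume "around \<sigma> i j"
  then show "i = j" by (induction rule: glued_around_induct) (auto simp: no)
qed

lemma unram_facet: "\<sigma> \<in> facets K d \<Longrightarrow> unram \<sigma>"
  unfolding unramified_at_def using around_facet by blast

lemma copy_exists: "z \<in> topspace Z \<Longrightarrow> \<exists>i\<in>I. supp z \<subseteq> fst i"
proof -
  assume "z \<in> topspace Z"
  then obtain \<tau> where "\<tau> \<in> facets K d" "supp z \<subseteq> \<tau>"
    using supp_in_K pure_K unfolding pure_def by blast
  moreover obtain l where "(\<tau>, l) \<in> I" using label_exists[OF calculation(1)] by blast
  ultimately show ?thesis by (intro bexI[of _ "(\<tau>, l)"]) simp
qed

lemma topspace_Y: "a \<in> topspace Y \<longleftrightarrow> (\<exists>i\<in>I. \<exists>x\<in>simplex_pts (fst i). a = pt i x)"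
  unfolding topspace_unfolding_space by blast

lemma point_in_Y: "i \<in> I \<Longrightarrow> x \<in> simplex_pts (fst i) \<Longrightarrow> pt i x \<in> topspace Y"
  unfolding topspace_Y by blast

lemma point_in_preim: "i \<in> I \<Longrightarrow> x \<in> simplex_pts (fst i) \<Longrightarrow> pt i x \<in> preim Y g T \<longleftrightarrow> x \<in> T"
  by (simp add: preim_def point_in_Y)

lemma continuous_point:
  assumes "i \<in> I"
  shows "continuous_map (top_of_set (simplex_pts (fst i))) Y (pt i)"
  unfolding continuous_map_def using assms
  by (auto simp: point_in_Y openin_unfolding_space)

lemma continuous_g: "continuous_map Y Z g"
  unfolding continuous_map_def
proof (intro conjI allI impI)
  show "g \<in> topspace Y \<rightarrow> topspace Z" by (auto simp: topspace_Y copy_point_Z)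
  fix U assume U: "openin Z U"
  have "openin (top_of_set (simplex_pts (fst i))) {x \<in> simplex_pts (fst i). pt i x \<in> {a \<in> topspace Y. g a \<in> U}}"
    if "i \<in> I" for i
  proof -
    have "{x \<in> simplex_pts (fst i). pt i x \<in> {a \<in> topspace Y. g a \<in> U}} = simplex_pts (fst i) \<inter> U"
      using that by (auto simp: point_in_Y)
    then show ?thesis using U that copy_face(1) by (auto simp: openin_realization)
  qed
  then show "openin Y {a \<in> topspace Y. g a \<in> U}" by (subst openin_unfolding_space) auto
qed

lemma openin_preim: "openin Z U \<Longrightarrow> openin Y (preim Y g U)"
  using openin_continuous_map_preimage[OF continuous_g] by (simp add: preim_def)

text \<open>Sets that contain the open faces of codimension at most one. All connectivity of neighborhoods
  comes from paths through the interiors of facets and ridges, hence it persists in the trace on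
  such a set.\<close>

definition generic :: "('v \<Rightarrow> real) set \<Rightarrow> bool" where
  "generic T \<longleftrightarrow> (\<forall>x\<in>topspace Z. supp x \<in> facets K d \<union> ridges K d \<longrightarrow> x \<in> T)"

text \<open>Within one copy every point is joined by a segment to an interior point of the facet, and the
  segment stays generic. Consecutive copies of a chain share an interior point of the ridge
  along which they are glued. The convex set \<open>B\<close> is a small cube in the local
  statement and everything in the global one.\<close>

lemma connectedin_copies:
  assumes T: "generic T" and i: "i \<in> I" "\<kappa> \<subseteq> fst i"
    and conv: "\<And>x y t. x \<in> B \<Longrightarrow> y \<in> B \<Longrightarrow> t \<in> {0..1} \<Longrightarrow> segment x y t \<in> B"
    and full: "\<And>\<sigma>. \<sigma> \<in> facets K d \<union> ridges K d \<Longrightarrow> \<kappa> \<subseteq> \<sigma> \<Longrightarrow> \<exists>x\<in>simplex_pts \<sigma> \<inter> B. supp x = \<sigma>"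
  shows "connectedin Y {pt j x | j x. around \<kappa> i j \<and> x \<in> simplex_pts (fst j) \<inter> B \<inter> T}" (is "connectedin Y ?W")
proof -
  define W where "W = ?W"
  define linked where "linked = connected_component_of (subtopology Y W)"
  have linked_sym: "linked a b \<Longrightarrow> linked b a" for a b
    unfolding linked_def by (subst connected_component_of_sym)
  have linked_trans: "linked a b \<Longrightarrow> linked b c \<Longrightarrow> linked a c" for a b c
    unfolding linked_def by (rule connected_component_of_trans)
  have mem: "j \<in> I" "\<kappa> \<subseteq> fst j" if "around \<kappa> i j" for j using glued_around_mem[OF that i] by auto
  have WY: "W \<subseteq> topspace Y" unfolding W_def using mem(1) point_in_Y by blast
  have top: "topspace (subtopology Y W) = W" using WY by (rule topspace_subtopology_subset)
  have step1: "linked (pt j x) (pt j c)"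
    if j: "around \<kappa> i j" and x: "x \<in> simplex_pts (fst j) \<inter> B \<inter> T"
      and c: "c \<in> simplex_pts (fst j) \<inter> B" "supp c = fst j" for j x c
  proof -
    have jI: "j \<in> I" using mem j by blast
    have sp: "segment x c t \<in> simplex_pts (fst j) \<inter> B \<inter> T" if t: "t \<in> {0..1}" for t
    proof -
      have s: "segment x c t \<in> simplex_pts (fst j) \<inter> B" using x c t conv segment_in_simplex by blast
      consider "t = 0" | "0 < t" "t < 1" | "t = 1" using t by fastforce
      then have "segment x c t = x \<or> supp (segment x c t) = fst j"
      proof cases
        case 2
        have "supp x \<subseteq> fst j" using copy_point_supp[OF jI] x by blast
        with 2 show ?thesis using supp_segment[of x "fst j" c t] x c by auto
      qed (auto simp: segment_def c(2))
      moreover have "segment x c t \<in> T" if "supp (segment x c t) = fst j"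
        using T that s I_facets[OF jI] copy_point_Z[OF jI] unfolding generic_def by auto
      ultimately show ?thesis using s x by auto
    qed
    have spW: "pt j (segment x c t) \<in> W" if t: "t \<in> {0..1}" for t
      unfolding W_def using sp[OF t] j by blast
    have "continuous_map (top_of_set {0..1}) (top_of_set (simplex_pts (fst j))) (segment x c)"
      using sp continuous_segment by (auto simp: continuous_map_in_subtopology)
    from continuous_map_compose[OF this continuous_point[OF jI]]
    have "continuous_map (top_of_set {0..1}) (subtopology Y W) (pt j \<circ> segment x c)"
      using spW unfolding continuous_map_in_subtopology by (intro conjI image_subsetI) auto
    moreover have "connectedin (top_of_set {0..1::real}) {0..1}"
      by (simp add: connectedin_subtopology)
    ultimately have "connectedin (subtopology Y W) ((pt j \<circ> segment x c) ` {0..1})"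
      by (rule connectedin_continuous_map_image)
    moreover have "segment x c 0 = x" "segment x c 1 = c" by (auto simp: segment_def)
    then have "pt j x \<in> (pt j \<circ> segment x c) ` {0..1}" "pt j c \<in> (pt j \<circ> segment x c) ` {0..1}"
      using image_eqI[of "pt j x" "pt j \<circ> segment x c" 0 "{0..1}"]
        image_eqI[of "pt j c" "pt j \<circ> segment x c" 1 "{0..1}"] by simp_all
    ultimately show ?thesis unfolding linked_def connected_component_of_def by blast
  qed
  (* One interior point for each facet serves as the hub of all copies of that facet. *)
  define c where "c \<sigma> = (SOME x. x \<in> simplex_pts \<sigma> \<inter> B \<and> supp x = \<sigma>)" for \<sigma>
  have c: "c (fst j) \<in> simplex_pts (fst j) \<inter> B" "supp (c (fst j)) = fst j" if "around \<kappa> i j" for j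
  proof -
    have "\<exists>x. x \<in> simplex_pts (fst j) \<inter> B \<and> supp x = fst j"
      using full[of "fst j"] mem[OF that] I_facets by blast
    from someI_ex[OF this] show "c (fst j) \<in> simplex_pts (fst j) \<inter> B" "supp (c (fst j)) = fst j"
      unfolding c_def by auto
  qed
  have step2: "linked (pt j (c (fst j))) (pt k (c (fst k)))"
    if jk: "around \<kappa> i j" "glued K d I G \<kappa> j k" for j k
  proof -
    have k: "around \<kappa> i k" using jk glued_around_trans glued_imp_around by metis
    have r: "fst j \<inter> fst k \<in> ridges K d" "\<kappa> \<subseteq> fst j \<inter> fst k" and I: "j \<in> I" "k \<in> I"
      using jk(2) neighbors_ridge by (auto simp: glued_def)
    obtain x where x: "x \<in> simplex_pts (fst j \<inter> fst k)" "x \<in> B" "supp x = fst j \<inter> fst k"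
      using full[of "fst j \<inter> fst k"] r by blast
    have xZ: "x \<in> topspace Z" unfolding topspace_Z using x(1) ridgeD[OF r(1)] by blast
    then have xT: "x \<in> T" using T r(1) x(3) unfolding generic_def by auto
    have xs: "x \<in> simplex_pts (fst j)" "x \<in> simplex_pts (fst k)"
      using copy_simplex[OF _ xZ] I x(3) by auto
    have "around (supp x) j k"
      using jk(2) x(3) by (intro glued_imp_around) (auto simp: glued_def)
    then have "pt j x = pt k x" using point_eq_iff[OF I(1) xs(1)] by simp
    moreover have "linked (pt j x) (pt j (c (fst j)))" using step1[OF jk(1) _ c[OF jk(1)]] xs x xT by blast
    moreover have "linked (pt k x) (pt k (c (fst k)))" using step1[OF k _ c[OF k]] xs x xT by blast
    ultimately show ?thesis using linked_sym linked_trans by metis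
  qed
  have cW: "pt i (c (fst i)) \<in> W"
  proof -
    have s: "around \<kappa> i i" by (rule glued_around_refl)
    have "c (fst i) \<in> T" using T c[OF s] copy_point_Z[OF i(1)] I_facets[OF i(1)] unfolding generic_def by auto
    with c[OF s] s show ?thesis unfolding W_def by blast
  qed
  have step3: "linked (pt i (c (fst i))) (pt j (c (fst j)))" if "around \<kappa> i j" for j
    using that
  proof (induction rule: glued_around_induct)
    case base
    show ?case using cW top unfolding linked_def by (simp add: connected_component_of_refl)
  next
    case (step j k)
    then show ?case using step2[OF step(1,2)] linked_trans by blast
  next
    case (sym j k)
    then have "around \<kappa> i k" using glued_around_trans glued_around_sym glued_imp_around by metis
    then have "linked (pt k (c (fst k))) (pt j (c (fst j)))" using step2 sym(2) by blast
    then show ?case using sym(3) linked_sym linked_trans by blast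
  qed
  have step4: "linked (pt i (c (fst i))) a" if a: "a \<in> W" for a
  proof -
    obtain j x where j: "around \<kappa> i j" "x \<in> simplex_pts (fst j) \<inter> B \<inter> T" "a = pt j x" using a unfolding W_def by blast
    have "linked (pt j x) (pt j (c (fst j)))" using step1[OF j(1,2) c[OF j(1)]] .
    with step3[OF j(1)] show ?thesis
      unfolding j(3) using linked_sym linked_trans by blast
  qed
  have "connected_space (subtopology Y W)"
    unfolding connected_space_iff_connected_component top linked_def[symmetric]
    using step4 linked_sym linked_trans by blast
  then show ?thesis using WY unfolding W_def by (simp add: connectedin_def)
qed


section \<open>Neighborhoods of the points over a given point\<close>

text \<open>Radii for which no point of the cube loses a vertex of the support of the center.\<close>

definition small :: "('v \<Rightarrow> real) \<Rightarrow> real \<Rightarrow> bool" where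
  "small z \<epsilon> \<longleftrightarrow> 0 < \<epsilon> \<and> (\<forall>v\<in>supp z. \<epsilon> \<le> z v)"

definition star :: "('v \<Rightarrow> real) \<Rightarrow> real \<Rightarrow> ('v \<Rightarrow> real) set" where
  "star z \<epsilon> = topspace Z \<inter> cube z \<epsilon>"

text \<open>The part of the preimage of the cube about \<open>z\<close> that belongs to the point
  \<open>pt i z\<close>.\<close>

definition nbhd :: "'v set \<times> 'l \<Rightarrow> ('v \<Rightarrow> real) \<Rightarrow> real \<Rightarrow> (('v set \<times> 'l) \<times> ('v \<Rightarrow> real)) set set" where
  "nbhd i z \<epsilon> = {pt j x | j x. around (supp z) i j \<and> x \<in> simplex_pts (fst j) \<inter> cube z \<epsilon>}"

lemma small_pos: "small z \<epsilon> \<Longrightarrow> 0 < \<epsilon>"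
  by (simp add: small_def)

lemma small_exists:
  assumes z: "z \<in> topspace Z" and "0 < \<epsilon>0"
  shows "\<exists>\<epsilon>\<le>\<epsilon>0. small z \<epsilon>"
proof -
  have fin: "finite (supp z)" by (rule finite_supp[OF z])
  have "0 < z v" if "v \<in> supp z" for v
  proof -
    obtain \<sigma> where "z \<in> simplex_pts \<sigma>" using z unfolding topspace_Z by blast
    then have "0 \<le> z v" by (simp add: simplex_pts_def)
    moreover have "z v \<noteq> 0" using that by (simp add: supp_def)
    ultimately show ?thesis by simp
  qed
  then have "small z (Min (insert \<epsilon>0 (z ` supp z)))" using fin assms(2) by (auto simp: small_def)
  moreover have "Min (insert \<epsilon>0 (z ` supp z)) \<le> \<epsilon>0" using fin by simp
  ultimately show ?thesis by blast
qed

lemma supp_near: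
  assumes "small z \<epsilon>" "x \<in> cube z \<epsilon>"
  shows "supp z \<subseteq> supp x"
proof
  fix v assume "v \<in> supp z"
  then have "\<epsilon> \<le> z v" "\<bar>x v - z v\<bar> < \<epsilon>" using assms by (auto simp: small_def cube_def)
  then have "x v > 0" by (simp add: abs_less_iff)
  then show "v \<in> supp x" by (simp add: supp_def)
qed

lemma cube_mono: "\<epsilon> \<le> \<epsilon>' \<Longrightarrow> cube z \<epsilon> \<subseteq> cube z \<epsilon>'"
  unfolding cube_def by (auto intro: less_le_trans)

lemma openin_star: "z \<in> topspace Z \<Longrightarrow> openin Z (star z \<epsilon>)"
  unfolding openin_realization
proof (intro conjI ballI)
  assume z: "z \<in> topspace Z"
  show "star z \<epsilon> \<subseteq> (\<Union>\<sigma>\<in>K. simplex_pts \<sigma>)" by (auto simp: star_def topspace_realization)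
  fix \<sigma> assume \<sigma>: "\<sigma> \<in> K"
  have "simplex_pts \<sigma> \<inter> star z \<epsilon> = simplex_pts \<sigma> \<inter> cube z \<epsilon>"
    using \<sigma> by (auto simp: star_def topspace_realization)
  then show "openin (top_of_set (simplex_pts \<sigma>)) (simplex_pts \<sigma> \<inter> star z \<epsilon>)"
    using openin_cube[OF finite_face[OF \<sigma>] finite_supp[OF z]] by simp
qed

lemma center_in_star: "z \<in> topspace Z \<Longrightarrow> small z \<epsilon> \<Longrightarrow> z \<in> star z \<epsilon>"
  by (simp add: star_def center_in_cube small_pos)

lemma finite_cofaces: "z \<in> topspace Z \<Longrightarrow> finite {\<sigma>\<in>K. supp z \<subseteq> \<sigma>}"
proof -
  assume z: "z \<in> topspace Z"
  then obtain v where "v \<in> supp z" using face_nonempty[OF supp_in_K[OF z]] by blast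
  then have "{\<sigma>\<in>K. supp z \<subseteq> \<sigma>} \<subseteq> {\<sigma>\<in>K. v \<in> \<sigma>}" by blast
  then show ?thesis using locfin unfolding locally_finite_def by (meson finite_subset)
qed

text \<open>Only finitely many faces contain the support of \<open>z\<close>, and every point close to
  \<open>z\<close> lies in one of them; so finitely many radii have to be considered.\<close>

lemma star_base:
  assumes U: "openin Z U" "z \<in> U" and "0 < \<epsilon>0"
  shows "\<exists>\<epsilon>\<le>\<epsilon>0. small z \<epsilon> \<and> star z \<epsilon> \<subseteq> U"
proof -
  have z: "z \<in> topspace Z" using U openin_subset by blast
  let ?F = "{\<sigma>\<in>K. supp z \<subseteq> \<sigma>}"
  have "\<exists>\<epsilon>>0. simplex_pts \<sigma> \<inter> cube z \<epsilon> \<subseteq> simplex_pts \<sigma> \<inter> U" if "\<sigma> \<in> ?F" for \<sigma>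
    using that U in_simplex[OF z] finite_face[of \<sigma>]
    by (intro open_simplex_contains_cube) (auto simp: openin_realization)
  then obtain e where e: "\<And>\<sigma>. \<sigma> \<in> ?F \<Longrightarrow> e \<sigma> > 0"
      "\<And>\<sigma>. \<sigma> \<in> ?F \<Longrightarrow> simplex_pts \<sigma> \<inter> cube z (e \<sigma>) \<subseteq> simplex_pts \<sigma> \<inter> U"
    by metis
  let ?m = "Min (insert \<epsilon>0 (e ` ?F))"
  have m: "0 < ?m" "?m \<le> \<epsilon>0" "\<And>\<sigma>. \<sigma> \<in> ?F \<Longrightarrow> ?m \<le> e \<sigma>"
    using finite_cofaces[OF z] e(1) assms(3) by auto
  obtain \<epsilon> where \<epsilon>: "\<epsilon> \<le> ?m" "small z \<epsilon>" using small_exists[OF z m(1)] by blast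
  have "x \<in> U" if x: "x \<in> star z \<epsilon>" for x
  proof -
    have xZ: "x \<in> topspace Z" and xb: "x \<in> cube z \<epsilon>" using x by (auto simp: star_def)
    have F: "supp x \<in> ?F" using supp_in_K[OF xZ] supp_near[OF \<epsilon>(2) xb] by blast
    have "x \<in> simplex_pts (supp x)" using in_simplex[OF xZ subset_refl finite_supp[OF xZ]] .
    moreover have "x \<in> cube z (e (supp x))" using xb cube_mono[of \<epsilon> "e (supp x)"] m(3)[OF F] \<epsilon>(1) by auto
    ultimately show ?thesis using e(2)[OF F] by blast
  qed
  with \<epsilon> m(2) show ?thesis by (intro exI[of _ \<epsilon>]) auto
qed

text \<open>The neighborhoods are saturated: points of the cube have larger supports than
  \<open>z\<close>, so identifications at such a point are also identifications at
  \<open>z\<close>.\<close>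

lemma point_in_nbhd_iff:
  assumes z: "small z \<epsilon>" and i: "i \<in> I" "supp z \<subseteq> fst i" and j: "j \<in> I" "x \<in> simplex_pts (fst j)"
  shows "pt j x \<in> nbhd i z \<epsilon> \<longleftrightarrow> around (supp z) i j \<and> x \<in> cube z \<epsilon>"
proof
  assume "pt j x \<in> nbhd i z \<epsilon>"
  then obtain k y where k: "around (supp z) i k" "y \<in> cube z \<epsilon>" "pt j x = pt k y"
    unfolding nbhd_def by blast
  then have e: "x = y" "around (supp x) j k" using point_eq_iff[OF j] by auto
  then have "around (supp z) j k" using glued_around_mono[OF supp_near[OF z k(2)]] by simp
  then show "around (supp z) i j \<and> x \<in> cube z \<epsilon>"
    using k e glued_around_trans glued_around_sym by metis
next
  assume "around (supp z) i j \<and> x \<in> cube z \<epsilon>"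
  with j(2) show "pt j x \<in> nbhd i z \<epsilon>" unfolding nbhd_def by blast
qed

lemma nbhd_subset: "i \<in> I \<Longrightarrow> supp z \<subseteq> fst i \<Longrightarrow> nbhd i z \<epsilon> \<subseteq> topspace Y"
  unfolding nbhd_def using glued_around_mem(1) point_in_Y by blast

lemma openin_nbhd:
  assumes z: "z \<in> topspace Z" "small z \<epsilon>" and i: "i \<in> I" "supp z \<subseteq> fst i"
  shows "openin Y (nbhd i z \<epsilon>)"
  unfolding openin_unfolding_space
proof (intro conjI ballI)
  fix j assume j: "j \<in> I"
  have "{x \<in> simplex_pts (fst j). pt j x \<in> nbhd i z \<epsilon>} =
      (if around (supp z) i j then simplex_pts (fst j) \<inter> cube z \<epsilon> else {})"
    using point_in_nbhd_iff[OF z(2) i j] by auto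
  then show "openin (top_of_set (simplex_pts (fst j))) {x \<in> simplex_pts (fst j). pt j x \<in> nbhd i z \<epsilon>}"
    using openin_cube[OF copy_face(2)[OF j] finite_supp[OF z(1)]] by simp
qed (rule nbhd_subset[OF i])

lemma center_in_nbhd:
  assumes "z \<in> topspace Z" "small z \<epsilon>" "i \<in> I" "supp z \<subseteq> fst i"
  shows "pt i z \<in> nbhd i z \<epsilon>"
  using assms copy_simplex[of i z] point_in_nbhd_iff[OF assms(2-4), of i z]
  by (simp add: glued_around_refl center_in_cube small_pos)

lemma nbhd_base:
  assumes V: "openin Y V" "pt i z \<in> V" and i: "i \<in> I" "supp z \<subseteq> fst i" and z: "z \<in> topspace Z"
    and "0 < \<epsilon>0"
  shows "\<exists>\<epsilon>\<le>\<epsilon>0. small z \<epsilon> \<and> nbhd i z \<epsilon> \<subseteq> V"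
proof -
  let ?F = "{j. around (supp z) i j}"
  have F: "j \<in> I" "z \<in> simplex_pts (fst j)" "pt j z = pt i z" if "j \<in> ?F" for j
  proof -
    have j: "around (supp z) i j" using that by simp
    show "j \<in> I" and zs: "z \<in> simplex_pts (fst j)"
      using glued_around_mem[OF j i] copy_simplex[OF _ z] by auto
    show "pt j z = pt i z"
      using point_eq_iff[OF i(1) copy_simplex[OF i(1) z i(2)], of j z] j by simp
  qed
  have finF: "finite ?F"
  proof (rule finite_subset)
    show "?F \<subseteq> Sigma {\<sigma>\<in>K. supp z \<subseteq> \<sigma>} (\<lambda>\<sigma>. {l. (\<sigma>, l) \<in> I})"
    proof
      fix j assume j: "j \<in> ?F"
      then have "fst j \<in> K" "(fst j, snd j) \<in> I" "supp z \<subseteq> fst j"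
        using F(1)[OF j] copy_face(1) glued_around_mem(2)[OF _ i] by auto
      then show "j \<in> Sigma {\<sigma>\<in>K. supp z \<subseteq> \<sigma>} (\<lambda>\<sigma>. {l. (\<sigma>, l) \<in> I})" by (cases j) simp
    qed
    show "finite (Sigma {\<sigma>\<in>K. supp z \<subseteq> \<sigma>} (\<lambda>\<sigma>. {l. (\<sigma>, l) \<in> I}))"
      using finite_cofaces[OF z] finite_labels by (intro finite_SigmaI)
  qed
  have "\<exists>\<epsilon>>0. simplex_pts (fst j) \<inter> cube z \<epsilon> \<subseteq> {x \<in> simplex_pts (fst j). pt j x \<in> V}" if j: "j \<in> ?F" for j
  proof (rule open_simplex_contains_cube)
    show "finite (fst j)" by (rule copy_face(2)[OF F(1)[OF j]])
    show "openin (top_of_set (simplex_pts (fst j))) {x \<in> simplex_pts (fst j). pt j x \<in> V}"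
      using V(1) F(1)[OF j] unfolding openin_unfolding_space by blast
    show "z \<in> {x \<in> simplex_pts (fst j). pt j x \<in> V}" using F[OF j] V(2) by simp
  qed
  then have "\<forall>j\<in>?F. \<exists>\<epsilon>. 0 < \<epsilon> \<and> simplex_pts (fst j) \<inter> cube z \<epsilon> \<subseteq> {x \<in> simplex_pts (fst j). pt j x \<in> V}"
    by blast
  from bchoice[OF this] obtain e where
    "\<forall>j\<in>?F. 0 < e j \<and> simplex_pts (fst j) \<inter> cube z (e j) \<subseteq> {x \<in> simplex_pts (fst j). pt j x \<in> V}" ..
  then have e: "\<And>j. j \<in> ?F \<Longrightarrow> e j > 0"
      "\<And>j. j \<in> ?F \<Longrightarrow> simplex_pts (fst j) \<inter> cube z (e j) \<subseteq> {x \<in> simplex_pts (fst j). pt j x \<in> V}"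
    by blast+
  let ?m = "Min (insert \<epsilon>0 (e ` ?F))"
  have m: "0 < ?m" "?m \<le> \<epsilon>0" "\<And>j. j \<in> ?F \<Longrightarrow> ?m \<le> e j"
    using finF e(1) assms(6) by auto
  obtain \<epsilon> where \<epsilon>: "\<epsilon> \<le> ?m" "small z \<epsilon>" using small_exists[OF z m(1)] by blast
  have "a \<in> V" if a: "a \<in> nbhd i z \<epsilon>" for a
  proof -
    obtain j x where j: "j \<in> ?F" "x \<in> simplex_pts (fst j)" "x \<in> cube z \<epsilon>" "a = pt j x"
      using a unfolding nbhd_def by blast
    have "x \<in> cube z (e j)" using j(3) cube_mono[of \<epsilon> "e j"] m(3)[OF j(1)] \<epsilon>(1) by auto
    then show ?thesis using e(2)[OF j(1)] j by blast
  qed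
  with \<epsilon> m(2) show ?thesis by (intro exI[of _ \<epsilon>]) auto
qed

lemma preim_star:
  assumes z: "z \<in> topspace Z" "small z \<epsilon>"
  shows "preim Y g (star z \<epsilon>) = (\<Union>i\<in>{i \<in> I. supp z \<subseteq> fst i}. nbhd i z \<epsilon>)"
proof
  show "preim Y g (star z \<epsilon>) \<subseteq> (\<Union>i\<in>{i \<in> I. supp z \<subseteq> fst i}. nbhd i z \<epsilon>)"
  proof
    fix a assume "a \<in> preim Y g (star z \<epsilon>)"
    then obtain i x where i: "i \<in> I" "x \<in> simplex_pts (fst i)" "a = pt i x" "x \<in> cube z \<epsilon>"
      by (auto simp: preim_def topspace_Y star_def)
    have "supp z \<subseteq> fst i" using supp_near[OF z(2) i(4)] copy_point_supp[OF i(1,2)] by blast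
    moreover have "a \<in> nbhd i z \<epsilon>" using i glued_around_refl unfolding nbhd_def by blast
    ultimately show "a \<in> (\<Union>i\<in>{i \<in> I. supp z \<subseteq> fst i}. nbhd i z \<epsilon>)" using i(1) by blast
  qed
  show "(\<Union>i\<in>{i \<in> I. supp z \<subseteq> fst i}. nbhd i z \<epsilon>) \<subseteq> preim Y g (star z \<epsilon>)"
  proof
    fix a assume "a \<in> (\<Union>i\<in>{i \<in> I. supp z \<subseteq> fst i}. nbhd i z \<epsilon>)"
    then obtain i j x where i: "i \<in> I" "supp z \<subseteq> fst i" "around (supp z) i j"
        "x \<in> simplex_pts (fst j)" "x \<in> cube z \<epsilon>" "a = pt j x"
      unfolding nbhd_def by blast
    have j: "j \<in> I" using glued_around_mem(1)[OF i(3,1,2)] .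
    then show "a \<in> preim Y g (star z \<epsilon>)"
      using i copy_point_Z[OF j i(4)] point_in_Y[OF j i(4)] by (simp add: preim_def star_def)
  qed
qed

text \<open>Each sheet covers the whole cube, as a copy can be moved to every facet around
  \<open>z\<close>.\<close>

lemma image_nbhd:
  assumes z: "z \<in> topspace Z" "small z \<epsilon>" and i: "i \<in> I" "supp z \<subseteq> fst i"
  shows "g ` nbhd i z \<epsilon> = star z \<epsilon>"
proof
  have "nbhd i z \<epsilon> \<subseteq> preim Y g (star z \<epsilon>)" unfolding preim_star[OF z] using i by blast
  then show "g ` nbhd i z \<epsilon> \<subseteq> star z \<epsilon>" by (auto simp: preim_def)
  show "star z \<epsilon> \<subseteq> g ` nbhd i z \<epsilon>"
  proof
    fix x assume x: "x \<in> star z \<epsilon>"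
    then have xZ: "x \<in> topspace Z" and xb: "x \<in> cube z \<epsilon>" by (auto simp: star_def)
    have sub: "supp z \<subseteq> supp x" by (rule supp_near[OF z(2) xb])
    obtain k where k: "k \<in> I" "supp x \<subseteq> fst k" using copy_exists[OF xZ] by blast
    then obtain l where l: "around (supp z) i (fst k, l)"
      using relabel_around[OF i(1) supp_in_K[OF z(1)] i(2) I_facets[OF k(1)]] sub by blast
    have "x \<in> simplex_pts (fst k)" using copy_simplex[OF k(1) xZ k(2)] .
    then have "pt (fst k, l) x \<in> nbhd i z \<epsilon>" unfolding nbhd_def using l xb by force
    then show "x \<in> g ` nbhd i z \<epsilon>" using image_eqI[of x g "pt (fst k, l) x"] by simp
  qed
qed

lemma nbhd_eq_or_disjnt:
  assumes z: "small z \<epsilon>" and i: "i \<in> I" "supp z \<subseteq> fst i" and k: "k \<in> I" "supp z \<subseteq> fst k"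
    and ne: "nbhd i z \<epsilon> \<inter> nbhd k z \<epsilon> \<noteq> {}"
  shows "around (supp z) i k" "nbhd i z \<epsilon> = nbhd k z \<epsilon>"
proof -
  obtain j x where j: "around (supp z) i j" "x \<in> simplex_pts (fst j)" "pt j x \<in> nbhd k z \<epsilon>"
    using ne unfolding nbhd_def by blast
  then have "around (supp z) k j"
    using point_in_nbhd_iff[OF z k glued_around_mem(1)[OF j(1) i] j(2)] by simp
  with j(1) show ik: "around (supp z) i k" using glued_around_trans glued_around_sym by metis
  have "around (supp z) i j \<longleftrightarrow> around (supp z) k j" for j
    using ik glued_around_trans glued_around_sym by metis
  then show "nbhd i z \<epsilon> = nbhd k z \<epsilon>" unfolding nbhd_def by simp
qed

lemma connectedin_nbhd:
  assumes T: "generic T" and z: "z \<in> topspace Z" "small z \<epsilon>" and i: "i \<in> I" "supp z \<subseteq> fst i"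
  shows "connectedin Y (nbhd i z \<epsilon> \<inter> preim Y g T)" "nbhd i z \<epsilon> \<inter> preim Y g T \<noteq> {}"
proof -
  have near: "\<exists>x\<in>simplex_pts \<sigma> \<inter> cube z \<epsilon>. supp x = \<sigma>" if "\<sigma> \<in> facets K d \<union> ridges K d" "supp z \<subseteq> \<sigma>" for \<sigma>
  proof -
    have f: "finite \<sigma>" using that facetD(2) ridgeD finite_face by blast
    show ?thesis by (rule interior_point_near[OF f in_simplex[OF z(1) that(2) f] small_pos[OF z(2)]])
  qed
  have eq: "nbhd i z \<epsilon> \<inter> preim Y g T =
      {pt j x | j x. around (supp z) i j \<and> x \<in> simplex_pts (fst j) \<inter> cube z \<epsilon> \<inter> T}"
  proof -
    have "pt j x \<in> preim Y g T \<longleftrightarrow> x \<in> T" if "around (supp z) i j" "x \<in> simplex_pts (fst j)" for j x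
      using point_in_preim[OF glued_around_mem(1)[OF that(1) i] that(2)] .
    then show ?thesis unfolding nbhd_def by blast
  qed
  show "connectedin Y (nbhd i z \<epsilon> \<inter> preim Y g T)"
    unfolding eq by (rule connectedin_copies[OF T i segment_in_cube near])
  obtain x where x: "x \<in> simplex_pts (fst i) \<inter> cube z \<epsilon>" "supp x = fst i"
    using near[of "fst i"] I_facets[OF i(1)] i(2) by blast
  then have "x \<in> T" using T copy_point_Z[OF i(1)] I_facets[OF i(1)] unfolding generic_def by auto
  with x have "pt i x \<in> nbhd i z \<epsilon> \<inter> preim Y g T" unfolding eq using glued_around_refl by blast
  then show "nbhd i z \<epsilon> \<inter> preim Y g T \<noteq> {}" by blast
qed

text \<open>The preimage of a small cube has one component for each point over its center, also after
  restriction to a generic open set.\<close>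

lemma preim_components_star:
  assumes T: "generic T" "openin Z T" and z: "z \<in> topspace Z" "small z \<epsilon>"
  shows "preim_components (subtopology Y (preim Y g T)) g (star z \<epsilon>) =
    (\<lambda>i. nbhd i z \<epsilon> \<inter> preim Y g T) ` {i \<in> I. supp z \<subseteq> fst i}" (is "_ = ?\<C>")
proof -
  let ?S = "preim Y g T"
  let ?X = "subtopology Y (?S \<inter> preim Y g (star z \<epsilon>))"
  have sub: "preim Y g A \<subseteq> topspace Y" for A by (auto simp: preim_def)
  have "preim (subtopology Y ?S) g (star z \<epsilon>) = ?S \<inter> preim Y g (star z \<epsilon>)" by (auto simp: preim_def)
  then have X: "subtopology (subtopology Y ?S) (preim (subtopology Y ?S) g (star z \<epsilon>)) = ?X"
    by (simp add: subtopology_subtopology inf_absorb2)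
  have C: "nbhd i z \<epsilon> \<inter> ?S \<subseteq> ?S \<inter> preim Y g (star z \<epsilon>)" if "i \<in> I" "supp z \<subseteq> fst i" for i
    unfolding preim_star[OF z] using that by blast
  have "connected_components_of ?X = ?\<C>"
  proof (rule connected_components_of_open_partition)
    have "topspace ?X = ?S \<inter> preim Y g (star z \<epsilon>)" using sub by (intro topspace_subtopology_subset) blast
    then show "\<Union>?\<C> = topspace ?X" unfolding preim_star[OF z] by blast
    fix A assume "A \<in> ?\<C>"
    then obtain i where i: "i \<in> I" "supp z \<subseteq> fst i" "A = nbhd i z \<epsilon> \<inter> ?S" by blast
    have "openin Y A" unfolding i(3) using openin_nbhd[OF z i(1,2)] openin_preim[OF T(2)] by blast
    moreover have "A = A \<inter> (?S \<inter> preim Y g (star z \<epsilon>))" using C[OF i(1,2)] i(3) by blast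
    ultimately show "openin ?X A" unfolding openin_subtopology by blast
    show "connectedin ?X A \<and> A \<noteq> {}"
      using connectedin_nbhd[OF T(1) z i(1,2)] C[OF i(1,2)] unfolding i(3) connectedin_subtopology by blast
  next
    show "pairwise disjnt ?\<C>"
    proof (rule pairwiseI)
      fix A B assume "A \<in> ?\<C>" "B \<in> ?\<C>" "A \<noteq> B"
      then obtain i k where i: "i \<in> I" "supp z \<subseteq> fst i" "A = nbhd i z \<epsilon> \<inter> ?S"
        and k: "k \<in> I" "supp z \<subseteq> fst k" "B = nbhd k z \<epsilon> \<inter> ?S" and "A \<noteq> B" by blast
      then have "nbhd i z \<epsilon> \<noteq> nbhd k z \<epsilon>" by blast
      with nbhd_eq_or_disjnt(2)[OF z(2) i(1,2) k(1,2)] show "disjnt A B"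
        unfolding i(3) k(3) disjnt_def by blast
    qed
  qed
  then show ?thesis unfolding preim_components_def X .
qed


section \<open>Spreads and the ordinary set\<close>

text \<open>The set over which the unfolding turns out to be a covering.\<close>

definition unramified_part :: "('v \<Rightarrow> real) set" where
  "unramified_part = {z \<in> topspace Z. unram (supp z)}"

lemma topspace_preim: "topspace (subtopology Y (preim Y g T)) = preim Y g T"
  by (rule topspace_subtopology_subset) (auto simp: preim_def)

lemma preim_topspace: "preim Y g (topspace Z) = topspace Y"
  using continuous_g by (auto simp: preim_def continuous_map_def Pi_iff)

lemma generic_topspace: "generic (topspace Z)"
  by (simp add: generic_def)

lemma generic_unramified_part: "generic unramified_part"
  using unram_facet unramified_ridge by (auto simp: generic_def unramified_part_def)

lemma openin_unramified_part: "openin Z unramified_part"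
proof (subst openin_subopen, intro ballI)
  fix z assume "z \<in> unramified_part"
  then have z: "z \<in> topspace Z" "unram (supp z)" by (auto simp: unramified_part_def)
  obtain \<epsilon> where \<epsilon>: "small z \<epsilon>" using small_exists[OF z(1) zero_less_one] by blast
  have "star z \<epsilon> \<subseteq> unramified_part"
    using unramified_at_mono[OF supp_near[OF \<epsilon>] z(2)] by (auto simp: star_def unramified_part_def)
  with openin_star[OF z(1)] center_in_star[OF z(1) \<epsilon>]
  show "\<exists>U. openin Z U \<and> z \<in> U \<and> U \<subseteq> unramified_part" by blast
qed

lemma connectedin_star:
  assumes T: "generic T" "openin Z T" and z: "z \<in> topspace Z" "small z \<epsilon>"
  shows "connectedin Z (star z \<epsilon> \<inter> T)" "star z \<epsilon> \<inter> T \<noteq> {}"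
proof -
  obtain i where i: "i \<in> I" "supp z \<subseteq> fst i" using copy_exists[OF z(1)] by blast
  let ?N = "nbhd i z \<epsilon>"
  have "g ` (?N \<inter> preim Y g T) = star z \<epsilon> \<inter> T"
    using nbhd_subset[OF i] unfolding image_nbhd[OF z i, symmetric] preim_def by blast
  with connectedin_continuous_map_image[OF continuous_g connectedin_nbhd(1)[OF T(1) z i]]
    connectedin_nbhd(2)[OF T(1) z i]
  show "connectedin Z (star z \<epsilon> \<inter> T)" "star z \<epsilon> \<inter> T \<noteq> {}" by auto
qed

lemma locally_connected_in_base:
  assumes T: "generic T" "openin Z T"
  shows "locally_connected_in T Z"
  unfolding locally_connected_in_def
proof (intro allI impI)
  fix V z assume V: "openin Z V \<and> z \<in> V"
  then have z: "z \<in> topspace Z" using openin_subset by blast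
  obtain \<epsilon> where \<epsilon>: "small z \<epsilon>" "star z \<epsilon> \<subseteq> V" using star_base[of V z 1] V by auto
  show "\<exists>B. openin Z B \<and> z \<in> B \<and> B \<subseteq> V \<and> connectedin Z (B \<inter> T)"
    using openin_star[OF z] center_in_star[OF z \<epsilon>(1)] \<epsilon>(2) connectedin_star(1)[OF T z \<epsilon>(1)] by blast
qed

lemma dense_in_base:
  assumes T: "generic T" "openin Z T"
  shows "dense_in T Z"
  unfolding dense_in_def dense_intersects_open
proof (intro conjI allI impI)
  show "T \<subseteq> topspace Z" using T(2) openin_subset by blast
  fix V assume V: "openin Z V \<and> V \<noteq> {}"
  then obtain z where zV: "z \<in> V" by blast
  then have z: "z \<in> topspace Z" using V openin_subset by blast
  obtain \<epsilon> where \<epsilon>: "small z \<epsilon>" "star z \<epsilon> \<subseteq> V" using star_base[of V z 1] V zV by auto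
  show "T \<inter> V \<noteq> {}" using connectedin_star(2)[OF T z \<epsilon>(1)] \<epsilon>(2) by blast
qed

lemma locally_connected_base: "locally_connected_space Z"
  unfolding locally_connected_space
proof (intro allI impI)
  fix V z assume V: "openin Z V \<and> z \<in> V"
  then have z: "z \<in> topspace Z" using openin_subset by blast
  obtain \<epsilon> where \<epsilon>: "small z \<epsilon>" "star z \<epsilon> \<subseteq> V" using star_base[of V z 1] V by auto
  have "star z \<epsilon> \<inter> topspace Z = star z \<epsilon>" by (auto simp: star_def)
  then show "\<exists>U. openin Z U \<and> connectedin Z U \<and> z \<in> U \<and> U \<subseteq> V"
    using openin_star[OF z] center_in_star[OF z \<epsilon>(1)] \<epsilon>(2)
      connectedin_star(1)[OF generic_topspace openin_topspace z \<epsilon>(1)] by metis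
qed

lemma t1_base: "t1_space Z"
  unfolding t1_space_def
proof (intro ballI impI)
  fix z w assume z: "z \<in> topspace Z" "w \<in> topspace Z" "z \<noteq> w"
  then obtain v where v: "z v \<noteq> w v" by blast
  then obtain \<epsilon> where \<epsilon>: "small z \<epsilon>" "\<epsilon> \<le> \<bar>w v - z v\<bar>"
    using small_exists[OF z(1), of "\<bar>w v - z v\<bar>"] by auto
  have "w \<notin> star z \<epsilon>"
  proof
    assume "w \<in> star z \<epsilon>"
    then have "\<bar>w v - z v\<bar> < \<epsilon>" by (simp add: star_def cube_def)
    with \<epsilon>(2) show False by simp
  qed
  with openin_star[OF z(1)] center_in_star[OF z(1) \<epsilon>(1)]
  show "\<exists>U. openin Z U \<and> z \<in> U \<and> w \<notin> U" by blast
qed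

lemma t1_Y: "t1_space Y"
  unfolding t1_space_def
proof (intro ballI impI)
  fix a b assume ab: "a \<in> topspace Y" "b \<in> topspace Y" "a \<noteq> b"
  obtain i z where i: "i \<in> I" "z \<in> simplex_pts (fst i)" "a = pt i z" using ab(1) topspace_Y by blast
  obtain j w where j: "j \<in> I" "w \<in> simplex_pts (fst j)" "b = pt j w" using ab(2) topspace_Y by blast
  have z: "z \<in> topspace Z" "w \<in> topspace Z" using copy_point_Z i j by blast+
  show "\<exists>U. openin Y U \<and> a \<in> U \<and> b \<notin> U"
  proof (cases "z = w")
    case True
    obtain \<epsilon> where \<epsilon>: "small z \<epsilon>" using small_exists[OF z(1) zero_less_one] by blast
    note si = copy_point_supp[OF i(1,2)]
    have "b \<notin> nbhd i z \<epsilon>"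
    proof
      assume "b \<in> nbhd i z \<epsilon>"
      then have "around (supp z) i j" using point_in_nbhd_iff[OF \<epsilon> i(1) si j(1,2)] j(3) by simp
      then have "pt i z = pt j w" using point_eq_iff[OF i(1,2)] True by simp
      with ab(3) i(3) j(3) show False by simp
    qed
    with openin_nbhd[OF z(1) \<epsilon> i(1) si] center_in_nbhd[OF z(1) \<epsilon> i(1) si] i(3) show ?thesis by blast
  next
    case False
    then obtain U where U: "openin Z U" "z \<in> U" "w \<notin> U"
      using t1_base z unfolding t1_space_def by blast
    have "a \<in> preim Y g U" "b \<notin> preim Y g U"
      using U i j point_in_preim by auto
    with openin_preim[OF U(1)] show ?thesis by blast
  qed
qed

lemma nbhd_in_open_part:
  assumes T: "openin Z T" and V: "openin (subtopology Y (preim Y g T)) V" "a \<in> V"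
  obtains i z \<epsilon> where "i \<in> I" "supp z \<subseteq> fst i" "z \<in> topspace Z" "small z \<epsilon>" "a \<in> nbhd i z \<epsilon>"
    "nbhd i z \<epsilon> \<subseteq> V" "V \<subseteq> preim Y g T"
proof -
  have VY: "openin Y V" and VT: "V \<subseteq> preim Y g T"
    using V(1) openin_preim[OF T] by (auto simp: openin_open_subtopology)
  then have "a \<in> topspace Y" using V(2) openin_subset by blast
  then obtain i z where i: "i \<in> I" "z \<in> simplex_pts (fst i)" "a = pt i z" using topspace_Y by blast
  note z = copy_point_Z[OF i(1,2)] and si = copy_point_supp[OF i(1,2)]
  obtain \<epsilon> where \<epsilon>: "small z \<epsilon>" "nbhd i z \<epsilon> \<subseteq> V"
    using nbhd_base[OF VY _ i(1) si z zero_less_one] V(2) i(3) by blast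
  have "a \<in> nbhd i z \<epsilon>" unfolding i(3) by (rule center_in_nbhd[OF z \<epsilon>(1) i(1) si])
  then show ?thesis using that[OF i(1) si z \<epsilon>(1) _ \<epsilon>(2) VT] by blast
qed

text \<open>Both spreads in the definition of a completion are covered: the full space is the case where
  \<open>T\<close> is everything.\<close>

lemma spread_generic:
  assumes T: "generic T" "openin Z T"
  shows "spread (subtopology Y (preim Y g T)) Z g" (is "spread ?X Z g")
proof -
  have nb: "connectedin ?X (nbhd i z \<epsilon>)" "openin ?X (nbhd i z \<epsilon>)"
      "nbhd i z \<epsilon> \<in> preim_components ?X g (star z \<epsilon>)"
    if i: "i \<in> I" "supp z \<subseteq> fst i" and z: "z \<in> topspace Z" "small z \<epsilon>" and sub: "nbhd i z \<epsilon> \<subseteq> preim Y g T" for i z \<epsilon>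
  proof -
    have eq: "nbhd i z \<epsilon> \<inter> preim Y g T = nbhd i z \<epsilon>" using sub by blast
    show "connectedin ?X (nbhd i z \<epsilon>)"
      using connectedin_nbhd(1)[OF T(1) z i] sub unfolding eq connectedin_subtopology by blast
    show "openin ?X (nbhd i z \<epsilon>)"
      using openin_nbhd[OF z i] sub openin_preim[OF T(2)] by (simp add: openin_open_subtopology)
    show "nbhd i z \<epsilon> \<in> preim_components ?X g (star z \<epsilon>)"
      unfolding preim_components_star[OF T z] by (rule image_eqI[where x = i]) (simp_all only: i eq mem_Collect_eq simp_thms)
  qed
  have lc: "locally_connected_space ?X"
    unfolding locally_connected_space
  proof (intro allI impI)
    fix V a assume "openin ?X V \<and> a \<in> V"
    then have V: "openin ?X V" "a \<in> V" by auto
    obtain i z \<epsilon> where i: "i \<in> I" "supp z \<subseteq> fst i" and z: "z \<in> topspace Z" "small z \<epsilon>"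
      and a: "a \<in> nbhd i z \<epsilon>" "nbhd i z \<epsilon> \<subseteq> V" "V \<subseteq> preim Y g T"
      by (rule nbhd_in_open_part[OF T(2) V])
    then show "\<exists>U. openin ?X U \<and> connectedin ?X U \<and> a \<in> U \<and> U \<subseteq> V"
      using nb[OF i z subset_trans[OF a(2,3)]] by blast
  qed
  have cont: "continuous_map ?X Z g" by (rule continuous_map_from_subtopology[OF continuous_g])
  have comps: "openin ?X C" if W: "openin Z W" and C: "C \<in> preim_components ?X g W" for W C
  proof -
    have "openin ?X (preim ?X g W)"
      using openin_continuous_map_preimage[OF cont W] by (simp only: preim_def)
    with lc C show ?thesis
      unfolding locally_connected_space_open_connected_components preim_components_def by blast
  qed
  have base: "\<exists>W. openin Z W \<and> (\<exists>C\<in>preim_components ?X g W. a \<in> C \<and> C \<subseteq> V)"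
    if V: "openin ?X V" "a \<in> V" for V a
  proof -
    obtain i z \<epsilon> where i: "i \<in> I" "supp z \<subseteq> fst i" and z: "z \<in> topspace Z" "small z \<epsilon>"
      and a: "a \<in> nbhd i z \<epsilon>" "nbhd i z \<epsilon> \<subseteq> V" "V \<subseteq> preim Y g T"
      by (rule nbhd_in_open_part[OF T(2) V])
    then show ?thesis using nb(3)[OF i z subset_trans[OF a(2,3)]] openin_star[OF z(1)] by blast
  qed
  show ?thesis
    unfolding spread_def
    by (intro conjI allI impI ballI lc t1_space_subtopology t1_Y locally_connected_base t1_base cont)
      (erule comps, assumption, erule conjE, erule base, assumption)
qed

text \<open>A compatible choice of components over the small cubes about \<open>z\<close> always chooses
  the component of one and the same point over \<open>z\<close>.\<close>

lemma complete_spread_Y: "complete_spread Y Z g"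
  unfolding complete_spread_def
proof (intro conjI ballI allI impI)
  show "spread Y Z g"
    using spread_generic[OF generic_topspace openin_topspace] by (simp add: preim_topspace subtopology_topspace)
  fix z c
  assume z: "z \<in> topspace Z" and "(\<forall>W. openin Z W \<and> z \<in> W \<longrightarrow> c W \<in> preim_components Y g W) \<and>
    (\<forall>W W'. openin Z W \<and> openin Z W' \<and> z \<in> W \<and> W \<subseteq> W' \<longrightarrow> c W \<subseteq> c W')"
  then have c: "\<And>W. openin Z W \<Longrightarrow> z \<in> W \<Longrightarrow> c W \<in> preim_components Y g W"
    and mono: "\<And>W W'. openin Z W \<Longrightarrow> openin Z W' \<Longrightarrow> z \<in> W \<Longrightarrow> W \<subseteq> W' \<Longrightarrow> c W \<subseteq> c W'"
    by blast+
  have c_star: "\<exists>i. i \<in> I \<and> supp z \<subseteq> fst i \<and> c (star z \<epsilon>) = nbhd i z \<epsilon>" if \<epsilon>: "small z \<epsilon>" for \<epsilon>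
  proof -
    have "preim_components Y g (star z \<epsilon>) = (\<lambda>i. nbhd i z \<epsilon> \<inter> topspace Y) ` {i \<in> I. supp z \<subseteq> fst i}"
      using preim_components_star[OF generic_topspace openin_topspace z \<epsilon>]
      by (simp add: preim_topspace subtopology_topspace)
    then obtain i where "i \<in> I" "supp z \<subseteq> fst i" "c (star z \<epsilon>) = nbhd i z \<epsilon> \<inter> topspace Y"
      using c[OF openin_star[OF z] center_in_star[OF z \<epsilon>]] by blast
    moreover have "nbhd i z \<epsilon> \<inter> topspace Y = nbhd i z \<epsilon>"
      using nbhd_subset[OF calculation(1,2)] by blast
    ultimately show ?thesis by (intro exI[of _ i]) simp
  qed
  obtain \<epsilon>0 where \<epsilon>0: "small z \<epsilon>0" using small_exists[OF z zero_less_one] by blast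
  (* The point chosen over one cube belongs to the component chosen over any other neighborhood, by
     comparison with a cube inside both. *)
  obtain k where k: "k \<in> I" "supp z \<subseteq> fst k" "c (star z \<epsilon>0) = nbhd k z \<epsilon>0" using c_star[OF \<epsilon>0] by blast
  have "pt k z \<in> c W" if W: "openin Z W" "z \<in> W" for W
  proof -
    have "openin Z (W \<inter> star z \<epsilon>0)" "z \<in> W \<inter> star z \<epsilon>0"
      using W openin_star[OF z] center_in_star[OF z \<epsilon>0] by auto
    then obtain \<epsilon> where \<epsilon>: "small z \<epsilon>" "star z \<epsilon> \<subseteq> W \<inter> star z \<epsilon>0"
      using star_base[OF _ _ zero_less_one] by blast
    obtain i where i: "i \<in> I" "supp z \<subseteq> fst i" "c (star z \<epsilon>) = nbhd i z \<epsilon>" using c_star[OF \<epsilon>(1)] by blast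
    note o = openin_star[OF z] center_in_star[OF z]
    have sub: "nbhd i z \<epsilon> \<subseteq> nbhd k z \<epsilon>0" "nbhd i z \<epsilon> \<subseteq> c W"
      using mono[OF o(1) o(1) o(2)[OF \<epsilon>(1)], of \<epsilon>0] mono[OF o(1) W(1) o(2)[OF \<epsilon>(1)]] \<epsilon>(2) i(3) k(3) by auto
    have ic: "pt i z \<in> nbhd i z \<epsilon>" by (rule center_in_nbhd[OF z \<epsilon>(1) i(1,2)])
    note s = copy_simplex[OF i(1) z i(2)]
    have "around (supp z) k i"
      using point_in_nbhd_iff[OF \<epsilon>0 k(1,2) i(1) s] sub(1) ic by blast
    then have "pt i z = pt k z" using point_eq_iff[OF i(1) s] glued_around_sym by blast
    then show ?thesis using ic sub(2) by auto
  qed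
  then show "(\<Inter>W\<in>{W. openin Z W \<and> z \<in> W}. c W) \<noteq> {}" by blast
qed

lemma continuous_map_from_Y:
  assumes "\<And>i. i \<in> I \<Longrightarrow> continuous_map (top_of_set (simplex_pts (fst i))) W (\<lambda>x. f (pt i x))"
  shows "continuous_map Y W f"
  unfolding continuous_map_def
proof (intro conjI allI impI)
  show "f \<in> topspace Y \<rightarrow> topspace W"
    using assms by (auto simp: topspace_Y continuous_map_def Pi_iff)
  fix U assume U: "openin W U"
  have "openin (top_of_set (simplex_pts (fst i))) {x \<in> simplex_pts (fst i). pt i x \<in> {a \<in> topspace Y. f a \<in> U}}"
    if i: "i \<in> I" for i
  proof -
    have "{x \<in> simplex_pts (fst i). pt i x \<in> {a \<in> topspace Y. f a \<in> U}} = {x \<in> simplex_pts (fst i). f (pt i x) \<in> U}"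
      using point_in_Y[OF i] by blast
    then show ?thesis using openin_continuous_map_preimage[OF assms[OF i] U] by simp
  qed
  then show "openin Y {a \<in> topspace Y. f a \<in> U}" by (subst openin_unfolding_space) auto
qed

lemma dense_in_Y:
  assumes T: "generic T" "openin Z T"
  shows "dense_in (preim Y g T) Y" "locally_connected_in (preim Y g T) Y"
proof -
  have XY: "subtopology Y (preim Y g (topspace Z)) = Y"
    by (simp add: preim_topspace subtopology_topspace)
  show "dense_in (preim Y g T) Y"
    unfolding dense_in_def dense_intersects_open
  proof (intro conjI allI impI)
    show "preim Y g T \<subseteq> topspace Y" by (auto simp: preim_def)
    fix V assume V: "openin Y V \<and> V \<noteq> {}"
    then obtain a where aV: "openin (subtopology Y (preim Y g (topspace Z))) V" "a \<in> V" unfolding XY by blast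
    obtain i z \<epsilon> where i: "i \<in> I" "supp z \<subseteq> fst i" and z: "z \<in> topspace Z" "small z \<epsilon>"
      and a: "a \<in> nbhd i z \<epsilon>" "nbhd i z \<epsilon> \<subseteq> V" "V \<subseteq> preim Y g (topspace Z)"
      by (rule nbhd_in_open_part[OF openin_topspace aV])
    then show "preim Y g T \<inter> V \<noteq> {}" using connectedin_nbhd(2)[OF T(1) z i] by blast
  qed
  show "locally_connected_in (preim Y g T) Y"
    unfolding locally_connected_in_def
  proof (intro allI impI)
    fix V a assume "openin Y V \<and> a \<in> V"
    then have aV: "openin (subtopology Y (preim Y g (topspace Z))) V" "a \<in> V" unfolding XY by auto
    obtain i z \<epsilon> where i: "i \<in> I" "supp z \<subseteq> fst i" and z: "z \<in> topspace Z" "small z \<epsilon>"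
      and a: "a \<in> nbhd i z \<epsilon>" "nbhd i z \<epsilon> \<subseteq> V" "V \<subseteq> preim Y g (topspace Z)"
      by (rule nbhd_in_open_part[OF openin_topspace aV])
    with connectedin_nbhd(1)[OF T(1) z i] openin_nbhd[OF z i]
    show "\<exists>B. openin Y B \<and> a \<in> B \<and> B \<subseteq> V \<and> connectedin Y (B \<inter> preim Y g T)" by blast
  qed
qed

lemma open_map_g: "openin Y V \<Longrightarrow> openin Z (g ` V)"
proof (subst openin_subopen, intro ballI)
  fix z assume V: "openin Y V" and "z \<in> g ` V"
  then obtain a where a: "a \<in> V" "z = g a" by blast
  then have "a \<in> topspace Y" using V openin_subset by blast
  then obtain i x where i: "i \<in> I" "x \<in> simplex_pts (fst i)" "a = pt i x" using topspace_Y by blast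
  have x: "x = z" using i(3) a(2) by simp
  note z = copy_point_Z[OF i(1,2), unfolded x] and si = copy_point_supp[OF i(1,2), unfolded x]
  obtain \<epsilon> where \<epsilon>: "small z \<epsilon>" "nbhd i z \<epsilon> \<subseteq> V"
    using nbhd_base[OF V _ i(1) si z zero_less_one] a(1) i(3) x by blast
  have "star z \<epsilon> \<subseteq> g ` V" using image_nbhd[OF z \<epsilon>(1) i(1) si] \<epsilon>(2) by blast
  with openin_star[OF z] center_in_star[OF z \<epsilon>(1)]
  show "\<exists>U. openin Z U \<and> z \<in> U \<and> U \<subseteq> g ` V" by blast
qed

text \<open>Two points of a sheet over the same \<open>x\<close> come from copies linked around
  \<open>z\<close>. After moving one of them within its class over \<open>x\<close>, they are
  copies of one facet, hence equal.\<close>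

lemma inj_on_nbhd:
  assumes z: "z \<in> topspace Z" "small z \<epsilon>" "unram (supp z)" and i: "i \<in> I" "supp z \<subseteq> fst i"
  shows "inj_on g (nbhd i z \<epsilon>)"
proof (rule inj_onI)
  fix a b assume ab: "a \<in> nbhd i z \<epsilon>" "b \<in> nbhd i z \<epsilon>" "g a = g b"
  obtain j x where j: "around (supp z) i j" "x \<in> simplex_pts (fst j)" "x \<in> cube z \<epsilon>" "a = pt j x"
    using ab(1) unfolding nbhd_def by blast
  obtain k y where ky: "around (supp z) i k" "y \<in> simplex_pts (fst k)" "b = pt k y"
    using ab(2) unfolding nbhd_def by blast
  have "y = x" using ab(3) j(4) ky(3) by simp
  note k = ky[unfolded this]
  have I: "j \<in> I" "k \<in> I" using glued_around_mem(1)[OF _ i] j(1) k(1) by auto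
  have xZ: "x \<in> topspace Z" using copy_point_Z[OF I(1) j(2)] .
  obtain l where l: "around (supp x) j (fst k, l)"
    using relabel_around[OF I(1) supp_in_K[OF xZ] copy_point_supp[OF I(1) j(2)] I_facets[OF I(2)]
        copy_point_supp[OF I(2) k(2)]] by blast
  have "around (supp z) j (fst k, l)" using glued_around_mono[OF supp_near[OF z(2) j(3)] l] .
  moreover have "around (supp z) j k" using j(1) k(1) glued_around_trans glued_around_sym by metis
  ultimately have "around (supp z) (fst k, l) (fst k, snd k)"
    using glued_around_trans glued_around_sym by (metis prod.collapse)
  then have "l = snd k" using z(3) unfolding unramified_at_def by blast
  then have "around (supp x) j k" using l by simp
  then show "a = b" unfolding j(4) k(3) using point_eq_iff[OF I(1) j(2)] by blast
qed

lemma covering_unramified_part: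
  "covering_map (subtopology Y (preim Y g unramified_part)) (subtopology Z unramified_part) g"
proof -
  let ?S = "preim Y g unramified_part"
  have OZ: "unramified_part \<subseteq> topspace Z" by (auto simp: unramified_part_def)
  then have topO: "topspace (subtopology Z unramified_part) = unramified_part" by (rule topspace_subtopology_subset)
  have "continuous_map (subtopology Y ?S) (subtopology Z unramified_part) g"
    unfolding continuous_map_in_subtopology topspace_preim
    by (auto simp: continuous_map_from_subtopology[OF continuous_g] preim_def)
  moreover have "g ` ?S = unramified_part"
  proof
    show "unramified_part \<subseteq> g ` ?S"
    proof
      fix z assume z: "z \<in> unramified_part"
      then have zZ: "z \<in> topspace Z" using OZ by blast
      then obtain i where i: "i \<in> I" "supp z \<subseteq> fst i" using copy_exists by blast
      have "pt i z \<in> ?S" using point_in_preim[OF i(1) copy_simplex[OF i(1) zZ i(2)]] z by blast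
      then show "z \<in> g ` ?S" using image_eqI[of z g "pt i z"] by simp
    qed
  qed (auto simp: preim_def)
  moreover have "\<exists>U. openin (subtopology Z unramified_part) U \<and> z \<in> U \<and>
      (\<exists>\<V>. \<Union>\<V> = preim (subtopology Y ?S) g U \<and> (\<forall>V\<in>\<V>. openin (subtopology Y ?S) V) \<and> pairwise disjnt \<V> \<and>
        (\<forall>V\<in>\<V>. homeomorphic_map (subtopology (subtopology Y ?S) V) (subtopology (subtopology Z unramified_part) U) g))"
    if zO: "z \<in> unramified_part" for z
  proof -
    have z: "z \<in> topspace Z" "unram (supp z)" using zO by (auto simp: unramified_part_def)
    obtain \<epsilon> where \<epsilon>: "small z \<epsilon>" "star z \<epsilon> \<subseteq> unramified_part"
      using star_base[OF openin_unramified_part zO zero_less_one] by blast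
    let ?U = "star z \<epsilon>" and ?\<V> = "(\<lambda>i. nbhd i z \<epsilon>) ` {i \<in> I. supp z \<subseteq> fst i}"
    have sub: "nbhd i z \<epsilon> \<subseteq> ?S" if "i \<in> I" "supp z \<subseteq> fst i" for i
    proof -
      have "nbhd i z \<epsilon> \<subseteq> preim Y g ?U" unfolding preim_star[OF z(1) \<epsilon>(1)] using that by blast
      then show ?thesis using \<epsilon>(2) by (auto simp: preim_def)
    qed
    have "preim (subtopology Y ?S) g ?U = preim Y g ?U"
      using \<epsilon>(2) unfolding preim_def topspace_preim[unfolded preim_def] by auto
    then have 1: "\<Union>?\<V> = preim (subtopology Y ?S) g ?U" using preim_star[OF z(1) \<epsilon>(1)] by simp
    have 2: "\<forall>V\<in>?\<V>. openin (subtopology Y ?S) V"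
      using sub openin_nbhd[OF z(1) \<epsilon>(1)] openin_preim[OF openin_unramified_part]
      by (auto simp: openin_open_subtopology)
    have 3: "pairwise disjnt ?\<V>"
    proof (rule pairwiseI)
      fix A B assume "A \<in> ?\<V>" "B \<in> ?\<V>" "A \<noteq> B"
      then obtain i k where i: "i \<in> I" "supp z \<subseteq> fst i" "A = nbhd i z \<epsilon>"
        and k: "k \<in> I" "supp z \<subseteq> fst k" "B = nbhd k z \<epsilon>" and ne: "A \<noteq> B" by blast
      with nbhd_eq_or_disjnt(2)[OF \<epsilon>(1) i(1,2) k(1,2)] show "disjnt A B"
        unfolding i(3) k(3) disjnt_def by blast
    qed
    have 4: "homeomorphic_map (subtopology (subtopology Y ?S) V) (subtopology (subtopology Z unramified_part) ?U) g"
      if V: "V \<in> ?\<V>" for V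
    proof -
      obtain i where i: "i \<in> I" "supp z \<subseteq> fst i" "V = nbhd i z \<epsilon>" using V by blast
      have VS: "?S \<inter> V = V" using sub[OF i(1,2)] i(3) by blast
      have US: "unramified_part \<inter> ?U = ?U" using \<epsilon>(2) by blast
      have Vo: "openin Y V" using openin_nbhd[OF z(1) \<epsilon>(1) i(1,2)] i(3) by simp
      have topV: "topspace (subtopology Y V) = V" using openin_subset[OF Vo] by (rule topspace_subtopology_subset)
      have topU: "topspace (subtopology Z ?U) = ?U"
        using openin_subset[OF openin_star[OF z(1)]] by (rule topspace_subtopology_subset)
      have img: "g ` V = ?U" using image_nbhd[OF z(1) \<epsilon>(1) i(1,2)] i(3) by simp
      have "homeomorphic_map (subtopology Y V) (subtopology Z ?U) g"
      proof (rule bijective_open_imp_homeomorphic_map)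
        show "continuous_map (subtopology Y V) (subtopology Z ?U) g"
          unfolding continuous_map_in_subtopology topV
          using img continuous_map_from_subtopology[OF continuous_g] by auto
        show "open_map (subtopology Y V) (subtopology Z ?U) g"
          unfolding open_map_def
        proof (intro allI impI)
          fix A assume "openin (subtopology Y V) A"
          then have "openin Y A" "A \<subseteq> V" using Vo by (simp_all add: openin_open_subtopology)
          then show "openin (subtopology Z ?U) (g ` A)"
            using open_map_g img openin_star[OF z(1)] by (auto simp: openin_open_subtopology)
        qed
        show "g ` topspace (subtopology Y V) = topspace (subtopology Z ?U)" unfolding topV topU by (rule img)
        show "inj_on g (topspace (subtopology Y V))"
          unfolding topV unfolding i(3) by (rule inj_on_nbhd[OF z(1) \<epsilon>(1) z(2) i(1,2)])
      qed
      then show ?thesis unfolding subtopology_subtopology VS US .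
    qed
    have 5: "openin (subtopology Z unramified_part) ?U"
      using openin_star[OF z(1)] \<epsilon>(2) openin_unramified_part by (simp add: openin_open_subtopology)
    show ?thesis
      by (intro exI[of _ ?U] exI[of _ ?\<V>] conjI ballI 1 bspec[OF 2] 3 4 5 center_in_star[OF z(1) \<epsilon>(1)])
  qed
  ultimately show ?thesis
    unfolding covering_map_def topspace_preim topO by (intro conjI ballI)
qed

text \<open>If a chain around \<open>z\<close> links different copies of a facet, these copies contribute
  to the same sheet at \<open>z\<close>, although they are disjoint over the interior of the
  facet; so no neighborhood of that point is mapped injectively.\<close>

lemma covering_imp_unram:
  assumes U: "openin Z U" "covering_map (subtopology Y (preim Y g U)) (subtopology Z U) g" and z: "z \<in> U"
  shows "unram (supp z)"
  unfolding unramified_at_def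
proof (intro allI impI)
  fix \<sigma> l m assume lm: "around (supp z) (\<sigma>, l) (\<sigma>, m)"
  have zZ: "z \<in> topspace Z" using z U openin_subset by blast
  show "l = m"
  proof (rule ccontr)
    assume ne: "l \<noteq> m"
    have im: "(\<sigma>, l) \<in> I \<and> supp z \<subseteq> \<sigma> \<and> (\<sigma>, m) \<in> I"
    proof -
      have "i = j \<or> i \<in> I \<and> supp z \<subseteq> fst i" if "around (supp z) i j" for i j
        using glued_around_sym[OF that] by (induction rule: glued_around_induct) (auto simp: glued_def)
      from this[OF lm] this[OF glued_around_sym[OF lm]] ne show ?thesis by auto
    qed
    let ?S = "preim Y g U"
    have zs: "z \<in> simplex_pts \<sigma>" using copy_simplex[of "(\<sigma>, l)" z] im zZ by simp
    have a: "pt (\<sigma>, l) z \<in> ?S" using point_in_preim[of "(\<sigma>, l)" z U] im zs z by simp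
    have "topspace (subtopology Z U) = U" using openin_subset[OF U(1)] by (rule topspace_subtopology_subset)
    then obtain U' \<V> where U': "z \<in> U'" "\<Union>\<V> = preim (subtopology Y ?S) g U'"
      "\<forall>V\<in>\<V>. openin (subtopology Y ?S) V"
      "\<forall>V\<in>\<V>. homeomorphic_map (subtopology (subtopology Y ?S) V) (subtopology (subtopology Z U) U') g"
      using U(2) z unfolding covering_map_def by metis
    have "pt (\<sigma>, l) z \<in> preim (subtopology Y ?S) g U'"
      using a U'(1) unfolding preim_def[of "subtopology Y ?S"] topspace_preim by simp
    then obtain V where V: "V \<in> \<V>" "pt (\<sigma>, l) z \<in> V" using U'(2) by blast
    have Vo: "openin Y V" "V \<subseteq> ?S"
      using U'(3) V(1) openin_preim[OF U(1)] by (auto simp: openin_open_subtopology)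
    have "inj_on g (topspace (subtopology (subtopology Y ?S) V))"
      using U'(4) V(1) homeomorphic_imp_injective_map by blast
    then have inj: "inj_on g V" using openin_subset[OF Vo(1)] Vo(2) by (simp add: inf_absorb2 topspace_preim)
    obtain \<epsilon> where \<epsilon>: "small z \<epsilon>" "nbhd (\<sigma>, l) z \<epsilon> \<subseteq> V"
      using nbhd_base[OF Vo(1) V(2) _ _ zZ zero_less_one] im by auto
    have f: "\<sigma> \<in> facets K d" using I_facets[of "(\<sigma>, l)"] im by simp
    (* At an interior point of the facet the two copies are not identified. *)
    obtain x where x: "x \<in> simplex_pts \<sigma>" "x \<in> cube z \<epsilon>" "supp x = \<sigma>"
      using interior_point_near[OF facetD(2)[OF f] zs small_pos[OF \<epsilon>(1)]] by blast
    have "pt (\<sigma>, l) x \<in> nbhd (\<sigma>, l) z \<epsilon>" "pt (\<sigma>, m) x \<in> nbhd (\<sigma>, l) z \<epsilon>"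
      using point_in_nbhd_iff[OF \<epsilon>(1), of "(\<sigma>, l)"] im x lm glued_around_refl by auto
    then have "pt (\<sigma>, l) x \<in> V" "pt (\<sigma>, m) x \<in> V" using \<epsilon>(2) by blast+
    then have "pt (\<sigma>, l) x = pt (\<sigma>, m) x" by (intro inj_onD[OF inj]) simp_all
    then have "around \<sigma> (\<sigma>, l) (\<sigma>, m)" using point_eq_iff[of "(\<sigma>, l)" x] im x by simp
    then show False using around_facet[OF f] ne by blast
  qed
qed

theorem ordinary_set_eq: "ordinary_set Y Z g = unramified_part"
proof
  show "unramified_part \<subseteq> ordinary_set Y Z g"
    by (rule ordinary_set_greatest[OF openin_unramified_part covering_unramified_part])
  show "ordinary_set Y Z g \<subseteq> unramified_part"
  proof
    fix z assume "z \<in> ordinary_set Y Z g"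
    then obtain U where U: "openin Z U" "covering_map (subtopology Y (preim Y g U)) (subtopology Z U) g" "z \<in> U"
      unfolding ordinary_set_def by blast
    then show "z \<in> unramified_part"
      using covering_imp_unram[OF U] openin_subset by (auto simp: unramified_part_def)
  qed
qed

theorem branched_covering_Y: "branched_covering Y Z g"
  unfolding branched_covering_def completion_of_def
  using generic_unramified_part openin_unramified_part
  by (intro exI[of _ unramified_part] exI[of _ "preim Y g unramified_part"] conjI
      dense_in_base locally_connected_in_base covering_unramified_part spread_generic
      complete_spread_Y dense_in_Y)

end


section \<open>Vertex labels and colorings\<close>

definition vertex_copies :: "'v set set \<Rightarrow> nat \<Rightarrow> ('v set \<times> 'v) set" where
  "vertex_copies K d = {(\<sigma>, v). \<sigma> \<in> facets K d \<and> v \<in> \<sigma>}"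

definition vertex_glue :: "'v set \<times> 'v \<Rightarrow> 'v set \<times> 'v \<Rightarrow> bool" where
  "vertex_glue = (\<lambda>(\<sigma>, v) (\<tau>, w). w = perspectivity \<sigma> \<tau> v)"

definition color_copies :: "'v set set \<Rightarrow> nat \<Rightarrow> 'v set \<Rightarrow> ('v \<Rightarrow> nat) \<Rightarrow> ('v set \<times> ('v \<Rightarrow> nat)) set" where
  "color_copies K d \<sigma>0 b0 = {(\<sigma>, b). \<sigma> \<in> facets K d \<and> admissible K d \<sigma>0 b0 \<sigma> b}"

definition color_glue :: "'v set \<times> ('v \<Rightarrow> nat) \<Rightarrow> 'v set \<times> ('v \<Rightarrow> nat) \<Rightarrow> bool" where
  "color_glue = (\<lambda>(\<sigma>, b) (\<tau>, c). \<forall>v\<in>\<sigma> \<inter> \<tau>. b v = c v)"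

locale colored_complex = locally_strong_complex K d
  for K :: "'v set set" and d :: nat +
  fixes \<sigma>0 :: "'v set" and b0 :: "'v \<Rightarrow> nat"
  assumes strong: "strongly_connected K d" and \<sigma>0: "\<sigma>0 \<in> facets K d" and b0: "bij_betw b0 \<sigma>0 {0..d}"
begin

abbreviation "colored \<equiv> color_copies K d \<sigma>0 b0"
abbreviation "marked \<equiv> vertex_copies K d"

text \<open>The vertices of \<open>\<rho>\<close> belong to both facets, so the perspectivity fixes them;
  being injective, it moves no other vertex into \<open>\<rho>\<close>.\<close>

lemma partial_ridge_step:
  assumes "glued K d (marked) vertex_glue \<rho> i j"
  shows "(snd i \<in> \<rho> \<longleftrightarrow> snd j \<in> \<rho>) \<and> (snd i \<in> \<rho> \<longrightarrow> snd j = snd i)"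
proof -
  have n: "neighbors K d (fst i) (fst j)" and \<rho>: "\<rho> \<subseteq> fst i \<inter> fst j"
    and e: "snd j = perspectivity (fst i) (fst j) (snd i)"
    using assms by (auto simp: glued_def vertex_glue_def case_prod_beta)
  show ?thesis
  proof (cases "snd i \<in> fst j")
    case True
    then have "snd j = snd i" using e by (simp add: perspectivity_def)
    then show ?thesis by simp
  next
    case False
    then show ?thesis using perspectivity_off[OF n False] e \<rho> by auto
  qed
qed

sublocale P: facet_labelling K d "marked" vertex_glue
proof
  show "fst i \<in> facets K d" if "i \<in> marked" for i
    using that by (auto simp: vertex_copies_def)
  show "finite {l. (\<sigma>, l) \<in> marked}" for \<sigma>
  proof (cases "\<sigma> \<in> facets K d")
    case True
    then show ?thesis using facetD(2)[OF True] by (simp add: vertex_copies_def)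
  qed (simp add: vertex_copies_def)
  show "\<exists>l. (\<sigma>, l) \<in> marked" if "\<sigma> \<in> facets K d" for \<sigma>
    using that face_nonempty[OF facetD(1)[OF that]] by (auto simp: vertex_copies_def)
  show "\<exists>l. (\<tau>, l) \<in> marked \<and> vertex_glue i (\<tau>, l)"
    if "i \<in> marked" "neighbors K d (fst i) \<tau>" for i \<tau>
    using that perspectivity_mem[OF that(2)] neighbors_facets[OF that(2)]
    by (auto simp: vertex_copies_def vertex_glue_def)
  show "unramified_at K d (marked) vertex_glue \<rho>" if \<rho>: "\<rho> \<in> ridges K d" for \<rho>
    unfolding unramified_at_def
  proof (intro allI impI)
    fix \<sigma> v w assume vw: "glued_around K d (marked) vertex_glue \<rho> (\<sigma>, v) (\<sigma>, w)"
    have inv: "(snd i \<in> \<rho> \<longleftrightarrow> snd j \<in> \<rho>) \<and> (snd i \<in> \<rho> \<longrightarrow> snd j = snd i)"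
      if "glued_around K d (marked) vertex_glue \<rho> i j" for i j
      using that by (induction rule: glued_around_induct) (auto dest: partial_ridge_step)
    show "v = w"
    proof (rule ccontr)
      assume ne: "v \<noteq> w"
      then have \<sigma>: "\<sigma> \<in> facets K d" "\<rho> \<subseteq> \<sigma>" "v \<in> \<sigma>" "w \<in> \<sigma>"
        using glued_around_trivial_or_mem[OF vw] by (auto simp: vertex_copies_def)
      have "v \<notin> \<rho>" "w \<notin> \<rho>" using inv[OF vw] ne by auto
      (* A facet has only one vertex outside a ridge. *)
      moreover have "card \<rho> = d" using \<rho> card_face[OF ridgeD[OF \<rho>]] by (auto simp: ridges_def codim_def)
      moreover have "finite \<rho>" by (rule finite_face[OF ridgeD[OF \<rho>]])
      ultimately have "card (insert v (insert w \<rho>)) = Suc (Suc d)" using ne by simp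
      moreover have "card (insert v (insert w \<rho>)) \<le> card \<sigma>"
        using \<sigma> by (intro card_mono facetD(2)) auto
      ultimately show False using facetD(3)[OF \<sigma>(1)] by simp
    qed
  qed
qed

lemma admissible_bij:
  assumes "admissible K d \<sigma>0 b0 \<sigma> b"
  shows "bij_betw b \<sigma> {0..d}" "b \<in> extensional \<sigma>"
proof -
  obtain \<eta> where \<eta>: "facet_path K d \<eta>" "hd \<eta> = \<sigma>0" "last \<eta> = \<sigma>"
      "b = restrict (b0 \<circ> projectivity (rev \<eta>)) \<sigma>"
    using assms by (auto simp: admissible_def)
  have "\<eta> \<noteq> []" using \<eta>(1) by (simp add: facet_path_def)
  then have "bij_betw (projectivity (rev \<eta>)) \<sigma> \<sigma>0"
    using bij_projectivity[OF facet_path_rev[OF \<eta>(1)]] \<eta>(2,3) by (simp add: hd_rev last_rev)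
  then show "bij_betw b \<sigma> {0..d}"
    using bij_betw_trans[OF _ b0] \<eta>(4) by (simp cong: bij_betw_cong)
  show "b \<in> extensional \<sigma>" using \<eta>(4) by simp
qed

lemma projectivity_snoc:
  "\<eta> \<noteq> [] \<Longrightarrow> projectivity (rev (\<eta> @ [\<tau>])) = projectivity (rev \<eta>) \<circ> perspectivity \<tau> (last \<eta>)"
  by (cases \<eta> rule: rev_cases) auto

lemma color_glue_snoc:
  assumes \<eta>: "facet_path K d \<eta>" and n: "neighbors K d (last \<eta>) \<tau>"
  shows "color_glue (last \<eta>, restrict (b0 \<circ> projectivity (rev \<eta>)) (last \<eta>))
    (\<tau>, restrict (b0 \<circ> projectivity (rev (\<eta> @ [\<tau>]))) \<tau>)"
proof -
  have "\<eta> \<noteq> []" using \<eta> by (simp add: facet_path_def)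
  then show ?thesis unfolding projectivity_snoc[OF \<open>\<eta> \<noteq> []\<close>]
    by (auto simp: color_glue_def perspectivity_def)
qed

lemma color_copies_glue_exists:
  assumes "i \<in> colored" "neighbors K d (fst i) \<tau>"
  shows "\<exists>c. (\<tau>, c) \<in> colored \<and> color_glue i (\<tau>, c)"
proof -
  obtain \<eta> where \<eta>: "facet_path K d \<eta>" "hd \<eta> = \<sigma>0" "last \<eta> = fst i"
      "snd i = restrict (b0 \<circ> projectivity (rev \<eta>)) (fst i)"
    using assms(1) by (auto simp: color_copies_def admissible_def)
  let ?c = "restrict (b0 \<circ> projectivity (rev (\<eta> @ [\<tau>]))) \<tau>"
  have n: "neighbors K d (last \<eta>) \<tau>" using assms(2) \<eta>(3) by simp
  have p: "facet_path K d (\<eta> @ [\<tau>])" by (rule facet_path_snoc[OF \<eta>(1) n])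
  have "hd (\<eta> @ [\<tau>]) = \<sigma>0" using \<eta>(1,2) by (simp add: facet_path_def)
  then have "admissible K d \<sigma>0 b0 \<tau> ?c"
    unfolding admissible_def using p by (intro exI[of _ "\<eta> @ [\<tau>]"]) simp
  moreover have "color_glue i (\<tau>, ?c)" using color_glue_snoc[OF \<eta>(1) n] \<eta>(3,4) by (metis prod.collapse)
  ultimately show ?thesis using neighbors_facets[OF n] by (auto simp: color_copies_def)
qed

lemma color_copyD:
  assumes "(\<sigma>, b) \<in> colored"
  shows "\<sigma> \<in> facets K d" "bij_betw b \<sigma> {0..d}" "b \<in> extensional \<sigma>"
  using assms admissible_bij by (auto simp: color_copies_def)

lemma color_copy_exists: "\<sigma> \<in> facets K d \<Longrightarrow> \<exists>b. (\<sigma>, b) \<in> colored"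
proof -
  assume \<sigma>: "\<sigma> \<in> facets K d"
  then obtain \<eta> where "facet_path K d \<eta>" "hd \<eta> = \<sigma>0" "last \<eta> = \<sigma>"
    using strong \<sigma>0 unfolding strongly_connected_def by blast
  with \<sigma> show ?thesis unfolding color_copies_def admissible_def by blast
qed

sublocale C: facet_labelling K d "colored" color_glue
proof
  show "fst i \<in> facets K d" if "i \<in> colored" for i
    using that by (auto simp: color_copies_def)
  show "finite {l. (\<sigma>, l) \<in> colored}" for \<sigma>
  proof (cases "\<sigma> \<in> facets K d")
    case True
    have "{l. (\<sigma>, l) \<in> colored} \<subseteq> (\<Pi>\<^sub>E v\<in>\<sigma>. {0..d})"
    proof
      fix b assume "b \<in> {l. (\<sigma>, l) \<in> colored}"
      then have b: "(\<sigma>, b) \<in> colored" by simp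
      show "b \<in> (\<Pi>\<^sub>E v\<in>\<sigma>. {0..d})"
        unfolding PiE_iff using color_copyD(3)[OF b] bij_betwE[OF color_copyD(2)[OF b]] by blast
    qed
    then show ?thesis by (rule finite_subset) (simp add: finite_PiE facetD(2)[OF True])
  qed (simp add: color_copies_def)
  show "unramified_at K d (colored) color_glue \<rho>" if \<rho>: "\<rho> \<in> ridges K d" for \<rho>
    unfolding unramified_at_def
  proof (intro allI impI)
    fix \<sigma> b c assume bc: "glued_around K d (colored) color_glue \<rho> (\<sigma>, b) (\<sigma>, c)"
    have inv: "\<forall>v\<in>\<rho>. snd i v = snd j v"
      if "glued_around K d (colored) color_glue \<rho> i j" for i j
      using that by (induction rule: glued_around_induct) (fastforce simp: glued_def color_glue_def)+
    show "b = c"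
    proof (rule ccontr)
      assume ne: "b \<noteq> c"
      then have m: "(\<sigma>, b) \<in> colored" "(\<sigma>, c) \<in> colored" "\<rho> \<subseteq> \<sigma>"
        using glued_around_trivial_or_mem[OF bc] by auto
      note B = color_copyD[OF m(1)] and C = color_copyD[OF m(2)]
      obtain a where a: "a \<in> \<sigma>" "b a \<noteq> c a"
        using ne extensionalityI[OF B(3) C(3)] by blast
      have "card \<rho> = d" using \<rho> card_face[OF ridgeD[OF \<rho>]] by (auto simp: ridges_def codim_def)
      then have "card (\<sigma> - \<rho>) = 1"
        using facetD(2,3)[OF B(1)] m(3) by (simp add: card_Diff_subset finite_subset)
      moreover have "a \<notin> \<rho>" using inv[OF bc] a(2) by auto
      ultimately have \<sigma>: "\<sigma> - \<rho> = {a}" using a(1) by (metis DiffI card_1_singletonE singletonD)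
      have "b a \<in> c ` \<sigma>" using B(2) C(2) a(1) by (metis bij_betw_imp_surj_on imageI)
      then obtain u where u: "u \<in> \<sigma>" "b a = c u" by blast
      then have "u \<noteq> a" using a(2) by auto
      then have "u \<in> \<rho>" using u(1) \<sigma> by blast
      then have "b a = b u" using inv[OF bc] u by simp
      then have "a = u" using B(2) a(1) u(1) by (metis bij_betw_imp_inj_on inj_onD)
      with \<open>u \<in> \<rho>\<close> \<open>a \<notin> \<rho>\<close> show False by simp
    qed
  qed
qed (use color_copy_exists color_copies_glue_exists in auto)


section \<open>Comparison of the two unfoldings\<close>

text \<open>Two colorings that agree on the common ridge have one color left for the remaining vertex of
  either facet. So gluing of colorings is composition with the perspectivity.\<close>

lemma color_transport:
  assumes m: "(\<sigma>, b) \<in> colored" "(\<tau>, c) \<in> colored"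
    and n: "neighbors K d \<sigma> \<tau>" and eq: "\<And>v. v \<in> \<sigma> \<inter> \<tau> \<Longrightarrow> b v = c v" and v: "v \<in> \<sigma>"
  shows "c (perspectivity \<sigma> \<tau> v) = b v"
proof (cases "v \<in> \<tau>")
  case False
  let ?w = "perspectivity \<sigma> \<tau> v"
  note B = color_copyD[OF m(1)] and C = color_copyD[OF m(2)]
  have w: "?w \<in> \<tau>" "?w \<notin> \<sigma>" using perspectivity_mem[OF n v] perspectivity_off[OF n False] by auto
  have "c ?w \<in> b ` \<sigma>" using B(2) C(2) w(1) by (metis bij_betw_imp_surj_on imageI)
  then obtain u where u: "u \<in> \<sigma>" "c ?w = b u" by blast
  have "u \<notin> \<tau>"
  proof
    assume ut: "u \<in> \<tau>"
    then have "c ?w = c u" using u eq by simp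
    then have "?w = u" using C(2) w(1) ut by (metis bij_betw_imp_inj_on inj_onD)
    with u(1) w(2) show False by simp
  qed
  then have "u = v" using u(1) v False neighbors_split[OF n] by (metis DiffI singletonD)
  with u(2) show ?thesis by simp
qed (use eq v in \<open>simp add: perspectivity_def\<close>)

text \<open>The passage from copies of the complete to copies of the partial unfolding.\<close>

definition color_vertex :: "nat \<Rightarrow> 'v set \<times> ('v \<Rightarrow> nat) \<Rightarrow> 'v set \<times> 'v" where
  "color_vertex k i = (fst i, inv_into (fst i) (snd i) k)"

lemma fst_color_vertex [simp]: "fst (color_vertex k i) = fst i"
  by (simp add: color_vertex_def)

lemma color_vertex_copy:
  assumes i: "i \<in> colored" and k: "k \<in> {0..d}"
  shows "color_vertex k i \<in> marked" "snd i (snd (color_vertex k i)) = k"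
proof -
  note B = color_copyD[of "fst i" "snd i", unfolded prod.collapse, OF i]
  have "k \<in> snd i ` fst i" using B(2) k by (simp add: bij_betw_imp_surj_on)
  then show "color_vertex k i \<in> marked" "snd i (snd (color_vertex k i)) = k"
    using B(1) by (auto simp: vertex_copies_def color_vertex_def inv_into_into f_inv_into_f)
qed

lemma color_vertex_eqI:
  assumes i: "i \<in> colored" and v: "v \<in> fst i" "snd i v = k"
  shows "color_vertex k i = (fst i, v)"
  using color_copyD(2)[of "fst i" "snd i", unfolded prod.collapse, OF i] v
  by (auto simp: color_vertex_def bij_betw_def inv_into_f_eq)

lemma color_vertex_glued:
  assumes g: "glued K d (colored) color_glue \<kappa> i j" and k: "k \<in> {0..d}"
  shows "glued K d (marked) vertex_glue \<kappa> (color_vertex k i) (color_vertex k j)"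
proof -
  have i: "i \<in> colored" and j: "j \<in> colored"
    and n: "neighbors K d (fst i) (fst j)" and eq: "\<And>v. v \<in> fst i \<inter> fst j \<Longrightarrow> snd i v = snd j v"
    using g by (auto simp: glued_def color_glue_def case_prod_beta)
  note vi = color_vertex_copy[OF i k]
  have v: "snd (color_vertex k i) \<in> fst i" using vi(1) by (simp add: vertex_copies_def case_prod_beta)
  have "snd j (perspectivity (fst i) (fst j) (snd (color_vertex k i))) = k"
    using color_transport[of "fst i" "snd i" "fst j" "snd j"] i j n eq v vi(2) by simp
  then have "snd (color_vertex k j) = perspectivity (fst i) (fst j) (snd (color_vertex k i))"
    using color_vertex_eqI[OF j perspectivity_mem[OF n v]] by simp
  then show ?thesis
    using g vi(1) color_vertex_copy(1)[OF j k]
    by (simp add: glued_def vertex_glue_def case_prod_beta)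
qed

lemma color_vertex_around:
  assumes "C.around \<kappa> i j" "k \<in> {0..d}"
  shows "P.around \<kappa> (color_vertex k i) (color_vertex k j)"
  using assms(1)
proof (induction rule: glued_around_induct)
  case (step j l)
  then show ?case using color_vertex_glued[OF _ assms(2)] glued_around_trans glued_imp_around by metis
next
  case (sym j l)
  then show ?case
    using color_vertex_glued[OF _ assms(2)] glued_around_trans glued_imp_around glued_around_sym by metis
qed (rule glued_around_refl)

text \<open>Each gluing of vertex labels is a perspectivity, along which a coloring can be carried so that
  the label keeps its color.\<close>

lemma lift_around:
  assumes "P.around \<kappa> i j" "i \<in> marked" "(fst i, b) \<in> colored"
  shows "\<exists>c. (fst j, c) \<in> colored \<and> snd j \<in> fst j \<and>
    C.around \<kappa> (fst i, b) (fst j, c) \<and> c (snd j) = b (snd i)"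
  using assms(1)
proof (induction rule: glued_around_induct)
  case base
  show ?case
    using assms(2,3) by (intro exI[of _ b]) (simp add: glued_around_refl vertex_copies_def case_prod_beta)
next
  case (step j l)
  then obtain c where c: "(fst j, c) \<in> colored" "snd j \<in> fst j"
    "C.around \<kappa> (fst i, b) (fst j, c)" "c (snd j) = b (snd i)" by blast
  have n: "neighbors K d (fst j) (fst l)" and \<kappa>: "\<kappa> \<subseteq> fst j \<inter> fst l"
    and e: "snd l = perspectivity (fst j) (fst l) (snd j)"
    using step(2) by (auto simp: glued_def vertex_glue_def case_prod_beta)
  obtain c' where c': "(fst l, c') \<in> colored" "color_glue (fst j, c) (fst l, c')"
    using color_copies_glue_exists[OF c(1)] n by auto
  have "C.around \<kappa> (fst j, c) (fst l, c')"
    using c(1) c' n \<kappa> by (intro glued_imp_around) (simp add: glued_def)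
  then have "C.around \<kappa> (fst i, b) (fst l, c')" using c(3) by (rule glued_around_trans[rotated])
  moreover have "c' (snd l) = b (snd i)"
    using color_transport[OF c(1) c'(1) n _ c(2)] c'(2) c(4) e by (simp add: color_glue_def)
  moreover have "snd l \<in> fst l" using perspectivity_mem[OF n c(2)] e by simp
  ultimately show ?case using c'(1) by blast
next
  case (sym j l)
  then obtain c where c: "(fst j, c) \<in> colored" "snd j \<in> fst j"
    "C.around \<kappa> (fst i, b) (fst j, c)" "c (snd j) = b (snd i)" by blast
  have n: "neighbors K d (fst l) (fst j)" and \<kappa>: "\<kappa> \<subseteq> fst j \<inter> fst l"
    and e: "snd j = perspectivity (fst l) (fst j) (snd l)" and l: "snd l \<in> fst l"
    using sym(2) by (auto simp: glued_def vertex_glue_def vertex_copies_def case_prod_beta)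
  note n' = neighbors_sym[OF n]
  obtain c' where c': "(fst l, c') \<in> colored" "color_glue (fst j, c) (fst l, c')"
    using color_copies_glue_exists[OF c(1)] n' by auto
  have "C.around \<kappa> (fst j, c) (fst l, c')"
    using c(1) c' n' \<kappa> by (intro glued_imp_around) (simp add: glued_def)
  then have "C.around \<kappa> (fst i, b) (fst l, c')" using c(3) by (rule glued_around_trans[rotated])
  moreover have "c' (snd l) = b (snd i)"
    using color_transport[OF c'(1) c(1) n _ l] c'(2) c(4) e by (simp add: color_glue_def)
  ultimately show ?case using c'(1) l by blast
qed

lemma colorings_eqI:
  assumes b: "(\<sigma>, b) \<in> colored" and c: "(\<sigma>, c) \<in> colored"
    and eq: "\<And>k. k \<in> {0..d} \<Longrightarrow> color_vertex k (\<sigma>, b) = color_vertex k (\<sigma>, c)"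
  shows "b = c"
proof (rule extensionalityI[OF color_copyD(3)[OF b] color_copyD(3)[OF c]])
  fix v assume v: "v \<in> \<sigma>"
  then have k: "b v \<in> {0..d}" using color_copyD(2)[OF b] by (auto simp: bij_betw_def)
  have "color_vertex (b v) (\<sigma>, c) = (\<sigma>, v)"
    using eq[OF k] color_vertex_eqI[OF b, of v "b v"] v by simp
  then show "b v = c v" using color_vertex_copy(2)[OF c k] by simp
qed

lemma unram_iff: "C.unram \<kappa> \<longleftrightarrow> P.unram \<kappa>"
proof
  assume C: "C.unram \<kappa>"
  show "P.unram \<kappa>"
    unfolding unramified_at_def
  proof (intro allI impI, rule ccontr)
    fix \<sigma> v w assume vw: "P.around \<kappa> (\<sigma>, v) (\<sigma>, w)" and ne: "v \<noteq> w"
    have m: "(\<sigma>, v) \<in> marked" "\<sigma> \<in> facets K d" "v \<in> \<sigma>"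
      using glued_around_trivial_or_mem[OF vw] ne by (auto simp: vertex_copies_def)
    obtain b where b: "(\<sigma>, b) \<in> colored" using color_copy_exists[OF m(2)] by blast
    then obtain c where c: "C.around \<kappa> (\<sigma>, b) (\<sigma>, c)" "w \<in> \<sigma>" "c w = b v"
      using lift_around[OF vw m(1), of b] by auto
    then have "b w = b v" using C unfolding unramified_at_def by blast
    then have "v = w" using color_copyD(2)[OF b] m(3) c(2) by (metis bij_betw_imp_inj_on inj_onD)
    with ne show False ..
  qed
next
  assume P: "P.unram \<kappa>"
  show "C.unram \<kappa>"
    unfolding unramified_at_def
  proof (intro allI impI, rule ccontr)
    fix \<sigma> b c assume bc: "C.around \<kappa> (\<sigma>, b) (\<sigma>, c)" and ne: "b \<noteq> c"
    have m: "(\<sigma>, b) \<in> colored" "(\<sigma>, c) \<in> colored"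
      using glued_around_trivial_or_mem[OF bc] ne by auto
    have "color_vertex k (\<sigma>, b) = color_vertex k (\<sigma>, c)" if "k \<in> {0..d}" for k
      using color_vertex_around[OF bc that] P
      unfolding unramified_at_def color_vertex_def by simp
    with colorings_eqI[OF m] ne show False by blast
  qed
qed

lemma unramified_part_eq: "C.unramified_part = P.unramified_part"
  unfolding C.unramified_part_def P.unramified_part_def unram_iff ..

text \<open>All members of a class give the same point, so the union is over equal sets; this defines the
  map on classes without choosing representatives.\<close>

definition color_map :: "nat \<Rightarrow> (('v set \<times> ('v \<Rightarrow> nat)) \<times> ('v \<Rightarrow> real)) set \<Rightarrow> (('v set \<times> 'v) \<times> ('v \<Rightarrow> real)) set" where
  "color_map k A = (\<Union>a\<in>A. P.pt (color_vertex k (fst a)) (snd a))"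

lemma color_map_point:
  assumes i: "i \<in> colored" and x: "x \<in> simplex_pts (fst i)" and k: "k \<in> {0..d}"
  shows "color_map k (C.pt i x) = P.pt (color_vertex k i) x"
proof -
  have "P.pt (color_vertex k (fst a)) (snd a) = P.pt (color_vertex k i) x" if a: "a \<in> C.pt i x" for a
  proof -
    have "C.pt i x = C.pt (fst a) (snd a)"
      using a unfolding point_def by (simp, intro Collect_cong) (metis equivclp_sym equivclp_trans)
    then have e: "snd a = x" "C.around (supp x) i (fst a)"
      using C.point_eq_iff[OF i x, of "fst a" "snd a"] by auto
    have "P.pt (color_vertex k i) x = P.pt (color_vertex k (fst a)) x"
      using P.point_eq_iff[OF color_vertex_copy(1)[OF i k], of x "color_vertex k (fst a)" x] x
        color_vertex_around[OF e(2) k] by simp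
    then show ?thesis using e(1) by simp
  qed
  moreover have "(i, x) \<in> C.pt i x" by (simp add: point_def)
  ultimately show ?thesis unfolding color_map_def by fastforce
qed

lemma continuous_color_map: "k \<in> {0..d} \<Longrightarrow> continuous_map C.Y P.Y (color_map k)"
proof (rule C.continuous_map_from_Y)
  fix i assume i: "i \<in> colored" and k: "k \<in> {0..d}"
  have "continuous_map (top_of_set (simplex_pts (fst i))) P.Y (P.pt (color_vertex k i))"
    using P.continuous_point[OF color_vertex_copy(1)[OF i k]] by simp
  then show "continuous_map (top_of_set (simplex_pts (fst i))) P.Y (\<lambda>x. color_map k (C.pt i x))"
    by (rule continuous_map_eq) (simp add: color_map_point[OF i _ k])
qed

text \<open>Extending a facet path by one facet composes the projectivity with a perspectivity, which
  fixes the common ridge; so the two colorings agree there and their copies are glued.\<close>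

lemma color_copies_linked:
  assumes "facet_path K d \<eta>" "hd \<eta> = \<sigma>0"
  shows "C.around {} (\<sigma>0, restrict b0 \<sigma>0) (last \<eta>, restrict (b0 \<circ> projectivity (rev \<eta>)) (last \<eta>))"
  using assms
proof (induction \<eta> rule: rev_induct)
  case (snoc \<tau> \<eta>)
  show ?case
  proof (cases "\<eta> = []")
    case True
    then show ?thesis using snoc(3) glued_around_refl by simp
  next
    case False
    then have \<eta>: "facet_path K d \<eta>" "hd \<eta> = \<sigma>0" and n: "neighbors K d (last \<eta>) \<tau>"
      using snoc(2,3) by (auto simp: facet_path_def successively_append_iff)
    let ?i = "(last \<eta>, restrict (b0 \<circ> projectivity (rev \<eta>)) (last \<eta>))"
    let ?j = "(\<tau>, restrict (b0 \<circ> projectivity (rev (\<eta> @ [\<tau>]))) \<tau>)"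
    have "?i \<in> colored"
      using \<eta> neighbors_facets[OF n] unfolding color_copies_def admissible_def by blast
    moreover have "?j \<in> colored"
      using snoc(2,3) neighbors_facets[OF n] unfolding color_copies_def admissible_def
      by (auto intro!: exI[of _ "\<eta> @ [\<tau>]"])
    ultimately have "C.around {} ?i ?j"
      using n color_glue_snoc[OF \<eta>(1) n] by (intro glued_imp_around) (simp add: glued_def)
    from glued_around_trans[OF snoc(1)[OF \<eta>] this] show ?thesis by (simp only: last_snoc)
  qed
qed (simp add: facet_path_def)

lemma color_copies_all_linked:
  assumes "i \<in> colored"
  shows "C.around {} (\<sigma>0, restrict b0 \<sigma>0) i"
proof -
  obtain \<eta> where "facet_path K d \<eta>" "hd \<eta> = \<sigma>0" "last \<eta> = fst i"
      "snd i = restrict (b0 \<circ> projectivity (rev \<eta>)) (fst i)"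
    using assms by (auto simp: color_copies_def admissible_def)
  then show ?thesis using color_copies_linked[of \<eta>] by (metis prod.collapse)
qed

lemma connected_complete:
  assumes T: "C.generic T"
  shows "connectedin C.Y (preim C.Y C.g T)" "preim C.Y C.g T \<noteq> {}"
proof -
  let ?i = "(\<sigma>0, restrict b0 \<sigma>0)"
  have i: "?i \<in> colored"
  proof -
    have "facet_path K d [\<sigma>0]" using \<sigma>0 by (simp add: facet_path_def)
    then show ?thesis using \<sigma>0 unfolding color_copies_def admissible_def
      by (auto intro!: exI[of _ "[\<sigma>0]"])
  qed
  have full: "\<exists>x\<in>simplex_pts \<sigma> \<inter> UNIV. supp x = \<sigma>" if "\<sigma> \<in> facets K d \<union> ridges K d" for \<sigma>
  proof -
    have "\<sigma> \<in> K" using that facetD(1) ridgeD by blast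
    then have f: "finite \<sigma>" "\<sigma> \<noteq> {}" using finite_face face_nonempty by blast+
    then obtain z where "z \<in> simplex_pts \<sigma>" using simplex_pts_nonempty by blast
    from interior_point_near[OF f(1) this zero_less_one] show ?thesis by blast
  qed
  have eq: "{C.pt j x | j x. C.around {} ?i j \<and> x \<in> simplex_pts (fst j) \<inter> UNIV \<inter> T} = preim C.Y C.g T"
  proof
    show "{C.pt j x | j x. C.around {} ?i j \<and> x \<in> simplex_pts (fst j) \<inter> UNIV \<inter> T} \<subseteq> preim C.Y C.g T"
      using glued_around_mem(1)[OF _ i] C.point_in_preim by blast
    show "preim C.Y C.g T \<subseteq> {C.pt j x | j x. C.around {} ?i j \<and> x \<in> simplex_pts (fst j) \<inter> UNIV \<inter> T}"
    proof
      fix a assume a: "a \<in> preim C.Y C.g T"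
      then obtain j x where j: "j \<in> colored" "x \<in> simplex_pts (fst j)" "a = C.pt j x"
        unfolding preim_def C.topspace_Y by blast
      have "x \<in> T" using a C.point_in_preim[OF j(1,2)] j(3) by blast
      with j color_copies_all_linked[OF j(1)]
      show "a \<in> {C.pt j x | j x. C.around {} ?i j \<and> x \<in> simplex_pts (fst j) \<inter> UNIV \<inter> T}" by blast
    qed
  qed
  show "connectedin C.Y (preim C.Y C.g T)"
    using C.connectedin_copies[OF T i, of "{}" UNIV] full unfolding eq by simp
  obtain x where x: "x \<in> simplex_pts \<sigma>0" "supp x = \<sigma>0" using full[of \<sigma>0] \<sigma>0 by blast
  have "x \<in> topspace Z" using C.copy_point_Z[OF i] x(1) by simp
  then have "x \<in> T" using T \<sigma>0 x(2) unfolding C.generic_def by blast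
  then have "C.pt ?i x \<in> preim C.Y C.g T" using C.point_in_preim[OF i, of x T] x(1) by simp
  then show "preim C.Y C.g T \<noteq> {}" by blast
qed

lemma complete_is_regularization:
  "regularization_of (associated_space C.Y Z C.g) C.g (associated_space P.Y Z P.g) P.g
     (subtopology Z (ordinary_set P.Y Z P.g))"
proof -
  let ?O = "P.unramified_part"
  have O: "ordinary_set C.Y Z C.g = ?O" "ordinary_set P.Y Z P.g = ?O"
    using C.ordinary_set_eq P.ordinary_set_eq unramified_part_eq by auto
  let ?X = "associated_space C.Y Z C.g" and ?X' = "associated_space P.Y Z P.g"
  have X: "?X = subtopology C.Y (preim C.Y C.g ?O)" "?X' = subtopology P.Y (preim P.Y P.g ?O)"
    unfolding associated_space_def O by (rule refl)+
  have top: "topspace ?X = preim C.Y C.g ?O" "topspace ?X' = preim P.Y P.g ?O"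
    unfolding X by (rule C.topspace_preim, rule P.topspace_preim)
  have pointC: "\<exists>i x. i \<in> colored \<and> x \<in> simplex_pts (fst i) \<and> a = C.pt i x \<and> x \<in> ?O"
    if a: "a \<in> topspace ?X" for a
  proof -
    obtain i x where i: "i \<in> colored" "x \<in> simplex_pts (fst i)" "a = C.pt i x"
      using a unfolding top preim_def C.topspace_Y by blast
    moreover have "x \<in> ?O" using a C.point_in_preim[OF i(1,2)] i(3) unfolding top by blast
    ultimately show ?thesis by blast
  qed
  have gC: "P.g (color_map k a) = C.g a \<and> color_map k a \<in> topspace ?X'"
    if k: "k \<in> {0..d}" and a: "a \<in> topspace ?X" for k a
  proof -
    obtain i x where i: "i \<in> colored" "x \<in> simplex_pts (fst i)" "a = C.pt i x" "x \<in> ?O"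
      using pointC[OF a] by blast
    have "color_map k a = P.pt (color_vertex k i) x" using color_map_point[OF i(1,2) k] i(3) by simp
    then show ?thesis
      using i(2-4) P.point_in_preim[OF color_vertex_copy(1)[OF i(1) k], of x ?O] unfolding top by simp
  qed
  show ?thesis
  proof (rule regularization_of_by_maps[where M = "{0..d}" and C = color_map])
    show "covering_map ?X (subtopology Z (ordinary_set P.Y Z P.g)) C.g"
      using covering_map_ordinary_set[OF C.continuous_g] unfolding O .
    show "covering_map ?X' (subtopology Z (ordinary_set P.Y Z P.g)) P.g"
      by (rule covering_map_ordinary_set[OF P.continuous_g])
    have gen: "C.generic ?O" using C.generic_unramified_part unramified_part_eq by simp
    show "connected_space ?X" "topspace ?X \<noteq> {}"
      using connected_complete[OF gen] unfolding top unfolding X connectedin_def by auto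
    fix k assume k: "k \<in> {0..d}"
    have "color_map k \<in> topspace ?X \<rightarrow> preim P.Y P.g ?O" using gC[OF k] unfolding top by blast
    then show "continuous_map ?X ?X' (color_map k)"
      using continuous_map_from_subtopology[OF continuous_color_map[OF k]] top(1)
      unfolding X continuous_map_in_subtopology by (auto simp: C.topspace_preim)
  next
    show "P.g (color_map k a) = C.g a" if "k \<in> {0..d}" "a \<in> topspace ?X" for k a
      using gC[OF that] by blast
  next
    fix a a' assume a: "a \<in> topspace ?X" "a' \<in> topspace ?X'" and eq: "P.g a' = C.g a"
    obtain i x where i: "i \<in> colored" "x \<in> simplex_pts (fst i)" "a = C.pt i x"
      using pointC[OF a(1)] by blast
    obtain j y where "j \<in> marked" "y \<in> simplex_pts (fst j)" "a' = P.pt j y"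
      using a(2) unfolding top preim_def P.topspace_Y by blast
    moreover from this have "y = x" using eq i(3) by simp
    ultimately have j: "j \<in> marked" "x \<in> simplex_pts (fst j)" "a' = P.pt j x" by auto
    have xZ: "x \<in> topspace Z" by (rule C.copy_point_Z[OF i(1,2)])
    obtain w where w: "P.around (supp x) j (fst i, w)"
      using P.relabel_around[OF j(1) supp_in_K[OF xZ] P.copy_point_supp[OF j(1,2)] C.I_facets[OF i(1)]
        C.copy_point_supp[OF i(1,2)]] by blast
    have "(fst i, w) \<in> marked"
      by (rule glued_around_mem(1)[OF w j(1) P.copy_point_supp[OF j(1,2)]])
    then have wi: "w \<in> fst i" by (simp add: vertex_copies_def)
    have k: "snd i w \<in> {0..d}"
      using color_copyD(2)[of "fst i" "snd i"] i(1) wi by (auto simp: bij_betw_def)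
    have "color_map (snd i w) a = P.pt (fst i, w) x"
      using color_map_point[OF i(1,2) k] i(3) color_vertex_eqI[OF i(1) wi refl] by simp
    also have "\<dots> = a'" using P.point_eq_iff[OF j(1,2), of "(fst i, w)" x] w j(3) by simp
    finally show "\<exists>k\<in>{0..d}. a' = color_map k a" using k by blast
  next
    fix a a' assume a: "a \<in> topspace ?X" "a' \<in> topspace ?X" and eq: "C.g a = C.g a'"
      and cm: "\<And>k. k \<in> {0..d} \<Longrightarrow> color_map k a = color_map k a'"
    obtain i x where i: "i \<in> colored" "x \<in> simplex_pts (fst i)" "a = C.pt i x" "x \<in> ?O"
      using pointC[OF a(1)] by blast
    obtain j y where "j \<in> colored" "y \<in> simplex_pts (fst j)" "a' = C.pt j y"
      using pointC[OF a(2)] by blast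
    moreover from this have "y = x" using eq i(3) by simp
    ultimately have j: "j \<in> colored" "x \<in> simplex_pts (fst j)" "a' = C.pt j x" by auto
    have xZ: "x \<in> topspace Z" by (rule C.copy_point_Z[OF i(1,2)])
    note si = C.copy_point_supp[OF i(1,2)] and sj = C.copy_point_supp[OF j(1,2)]
    obtain c where c: "C.around (supp x) j (fst i, c)"
      using C.relabel_around[OF j(1) supp_in_K[OF xZ] sj C.I_facets[OF i(1)] si] by blast
    have ci: "(fst i, c) \<in> colored" by (rule glued_around_mem(1)[OF c j(1) sj])
    have a': "a' = C.pt (fst i, c) x" using C.point_eq_iff[OF j(1,2), of "(fst i, c)" x] c j(3) by simp
    have "color_vertex k (fst i, snd i) = color_vertex k (fst i, c)" if k: "k \<in> {0..d}" for k
    proof -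
      have "P.pt (color_vertex k i) x = P.pt (color_vertex k (fst i, c)) x"
        using cm[OF k] color_map_point[OF i(1,2) k] color_map_point[OF ci _ k, of x] i(2,3) a' by simp
      then have "P.around (supp x) (color_vertex k i) (color_vertex k (fst i, c))"
        using P.point_eq_iff[OF color_vertex_copy(1)[OF i(1) k], of x] i(2) by simp
      moreover have "P.unram (supp x)" using i(4) by (simp add: P.unramified_part_def)
      ultimately show ?thesis unfolding unramified_at_def color_vertex_def by simp
    qed
    then have "snd i = c" using colorings_eqI[of "fst i" "snd i" c] i(1) ci by simp
    then have "(fst i, c) = i" by (simp add: prod_eq_iff)
    then show "a = a'" using i(3) a' by simp
  qed
qed

end

theorem theorem4p2p1:
  fixes K :: "'v set set" and d :: nat and \<sigma>0 :: "'v set" and b0 :: "'v \<Rightarrow> nat"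
  assumes "abstract_complex K" and "locally_finite K" and "pure K d"
    and "strongly_connected K d" and "nice K d"
    and "\<sigma>0 \<in> facets K d" and "bij_betw b0 \<sigma>0 {0..d}"
  shows "branched_regularization_of
           (complete_unfolding K d \<sigma>0 b0) unfolding_map
           (partial_unfolding K d) unfolding_map
           (realization K)"
proof -
  interpret colored_complex K d \<sigma>0 b0
    using assms by unfold_locales (auto simp: nice_def)
  have Y: "complete_unfolding K d \<sigma>0 b0 = C.Y" "partial_unfolding K d = P.Y"
    by (simp_all add: complete_unfolding_def partial_unfolding_def color_copies_def color_glue_def
        vertex_copies_def vertex_glue_def)
  have "ordinary_set C.Y Z C.g = ordinary_set P.Y Z P.g"
    using C.ordinary_set_eq P.ordinary_set_eq unramified_part_eq by simp
  then show ?thesis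
    unfolding branched_regularization_of_def Y
    using C.branched_covering_Y P.branched_covering_Y complete_is_regularization by blast
qed

end
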